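(* Suppose that the following holds: for all $n\ge 2$ and all polynomial maps $F:\mathbb{R}^n\to\mathbb{R}^n$ of the form $$F=(-X_1+H_1,\,-X_2+H_2,\,\ldots,\,-X_n+H_n),$$ where $X_i$ denotes the canonical $i$-th coordinate function, each $H_i:\mathbb{R}^n\to\mathbb{R}$ is either zero or a homogeneous polynomial of degree $3$, and the Jacobian matrix $JH$ of $H=(H_1,\ldots,H_n)$ is nilpotent, if $\operatorname{codim}(S_F)\ge 2$ then $F$ is injective. Then the Jacobian Conjecture is true, that is: for every $n$, every polynomial mapping $Y:\mathbb{C}^n\to\mathbb{C}^n$ with nonzero Jacobian everywhere is an isomorphism.
   Context: For a continuous map $Y:M\to N$ of locally compact spaces, $Y$ is said to be not proper at a point $y\in N$ if there is no neighborhood $U$ of $y$ such that $Y^{-1}(\overline{U})$ is compact. $S_Y\subset N$ denotes the set of points at which $Y$ is not proper. For a polynomial map $F:\mathbb{R}^n\to\mathbb{R}^n$, $S_F$ is a semi-algebraic set, and $\operatorname{codim}(S_F)=n-\dim(S_F)$ is its real codimension in $\mathbb{R}^n$; if $S_F=\emptyset$ the condition $\operatorname{codim}(S_F)\ge 2$ is regarded as satisfied. "Jacobian" means the determinant of the Jacobian matrix. An isomorphism $\mathbb{C}^n\to\mathbb{C}^n$ is a bijective polynomial map whose inverse is also polynomial. *)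

theory Defs
  imports
    "HOL-Analysis.Abstract_Euclidean_Space"
    "HOL-Library.Poly_Mapping"
    "Jordan_Normal_Form.Determinant"
begin

section \<open>Polynomials in finitely many variables\<close>

text \<open>
  The dimension \<open>n\<close> is quantified inside the statement, so it cannot be a type.  A point of
  \<open>R^n\<close> or \<open>C^n\<close> is a function on \<open>nat\<close> vanishing from index \<open>n\<close> on, as in
  \<^const>\<open>Euclidean_space\<close>; variables are numbered from \<open>0\<close> to \<open>n - 1\<close>.
  A polynomial is a finitely supported map from monomials (finitely supported exponent maps)
  to coefficients; the library supplies the ring structure.
\<close>

type_synonym 'a mpoly = "(nat \<Rightarrow>\<^sub>0 nat) \<Rightarrow>\<^sub>0 'a"

definition coord_space :: "nat \<Rightarrow> (nat \<Rightarrow> 'a::zero) set" where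
  "coord_space n = {x. \<forall>i\<ge>n. x i = 0}"

lemma topspace_Euclidean_space_coord_space: "topspace (Euclidean_space n) = coord_space n"
  by (simp add: topspace_Euclidean_space coord_space_def)

definition mpolys :: "nat \<Rightarrow> 'a::zero mpoly set" where
  "mpolys n = {p. \<forall>m\<in>Poly_Mapping.keys p. Poly_Mapping.keys m \<subseteq> {..<n}}"

definition mvar :: "nat \<Rightarrow> 'a::{zero,one} mpoly" where
  "mvar i = Poly_Mapping.single (Poly_Mapping.single i 1) 1"

definition mdeg :: "(nat \<Rightarrow>\<^sub>0 nat) \<Rightarrow> nat" where
  "mdeg m = (\<Sum>i\<in>Poly_Mapping.keys m. Poly_Mapping.lookup m i)"

text \<open>The zero polynomial is homogeneous of every degree in this sense.\<close>

definition homogeneous :: "nat \<Rightarrow> 'a::zero mpoly \<Rightarrow> bool" where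
  "homogeneous d p \<longleftrightarrow> (\<forall>m\<in>Poly_Mapping.keys p. mdeg m = d)"

definition meval :: "(nat \<Rightarrow> 'a) \<Rightarrow> 'a::comm_semiring_1 mpoly \<Rightarrow> 'a" where
  "meval x p = (\<Sum>m\<in>Poly_Mapping.keys p.
     Poly_Mapping.lookup p m * (\<Prod>i\<in>Poly_Mapping.keys m. x i ^ Poly_Mapping.lookup m i))"

text \<open>
  Formal partial derivative.  If variable \<open>i\<close> does not occur in \<open>m\<close>, the truncated
  subtraction of exponents is harmless because the coefficient is \<open>0\<close>.
\<close>

definition mpderiv :: "nat \<Rightarrow> 'a::comm_semiring_1 mpoly \<Rightarrow> 'a mpoly" where
  "mpderiv i p = (\<Sum>m\<in>Poly_Mapping.keys p.
     Poly_Mapping.single (m - Poly_Mapping.single i 1)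
       (of_nat (Poly_Mapping.lookup m i) * Poly_Mapping.lookup p m))"


section \<open>Polynomial maps\<close>

text \<open>Only the components \<open>F 0\<close>, ..., \<open>F (n - 1)\<close> are relevant.\<close>

definition polymap :: "nat \<Rightarrow> (nat \<Rightarrow> 'a::comm_semiring_1 mpoly) \<Rightarrow> (nat \<Rightarrow> 'a) \<Rightarrow> nat \<Rightarrow> 'a" where
  "polymap n F x = (\<lambda>i. if i < n then meval x (F i) else 0)"

definition jacobian_mat :: "nat \<Rightarrow> (nat \<Rightarrow> 'a::comm_ring_1 mpoly) \<Rightarrow> 'a mpoly mat" where
  "jacobian_mat n F = mat n n (\<lambda>(i, j). mpderiv j (F i))"

definition nilpotent_mat :: "'a::semiring_1 mat \<Rightarrow> bool" where
  "nilpotent_mat A \<longleftrightarrow> (\<exists>k. A ^\<^sub>m k = 0\<^sub>m (dim_row A) (dim_col A))"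

definition polynomial_isomorphism :: "nat \<Rightarrow> (nat \<Rightarrow> 'a::comm_semiring_1 mpoly) \<Rightarrow> bool" where
  "polynomial_isomorphism n F \<longleftrightarrow>
     bij_betw (polymap n F) (coord_space n) (coord_space n) \<and>
     (\<exists>G. (\<forall>i<n. G i \<in> mpolys n) \<and>
       (\<forall>y\<in>coord_space n. polymap n G y = inv_into (coord_space n) (polymap n F) y))"


section \<open>Points at which a map is not proper\<close>

definition nonproper_set :: "'a topology \<Rightarrow> 'b topology \<Rightarrow> ('a \<Rightarrow> 'b) \<Rightarrow> 'b set" where
  "nonproper_set X Y f = {y \<in> topspace Y.
     \<not> (\<exists>U V. openin Y V \<and> y \<in> V \<and> V \<subseteq> U \<and> U \<subseteq> topspace Y \<and>
           compactin X {x \<in> topspace X. f x \<in> Y closure_of U})}"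


section \<open>Dimension of semi-algebraic sets\<close>

inductive semialgebraic :: "nat \<Rightarrow> (nat \<Rightarrow> real) set \<Rightarrow> bool" for n :: nat where
  eq: "p \<in> mpolys n \<Longrightarrow> semialgebraic n {x \<in> coord_space n. meval x p = 0}"
| pos: "p \<in> mpolys n \<Longrightarrow> semialgebraic n {x \<in> coord_space n. meval x p > 0}"
| un: "semialgebraic n A \<Longrightarrow> semialgebraic n B \<Longrightarrow> semialgebraic n (A \<union> B)"
| compl: "semialgebraic n A \<Longrightarrow> semialgebraic n (coord_space n - A)"

definition open_cube :: "nat \<Rightarrow> (nat \<Rightarrow> real) set" where
  "open_cube d = {x \<in> coord_space d. \<forall>i<d. 0 < x i \<and> x i < 1}"

text \<open>The graph of a map from a subset \<open>A\<close> of \<open>R^d\<close>, as a subset of \<open>R^(d + n)\<close>.\<close>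

definition graph_on :: "nat \<Rightarrow> (nat \<Rightarrow> real) set \<Rightarrow> ((nat \<Rightarrow> real) \<Rightarrow> nat \<Rightarrow> real) \<Rightarrow> (nat \<Rightarrow> real) set" where
  "graph_on d A f = (\<lambda>x i. if i < d then x i else f x (i - d)) ` A"

text \<open>\<open>C\<close> is a subset of \<open>R^n\<close> semi-algebraically homeomorphic to \<open>(0, 1)^d\<close>.\<close>

definition semialgebraic_cell :: "nat \<Rightarrow> nat \<Rightarrow> (nat \<Rightarrow> real) set \<Rightarrow> bool" where
  "semialgebraic_cell n d C \<longleftrightarrow> C \<subseteq> coord_space n \<and>
     (\<exists>\<phi>. homeomorphic_map (subtopology (Euclidean_space d) (open_cube d))
                           (subtopology (Euclidean_space n) C) \<phi> \<and>
          semialgebraic (d + n) (graph_on d (open_cube d) \<phi>))"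

text \<open>
  Every semi-algebraic set is a finite disjoint union of cells semi-algebraically homeomorphic
  to some \<open>(0, 1)^d\<close>; its dimension is the largest \<open>d\<close> that occurs, equivalently (and
  independently of a decomposition) the largest \<open>d\<close> for which it contains such a cell
  (Bochnak--Coste--Roy, Real Algebraic Geometry, Sections 2.3 and 2.8).
  The value is meaningful only for nonempty sets.
\<close>

definition semialgebraic_dim :: "nat \<Rightarrow> (nat \<Rightarrow> real) set \<Rightarrow> nat" where
  "semialgebraic_dim n A = (GREATEST d. \<exists>C\<subseteq>A. semialgebraic_cell n d C)"

definition real_codim :: "nat \<Rightarrow> (nat \<Rightarrow> real) set \<Rightarrow> nat" where
  "real_codim n A = n - semialgebraic_dim n A"

end

theory Submission
imports Defs "HOL-Complex_Analysis.Complex_Analysis" "HOL-Homology.Homology" "Jordan_Normal_Form.Schur_Decomposition"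
begin

text \<open>
  Call a polynomial map \<^emph>\<open>etale\<close> if its differential is injective at every point;
  for a square system over a field this means that the Jacobian does not vanish. The proof shows that
  the hypothesis makes every etale complex map injective, and that an injective etale complex map is an
  isomorphism.

  \<^emph>\<open>Etale implies injective.\<close> The classical reductions of Bass, Connell, Wright and
  Yagzhev trade degree for variables. A monomial \<open>cPQ\<close> of the component
  \<open>F\<^sub>k\<close> is removed by two new variables: \<open>F\<^sub>k\<close> becomes
  \<open>F\<^sub>k - c(P + u)(Q + v)\<close> and the components \<open>P + u\<close>, \<open>Q +
  v\<close> are added. The new map is again etale, and two points with the same image lift to such
  points, with \<open>u = -P\<close> and \<open>v = -Q\<close>. This leads to degree three and, after a
  normalization at the origin and one more step of the same kind, to a map \<open>-X + H\<close> with
  \<open>H\<close> cubic homogeneous. Scaling the point shows that \<open>JH\<close> has no eigenvalue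
  except \<open>0\<close>, so it is nilpotent. The hypothesis applies to the underlying real map,
  because a complex etale map \<open>F\<close> is proper outside a complex hypersurface \<open>a =
  0\<close>: each coordinate \<open>x\<^sub>i\<close> satisfies a polynomial equation over
  \<open>\<complex>[F]\<close>, and \<open>a\<close> is the product of the leading coefficients. A
  complex hypersurface has real codimension two: otherwise, at a suitable smooth point, invariance of
  domain would be violated.

  \<^emph>\<open>Injective implies invertible.\<close> Over \<open>a \<noteq> 0\<close> the image of an
  injective etale map \<open>F\<close> is open and closed, hence everything, and the inverse
  \<open>G\<close> is holomorphic there. The functions \<open>aG\<^sub>i\<close> have polynomial growth,
  so they are polynomials. It remains to get rid of the denominator. Along the lines \<open>y +
  se\<close> with a fixed general direction \<open>e\<close>, let \<open>q(y, s)\<close> be a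
  denominator of least degree in \<open>s\<close>. By minimality, \<open>q\<close> can vanish on the
  image of \<open>F\<close> only if some fixed nonzero polynomial \<open>r(y)\<close> vanishes too. Up
  to a factor in \<open>\<complex>[y]\<close>, \<open>q\<close> is monic in \<open>s\<close>, so its
  roots move continuously with \<open>y\<close>; if \<open>q\<close> depended on \<open>s\<close>, then
  \<open>q\<close>, pulled back by \<open>F\<close>, would have a zero, which could be moved off
  \<open>r = 0\<close>, since the image is open. Hence \<open>q\<close> does not involve
  \<open>s\<close>, so \<open>G\<close> is polynomial on almost every line in direction
  \<open>e\<close>; by the maximum principle \<open>G\<close> itself has polynomial growth, and is
  therefore polynomial.
\<close>

text \<open>From here on \<open>det\<close> belongs to matrices of variable size, \<open>coeff\<close>, \<open>monom\<close> and \<open>degree\<close> to univariate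
  polynomials.\<close>

hide_const (open) Determinants.det up_ring.coeff up_ring.monom Poly_Mapping.degree

abbreviation "lookup \<equiv> Poly_Mapping.lookup"
abbreviation "keys \<equiv> Poly_Mapping.keys"
abbreviation "single \<equiv> Poly_Mapping.single"

section \<open>Substitution into polynomials\<close>

definition mconst :: "'a::zero \<Rightarrow> 'a mpoly" where
  "mconst c = single 0 c"

lemma mconst_1 [simp]: "mconst (1::'a::zero_neq_one) = 1"
  by (simp add: mconst_def)

definition monomial_value :: "(nat \<Rightarrow> 'b::comm_semiring_1) \<Rightarrow> (nat \<Rightarrow>\<^sub>0 nat) \<Rightarrow> 'b" where
  "monomial_value x m = (\<Prod>i\<in>keys m. x i ^ lookup m i)"

text \<open>
  Evaluation at a point, substitution of polynomials and substitution of univariate polynomials over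
  polynomials are the instances that occur, with three different coefficient maps \<open>h\<close>.
\<close>

definition msubst :: "('a::zero \<Rightarrow> 'b) \<Rightarrow> (nat \<Rightarrow> 'b::comm_semiring_1) \<Rightarrow> 'a mpoly \<Rightarrow> 'b" where
  "msubst h x p = (\<Sum>m\<in>keys p. h (lookup p m) * monomial_value x m)"

lemma meval_eq_msubst: "meval x p = msubst (\<lambda>c. c) x p"
  by (simp add: meval_def msubst_def monomial_value_def)

lemma monomial_value_superset:
  "finite A \<Longrightarrow> keys m \<subseteq> A \<Longrightarrow> monomial_value x m = (\<Prod>i\<in>A. x i ^ lookup m i)"
  unfolding monomial_value_def
  by (rule prod.mono_neutral_left) (auto simp: in_keys_iff)

lemma monomial_value_0 [simp]: "monomial_value x 0 = 1"
  by (simp add: monomial_value_def)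

lemma monomial_value_add: "monomial_value x (m + m') = monomial_value x m * monomial_value x m'"
proof -
  let ?A = "keys m \<union> keys m'"
  have "keys (m + m') \<subseteq> ?A" by (rule keys_add)
  then show ?thesis
    by (simp add: monomial_value_superset[of ?A] lookup_add power_add prod.distrib)
qed

lemma monomial_value_single [simp]: "monomial_value x (single i k) = x i ^ k"
  by (simp add: monomial_value_def)

lemma mpoly_sum_monomials: "p = (\<Sum>m\<in>keys p. single m (lookup p m))" for p :: "'a::comm_monoid_add mpoly"
proof (rule poly_mapping_eqI)
  fix k
  show "lookup p k = lookup (\<Sum>m\<in>keys p. single m (lookup p m)) k"
    by (auto simp: lookup_sum lookup_single when_def in_keys_iff sum.delta)
qed

context comm_semiring_hom
begin

lemma msubst_add: "msubst hom x (p + q) = msubst hom x p + msubst hom x q"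
  unfolding msubst_def
  by (rule setsum_keys_plus_distrib) (auto simp: hom_distribs algebra_simps)

lemma msubst_zero [simp]: "msubst hom x 0 = 0"
  by (simp add: msubst_def)

lemma msubst_sum: "msubst hom x (sum f A) = (\<Sum>a\<in>A. msubst hom x (f a))"
  by (induction A rule: infinite_finite_induct) (auto simp: msubst_add)

lemma msubst_single: "msubst hom x (single m c) = hom c * monomial_value x m"
  by (cases "c = 0") (auto simp: msubst_def)

lemma msubst_mult: "msubst hom x (p * q) = msubst hom x p * msubst hom x q"
proof -
  have "p * q = (\<Sum>m\<in>keys p. \<Sum>m'\<in>keys q. single (m + m') (lookup p m * lookup q m'))"
    by (subst mpoly_sum_monomials[of p], subst mpoly_sum_monomials[of q])
      (simp add: sum_product mult_single)
  then have "msubst hom x (p * q) = (\<Sum>m\<in>keys p. \<Sum>m'\<in>keys q.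
      (hom (lookup p m) * monomial_value x m) * (hom (lookup q m') * monomial_value x m'))"
    by (simp add: msubst_sum msubst_single monomial_value_add hom_distribs mult_ac)
  then show ?thesis by (simp add: msubst_def sum_product)
qed

lemma msubst_mconst [simp]: "msubst hom x (mconst c) = hom c"
  by (simp add: mconst_def msubst_single)

lemma msubst_mvar [simp]: "msubst hom x (mvar i) = x i"
  by (simp add: mvar_def msubst_single)

lemma msubst_one [simp]: "msubst hom x 1 = 1"
  using msubst_mconst[of x 1] by (simp add: mconst_def)

lemma msubst_power: "msubst hom x (p ^ k) = msubst hom x p ^ k"
  by (induction k) (auto simp: msubst_mult)

lemma msubst_prod: "msubst hom x (prod f A) = (\<Prod>a\<in>A. msubst hom x (f a))"
  by (induction A rule: infinite_finite_induct) (auto simp: msubst_mult)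

end

lemma comm_semiring_hom_id: "comm_semiring_hom (\<lambda>c::'a::comm_semiring_1. c)"
  by unfold_locales simp_all

lemmas meval_add = comm_semiring_hom.msubst_add[OF comm_semiring_hom_id, folded meval_eq_msubst]
  and meval_mult = comm_semiring_hom.msubst_mult[OF comm_semiring_hom_id, folded meval_eq_msubst]
  and meval_0 [simp] = comm_semiring_hom.msubst_zero[OF comm_semiring_hom_id, folded meval_eq_msubst]
  and meval_1 [simp] = comm_semiring_hom.msubst_one[OF comm_semiring_hom_id, folded meval_eq_msubst]
  and meval_sum = comm_semiring_hom.msubst_sum[OF comm_semiring_hom_id, folded meval_eq_msubst]
  and meval_prod = comm_semiring_hom.msubst_prod[OF comm_semiring_hom_id, folded meval_eq_msubst]
  and meval_power = comm_semiring_hom.msubst_power[OF comm_semiring_hom_id, folded meval_eq_msubst]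
  and meval_mconst [simp] = comm_semiring_hom.msubst_mconst[OF comm_semiring_hom_id, folded meval_eq_msubst]
  and meval_mvar [simp] = comm_semiring_hom.msubst_mvar[OF comm_semiring_hom_id, folded meval_eq_msubst]
  and meval_single = comm_semiring_hom.msubst_single[OF comm_semiring_hom_id, folded meval_eq_msubst]

lemma comm_ring_hom_meval: "comm_ring_hom (meval (x :: nat \<Rightarrow> 'a::comm_ring_1))"
  by unfold_locales (simp_all add: meval_add meval_mult)

lemma meval_uminus: "meval x (- p) = - meval x p" for p :: "'a::comm_ring_1 mpoly"
  using meval_add[of x p "- p"] by (simp add: eq_neg_iff_add_eq_0 add.commute)

lemma meval_minus: "meval x (p - q) = meval x p - meval x q" for p :: "'a::comm_ring_1 mpoly"
  using meval_add[of x p "- q"] by (simp add: meval_uminus)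

lemmas meval_simps = meval_add meval_mult meval_sum meval_prod meval_power meval_uminus meval_minus

lemma mpolys_add: "p \<in> mpolys n \<Longrightarrow> q \<in> mpolys n \<Longrightarrow> p + q \<in> mpolys n" for p q :: "'a::monoid_add mpoly"
  using keys_add[of p q] by (fastforce simp: mpolys_def)

lemma mpolys_0 [simp]: "0 \<in> mpolys n"
  by (auto simp: mpolys_def)

lemma mpolys_single: "keys m \<subseteq> {..<n} \<Longrightarrow> single m c \<in> mpolys n"
  by (auto simp: mpolys_def)

lemma mpolys_mconst [simp]: "mconst c \<in> mpolys n"
  by (auto simp: mpolys_def mconst_def)

lemma mpolys_1 [simp]: "(1 :: 'a::zero_neq_one mpoly) \<in> mpolys n"
  unfolding mconst_1[symmetric] by (rule mpolys_mconst)

lemma mpolys_mvar: "i < n \<Longrightarrow> mvar i \<in> mpolys n"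
  by (auto simp: mvar_def intro!: mpolys_single split: if_splits)

lemma mpolys_mult: "p \<in> mpolys n \<Longrightarrow> q \<in> mpolys n \<Longrightarrow> p * q \<in> mpolys n" for p q :: "'a::semiring_0 mpoly"
proof -
  assume "p \<in> mpolys n" "q \<in> mpolys n"
  then have "keys (a + b) \<subseteq> {..<n}" if "a \<in> keys p" "b \<in> keys q" for a b
    using keys_add[of a b] that unfolding mpolys_def by blast
  with keys_mult[of p q] show ?thesis by (fastforce simp: mpolys_def)
qed

lemma mpolys_uminus: "p \<in> mpolys n \<Longrightarrow> - p \<in> mpolys n" for p :: "'a::ab_group_add mpoly"
  by (auto simp: mpolys_def in_keys_iff)

lemma mpolys_minus: "p \<in> mpolys n \<Longrightarrow> q \<in> mpolys n \<Longrightarrow> p - q \<in> mpolys n" for p q :: "'a::ab_group_add mpoly"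
  using mpolys_add[OF _ mpolys_uminus, of p n q] by simp

lemma mpolys_sum: "(\<And>a. a \<in> A \<Longrightarrow> f a \<in> mpolys n) \<Longrightarrow> sum f A \<in> mpolys n" for f :: "_ \<Rightarrow> 'a::comm_monoid_add mpoly"
  by (induction A rule: infinite_finite_induct) (auto intro: mpolys_add)

lemma mpolys_prod: "(\<And>a. a \<in> A \<Longrightarrow> f a \<in> mpolys n) \<Longrightarrow> prod f A \<in> mpolys n" for f :: "_ \<Rightarrow> 'a::comm_semiring_1 mpoly"
  by (induction A rule: infinite_finite_induct) (auto intro: mpolys_mult)

lemma mpolys_power: "p \<in> mpolys n \<Longrightarrow> p ^ k \<in> mpolys n" for p :: "'a::comm_semiring_1 mpoly"
  by (induction k) (auto intro: mpolys_mult)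

lemma mpolys_mono: "p \<in> mpolys n \<Longrightarrow> n \<le> k \<Longrightarrow> p \<in> mpolys k"
  by (fastforce simp: mpolys_def)

lemmas mpolys_intros = mpolys_add mpolys_mult mpolys_uminus mpolys_minus mpolys_sum mpolys_prod mpolys_power mpolys_mvar
  mpolys_mconst mpolys_0 mpolys_1

lemma single_eq_mvars:
  "finite A \<Longrightarrow> keys m \<subseteq> A \<Longrightarrow> single m c = mconst c * (\<Prod>i\<in>A. mvar i ^ lookup m i)" for c :: "'a::comm_semiring_1"
proof -
  have pw: "(mvar i :: 'a mpoly) ^ k = single (single i k) 1" for i k
    by (induction k) (simp_all add: mvar_def mult_single single_add[symmetric])
  have "(\<Prod>i\<in>A. (mvar i :: 'a mpoly) ^ lookup m i) = single (\<Sum>i\<in>A. single i (lookup m i)) 1" if "finite A" for A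
    using that by (induction A) (auto simp: pw mult_single)
  moreover have "(\<Sum>i\<in>A. single i (lookup m i)) = m" if "finite A" "keys m \<subseteq> A"
  proof (rule poly_mapping_eqI)
    fix k
    show "lookup (\<Sum>i\<in>A. single i (lookup m i)) k = lookup m k"
      using that by (auto simp: lookup_sum lookup_single when_def in_keys_iff sum.delta subset_iff)
  qed
  moreover assume "finite A" "keys m \<subseteq> A"
  ultimately show ?thesis by (simp add: mconst_def mult_single)
qed

text \<open>
  Evaluation, differentiation and substitution respect sums and products, so this rule replaces
  computations with coefficients.
\<close>

lemma mpolys_induct [consumes 1, case_names const var add mult]:
  fixes p :: "'a::comm_semiring_1 mpoly"
  assumes p: "p \<in> mpolys n"
    and const: "\<And>c. P (mconst c)" and var: "\<And>i. i < n \<Longrightarrow> P (mvar i)"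
    and add: "\<And>p q. p \<in> mpolys n \<Longrightarrow> q \<in> mpolys n \<Longrightarrow> P p \<Longrightarrow> P q \<Longrightarrow> P (p + q)"
    and mult: "\<And>p q. p \<in> mpolys n \<Longrightarrow> q \<in> mpolys n \<Longrightarrow> P p \<Longrightarrow> P q \<Longrightarrow> P (p * q)"
  shows "P p"
proof -
  define Q where "Q p \<longleftrightarrow> p \<in> mpolys n \<and> P p" for p
  have one: "Q 1" using const[of 1] by (simp add: Q_def mconst_def)
  have zero: "Q 0" using const[of 0] by (simp add: Q_def mconst_def)
  have pw: "Q (mvar i ^ k)" if "i < n" for i k
    by (induction k) (use one that in \<open>auto simp: Q_def intro: mult var mpolys_mvar mpolys_mult\<close>)
  have pr: "Q (\<Prod>i\<in>A. mvar i ^ lookup m i)" if "finite A" "A \<subseteq> {..<n}" for A m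
    using that by (induction A) (use one pw in \<open>auto simp: Q_def intro: mult mpolys_mult\<close>)
  have s: "Q (single m c)" if "keys m \<subseteq> {..<n}" for m c
    using pr[of "{..<n}" m] that unfolding single_eq_mvars[OF finite_lessThan that]
    by (auto simp: Q_def intro: mult mpolys_mult const)
  have sm: "Q (\<Sum>m\<in>A. single m (lookup p m))" if "finite A" "A \<subseteq> keys p" for A
    using that
  proof (induction A)
    case empty
    then show ?case using zero by simp
  next
    case (insert m A)
    have "Q (single m (lookup p m))" using p insert by (intro s) (auto simp: mpolys_def)
    with insert show ?case by (auto simp: Q_def intro: add mpolys_add)
  qed
  show ?thesis using sm[of "keys p"] mpoly_sum_monomials[of p] by (simp add: Q_def)
qed

lemma mpolys_exists: "\<exists>n. p \<in> mpolys n"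
proof -
  have "finite (\<Union>m\<in>keys p. keys m)" by simp
  then obtain n where "(\<Union>m\<in>keys p. keys m) \<subseteq> {..<n}"
    by (meson finite_nat_iff_bounded)
  then show ?thesis by (intro exI[of _ n]) (auto simp: mpolys_def)
qed

lemma meval_cong: "p \<in> mpolys n \<Longrightarrow> (\<And>i. i < n \<Longrightarrow> x i = y i) \<Longrightarrow> meval x p = meval y p"
  by (induction p rule: mpolys_induct) (auto simp: meval_simps)

section \<open>Derivatives and vanishing polynomials\<close>

lemma lookup_mpderiv: "lookup (mpderiv i p) m = of_nat (Suc (lookup m i)) * lookup p (m + single i 1)"
proof -
  have *: "lookup (single (k - single i 1) (of_nat (lookup k i) * lookup p k)) m
      = (if k = m + single i 1 then of_nat (lookup k i) * lookup p k else 0)" for k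
  proof (cases "lookup k i = 0")
    case True
    then have "k \<noteq> m + single i 1" by (auto simp: lookup_add)
    then show ?thesis using True by simp
  next
    case False
    have "k - single i 1 + single i 1 = k"
    proof (rule poly_mapping_eqI)
      fix j show "lookup (k - single i 1 + single i 1) j = lookup k j"
        using False by (cases "i = j") (auto simp: lookup_add lookup_minus lookup_single when_def)
    qed
    then have "k - single i 1 = m \<longleftrightarrow> k = m + single i 1" by auto
    then show ?thesis by (auto simp: lookup_single when_def)
  qed
  show ?thesis
    unfolding mpderiv_def lookup_sum * by (auto simp: sum.delta lookup_add in_keys_iff)
qed

lemma mpderiv_add: "mpderiv i (p + q) = mpderiv i p + mpderiv i q"
  by (rule poly_mapping_eqI) (simp add: lookup_mpderiv lookup_add algebra_simps)

lemma mpderiv_0 [simp]: "mpderiv i 0 = 0"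
  by (simp add: mpderiv_def)

lemma mpderiv_sum: "mpderiv i (sum f A) = (\<Sum>a\<in>A. mpderiv i (f a))"
  by (induction A rule: infinite_finite_induct) (auto simp: mpderiv_add)

lemma mpderiv_single: "mpderiv i (single m c) = single (m - single i 1) (of_nat (lookup m i) * c)"
  by (cases "c = 0") (auto simp: mpderiv_def)

lemma mpderiv_mult: "mpderiv i (p * q) = mpderiv i p * q + p * mpderiv i q"
proof -
  have aux: "mpderiv i (single m c * single k d) = mpderiv i (single m c) * single k d + single m c * mpderiv i (single k d)"
    for m k and c d :: 'a
  proof -
    have A: "m - single i 1 + k = m + k - single i 1" if "lookup m i \<noteq> 0" for m k :: "nat \<Rightarrow>\<^sub>0 nat"
      by (rule poly_mapping_eqI) (use that in \<open>auto simp: lookup_add lookup_minus lookup_single when_def\<close>)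
    have B: "m + (k - single i 1) = m + k - single i 1" if "lookup k i \<noteq> 0"
      using A[OF that, of m] by (simp add: add.commute)
    show ?thesis
    proof (cases "lookup m i = 0"; cases "lookup k i = 0")
      assume "lookup m i = 0" "lookup k i = 0"
      then show ?thesis by (simp add: mpderiv_single mult_single lookup_add)
    next
      assume "lookup m i = 0" "lookup k i \<noteq> 0"
      with B show ?thesis by (simp add: mpderiv_single mult_single lookup_add mult.left_commute)
    next
      assume "lookup m i \<noteq> 0" "lookup k i = 0"
      with A[of m k] show ?thesis by (simp add: mpderiv_single mult_single lookup_add mult.assoc)
    next
      assume "lookup m i \<noteq> 0" "lookup k i \<noteq> 0"
      with A[of m k] B show ?thesis
        by (simp add: mpderiv_single mult_single lookup_add algebra_simps single_add[symmetric])
    qed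
  qed
  have "p * q = (\<Sum>m\<in>keys p. \<Sum>k\<in>keys q. single m (lookup p m) * single k (lookup q k))"
    by (subst mpoly_sum_monomials[of p], subst mpoly_sum_monomials[of q]) (simp add: sum_product)
  then have "mpderiv i (p * q) = (\<Sum>m\<in>keys p. \<Sum>k\<in>keys q. mpderiv i (single m (lookup p m)) * single k (lookup q k))
     + (\<Sum>m\<in>keys p. \<Sum>k\<in>keys q. single m (lookup p m) * mpderiv i (single k (lookup q k)))"
    by (simp add: mpderiv_sum aux sum.distrib)
  also have "\<dots> = mpderiv i (\<Sum>m\<in>keys p. single m (lookup p m)) * (\<Sum>k\<in>keys q. single k (lookup q k))
      + (\<Sum>m\<in>keys p. single m (lookup p m)) * mpderiv i (\<Sum>k\<in>keys q. single k (lookup q k))"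
    by (simp add: mpderiv_sum sum_product)
  finally show ?thesis by (simp flip: mpoly_sum_monomials)
qed

lemma mpderiv_mconst [simp]: "mpderiv i (mconst c) = 0"
  by (simp add: mconst_def mpderiv_single)

lemma mpderiv_mvar: "mpderiv i (mvar j) = (if i = j then 1 else 0)"
  by (auto simp: mvar_def mpderiv_single lookup_single when_def)

lemma mpderiv_uminus: "mpderiv i (- p) = - mpderiv i p" for p :: "'a::comm_ring_1 mpoly"
  by (rule poly_mapping_eqI) (simp add: lookup_mpderiv)

lemma mpderiv_minus: "mpderiv i (p - q) = mpderiv i p - mpderiv i q" for p :: "'a::comm_ring_1 mpoly"
  using mpderiv_add[of i p "- q"] by (simp add: mpderiv_uminus)

lemmas mpderiv_simps = mpderiv_add mpderiv_mult mpderiv_sum mpderiv_uminus mpderiv_minus mpderiv_mvar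

lemma mpolys_mpderiv: "p \<in> mpolys n \<Longrightarrow> mpderiv i p \<in> mpolys n" for p :: "'a::comm_semiring_1 mpoly"
  by (induction p rule: mpolys_induct) (auto simp: mpderiv_simps intro!: mpolys_intros)

lemma mpderiv_outside: "p \<in> mpolys n \<Longrightarrow> n \<le> i \<Longrightarrow> mpderiv i p = 0" for p :: "'a::comm_semiring_1 mpoly"
  by (induction p rule: mpolys_induct) (auto simp: mpderiv_simps)

text \<open>
  The only place where formal and analytic derivatives meet; stated along an arbitrary curve so that it
  also serves as chain rule for compositions.
\<close>

lemma DERIV_meval:
  fixes p :: "'a::real_normed_field mpoly"
  assumes "p \<in> mpolys n" "\<And>i. i < n \<Longrightarrow> ((\<lambda>t. g t i) has_field_derivative g' i) (at t)"
  shows "((\<lambda>t. meval (g t) p) has_field_derivative (\<Sum>i<n. meval (g t) (mpderiv i p) * g' i)) (at t)"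
  using assms(1)
proof (induction p rule: mpolys_induct)
  case (var i)
  have "(\<Sum>j<n. meval (g t) (mpderiv j (mvar i)) * g' j) = (\<Sum>j<n. if j = i then g' j else 0)"
    by (intro sum.cong) (auto simp: mpderiv_mvar)
  with var assms(2) show ?case by (simp add: sum.delta)
next
  case (add p q)
  then show ?case
    by (auto simp: meval_simps mpderiv_simps algebra_simps sum.distrib intro!: derivative_eq_intros)
next
  case (mult p q)
  show ?case unfolding meval_mult
    by (rule derivative_eq_intros mult.IH refl)+
      (simp add: meval_simps mpderiv_simps algebra_simps sum.distrib sum_distrib_left)
qed simp

lemma DERIV_meval_line:
  fixes p :: "'a::real_normed_field mpoly"
  assumes "p \<in> mpolys n"
  shows "((\<lambda>t. meval (\<lambda>i. x i + t * v i) p) has_field_derivative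
     (\<Sum>i<n. meval (\<lambda>i. x i + t * v i) (mpderiv i p) * v i)) (at t)"
  by (rule DERIV_meval[OF assms]) (auto intro!: derivative_eq_intros)

definition mdeg_le :: "nat \<Rightarrow> 'a::zero mpoly \<Rightarrow> bool" where
  "mdeg_le d p \<longleftrightarrow> (\<forall>m\<in>keys p. mdeg m \<le> d)"

lemma mdeg_superset: "finite A \<Longrightarrow> keys m \<subseteq> A \<Longrightarrow> mdeg m = (\<Sum>i\<in>A. lookup m i)"
  unfolding mdeg_def by (rule sum.mono_neutral_left) (auto simp: in_keys_iff)

lemma mdeg_add: "mdeg (m + k) = mdeg m + mdeg k"
  using mdeg_superset[of "keys m \<union> keys k" m] mdeg_superset[of "keys m \<union> keys k" k]
    mdeg_superset[of "keys m \<union> keys k" "m + k"] keys_add[of m k] 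
  by (simp add: lookup_add sum.distrib)

lemma mdeg_single [simp]: "mdeg (single i k) = k"
  by (simp add: mdeg_def)

lemma mdeg_0 [simp]: "mdeg 0 = 0"
  by (simp add: mdeg_def)

lemma mdeg_eq_0: "mdeg m = 0 \<longleftrightarrow> m = 0"
  by (auto simp: mdeg_def in_keys_iff intro!: poly_mapping_eqI)

lemma mdeg_le_exists: "\<exists>d. mdeg_le d p"
  by (intro exI[of _ "Max (mdeg ` keys p)"]) (auto simp: mdeg_le_def)

lemma mdeg_le_mpderiv: "mdeg_le (Suc d) p \<Longrightarrow> mdeg_le d (mpderiv i p)"
proof (unfold mdeg_le_def, intro ballI)
  fix m assume *: "\<forall>m\<in>keys p. mdeg m \<le> Suc d" "m \<in> keys (mpderiv i p)"
  then have "m + single i 1 \<in> keys p" by (auto simp: in_keys_iff lookup_mpderiv)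
  with * show "mdeg m \<le> d" by (fastforce simp: mdeg_add)
qed

lemma mdeg_le_0: "mdeg_le 0 p \<Longrightarrow> p = mconst (lookup p 0)"
  by (rule poly_mapping_eqI) (auto simp: mdeg_le_def mconst_def lookup_single when_def mdeg_eq_0 in_keys_iff)

lemma const_if_mpderivs_0:
  fixes p :: "'a::{idom,ring_char_0} mpoly"
  assumes "p \<in> mpolys n" "\<And>i. i < n \<Longrightarrow> mpderiv i p = 0"
  shows "p = mconst (lookup p 0)"
proof (rule poly_mapping_eqI)
  fix m
  show "lookup p m = lookup (mconst (lookup p 0)) m"
  proof (cases "m = 0")
    case False
    then obtain i where i: "lookup m i \<noteq> 0" by (metis lookup_zero poly_mapping_eqI)
    have "lookup p m = 0"
    proof (rule ccontr)
      assume nz: "lookup p m \<noteq> 0"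
      then have "m \<in> keys p" "i \<in> keys m" using i by (auto simp: in_keys_iff)
      then have "i < n" using assms(1) unfolding mpolys_def by blast
      then have "lookup (mpderiv i p) (m - single i 1) = 0" using assms(2) by simp
      moreover have "m - single i 1 + single i 1 = m"
        by (rule poly_mapping_eqI) (use i in \<open>auto simp: lookup_add lookup_minus lookup_single when_def\<close>)
      ultimately show False using nz by (auto simp: lookup_mpderiv simp del: of_nat_Suc)
    qed
    then show ?thesis using False by (simp add: mconst_def lookup_single when_def)
  qed (simp add: mconst_def)
qed

lemma coord_space_0 [simp]: "(\<lambda>_. 0) \<in> coord_space n"
  by (simp add: coord_space_def)

lemma coord_space_line: "x \<in> coord_space n \<Longrightarrow> v \<in> coord_space n \<Longrightarrow> (\<lambda>i. x i + t * v i) \<in> coord_space n"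
  for x :: "nat \<Rightarrow> 'a::semiring_0"
  by (simp add: coord_space_def)

definition unitv :: "nat \<Rightarrow> nat \<Rightarrow> 'a::zero_neq_one" where
  "unitv j = (\<lambda>i. if i = j then 1 else 0)"

lemma unitv_coord_space [simp]: "j < n \<Longrightarrow> unitv j \<in> coord_space n"
  by (auto simp: coord_space_def unitv_def)

lemma sum_unitv [simp]: "j < n \<Longrightarrow> (\<Sum>i<n. f i * unitv j i) = (f j :: 'a::semiring_1)"
  by (simp add: unitv_def if_distrib sum.delta cong: if_cong)

text \<open>
  Differentiation lowers the degree, so by induction all first derivatives are \<open>0\<close>, and in
  characteristic \<open>0\<close> only constants are left. The predicate \<open>V\<close> will be
  vanishing everywhere, vanishing on the image of an etale map, and vanishing on a cell.
\<close>

lemma mpoly_eq_0_if_mpderiv_closed: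
  fixes p :: "'a::{idom,ring_char_0} mpoly"
  assumes p: "p \<in> mpolys n" "V p"
    and closed: "\<And>q j. q \<in> mpolys n \<Longrightarrow> V q \<Longrightarrow> j < n \<Longrightarrow> V (mpderiv j q)"
    and const: "\<And>c. V (mconst c) \<Longrightarrow> c = 0"
  shows "p = 0"
proof -
  obtain d where "mdeg_le d p" using mdeg_le_exists by blast
  then have "\<exists>c. p = mconst c"
    using p
  proof (induction d arbitrary: p)
    case 0
    then show ?case using mdeg_le_0 by blast
  next
    case (Suc d)
    have "mpderiv j p = 0" if j: "j < n" for j
    proof -
      have V: "V (mpderiv j p)" by (rule closed) (use Suc.prems j in auto)
      obtain c where c: "mpderiv j p = mconst c"
        using Suc.IH[OF mdeg_le_mpderiv[OF Suc.prems(1)] mpolys_mpderiv[OF Suc.prems(2)] V] by blast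
      have "c = 0" by (rule const) (use V c in simp)
      then show ?thesis by (simp add: c mconst_def)
    qed
    then show ?case using const_if_mpderivs_0[OF Suc.prems(2)] by blast
  qed
  then obtain c where c: "p = mconst c" by blast
  have "c = 0" by (rule const) (use p(2) c in simp)
  then show ?thesis by (simp add: c mconst_def)
qed

lemma mpoly_eq_0_if_vanishing:
  fixes p :: "'a::real_normed_field mpoly"
  assumes p: "p \<in> mpolys n" and van: "\<And>x. x \<in> coord_space n \<Longrightarrow> meval x p = 0"
  shows "p = 0"
proof (rule mpoly_eq_0_if_mpderiv_closed[where V = "\<lambda>p. \<forall>x\<in>coord_space n. meval x p = 0"])
  fix q :: "'a mpoly" and j assume q: "q \<in> mpolys n" "\<forall>x\<in>coord_space n. meval x q = 0" and j: "j < n"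
  show "\<forall>x\<in>coord_space n. meval x (mpderiv j q) = 0"
  proof
    fix x :: "nat \<Rightarrow> 'a" assume x: "x \<in> coord_space n"
    have "((\<lambda>t. meval (\<lambda>i. x i + t * unitv j i) q) has_field_derivative meval x (mpderiv j q)) (at 0)"
      using DERIV_meval_line[OF q(1), of x "unitv j" 0] j by simp
    moreover have "(\<lambda>t. meval (\<lambda>i. x i + t * unitv j i) q) = (\<lambda>t. 0)"
      using q(2) coord_space_line[OF x unitv_coord_space[OF j]] by auto
    ultimately have "((\<lambda>t. 0) has_field_derivative meval x (mpderiv j q)) (at 0)" by simp
    then show "meval x (mpderiv j q) = 0" by (rule DERIV_unique[OF _ DERIV_const])
  qed
next
  fix c :: 'a assume "\<forall>x\<in>coord_space n. meval x (mconst c) = 0"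
  then show "c = 0" using coord_space_0 by (metis meval_mconst)
qed (use p van in auto)

text \<open>
  An algebraic substitute for the density of the complement of a hypersurface.
\<close>

lemma mpoly_eq_if_eq_off_zeros:
  fixes c :: "'a::real_normed_field mpoly"
  assumes c: "c \<in> mpolys n" "c \<noteq> 0" and pq: "p \<in> mpolys n" "q \<in> mpolys n"
    and eq: "\<And>x. x \<in> coord_space n \<Longrightarrow> meval x c \<noteq> 0 \<Longrightarrow> meval x p = meval x q"
  shows "p = q"
proof -
  have "c * (p - q) = 0"
  proof (rule mpoly_eq_0_if_vanishing)
    show "c * (p - q) \<in> mpolys n" using c pq by (intro mpolys_intros)
    show "meval x (c * (p - q)) = 0" if "x \<in> coord_space n" for x
      using eq[OF that] by (cases "meval x c = 0") (auto simp: meval_simps)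
  qed
  then show ?thesis using c(2) by simp
qed

section \<open>Etale maps and algebraic dependence\<close>

text \<open>
  In this form the condition survives the changes of variables below without any computation
  of determinants.
\<close>

definition etale :: "nat \<Rightarrow> (nat \<Rightarrow> 'a::comm_ring_1 mpoly) \<Rightarrow> bool" where
  "etale n F \<longleftrightarrow> (\<forall>x\<in>coord_space n. \<forall>v\<in>coord_space n.
     (\<forall>i<n. (\<Sum>j<n. meval x (mpderiv j (F i)) * v j) = 0) \<longrightarrow> v = (\<lambda>_. 0))"

lemma etaleD:
  "etale n F \<Longrightarrow> x \<in> coord_space n \<Longrightarrow> v \<in> coord_space n \<Longrightarrow>
    (\<And>i. i < n \<Longrightarrow> (\<Sum>j<n. meval x (mpderiv j (F i)) * v j) = 0) \<Longrightarrow> v = (\<lambda>_. 0)"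
  by (auto simp: etale_def)

lemma mult_mat_vec_eq_sum:
  fixes M :: "nat \<Rightarrow> nat \<Rightarrow> 'a::comm_ring_1"
  shows "i < n \<Longrightarrow> vec_index (mat n n (\<lambda>(i, j). M i j) *\<^sub>v vec n v) i = (\<Sum>j<n. M i j * v j)"
  by (simp add: scalar_prod_def atLeast0LessThan)

lemma det_nonzero_iff_injective:
  fixes M :: "nat \<Rightarrow> nat \<Rightarrow> 'a::idom"
  shows "det (mat n n (\<lambda>(i, j). M i j)) \<noteq> 0 \<longleftrightarrow>
    (\<forall>v\<in>coord_space n. (\<forall>i<n. (\<Sum>j<n. M i j * v j) = 0) \<longrightarrow> v = (\<lambda>_. 0))" (is "det ?A \<noteq> 0 \<longleftrightarrow> ?R")
proof -
  have eq0: "?A *\<^sub>v vec n v = 0\<^sub>v n \<longleftrightarrow> (\<forall>i<n. (\<Sum>j<n. M i j * v j) = 0)" for v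
  proof
    assume *: "?A *\<^sub>v vec n v = 0\<^sub>v n"
    show "\<forall>i<n. (\<Sum>j<n. M i j * v j) = 0"
    proof (intro allI impI)
      fix i assume "i < n"
      then show "(\<Sum>j<n. M i j * v j) = 0"
        using mult_mat_vec_eq_sum[of i n M v] * by simp
    qed
  next
    assume *: "\<forall>i<n. (\<Sum>j<n. M i j * v j) = 0"
    show "?A *\<^sub>v vec n v = 0\<^sub>v n"
      by (rule eq_vecI) (use * mult_mat_vec_eq_sum[of _ n M v] in auto)
  qed
  have "det ?A = 0 \<longleftrightarrow> (\<exists>v. v \<in> carrier_vec n \<and> v \<noteq> 0\<^sub>v n \<and> ?A *\<^sub>v v = 0\<^sub>v n)"
    by (rule det_0_iff_vec_prod_zero) simp
  also have "\<dots> \<longleftrightarrow> \<not> ?R"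
  proof
    assume "\<exists>v. v \<in> carrier_vec n \<and> v \<noteq> 0\<^sub>v n \<and> ?A *\<^sub>v v = 0\<^sub>v n"
    then obtain v where v: "v \<in> carrier_vec n" "v \<noteq> 0\<^sub>v n" "?A *\<^sub>v v = 0\<^sub>v n" by blast
    define w where "w = (\<lambda>i. if i < n then vec_index v i else 0)"
    have vw: "v = vec n w" using v(1) by (intro eq_vecI) (auto simp: w_def)
    have "w \<in> coord_space n" by (auto simp: w_def coord_space_def)
    moreover have "w \<noteq> (\<lambda>_. 0)" using v(2) vw by auto
    ultimately show "\<not> ?R" using v(3) eq0[of w] vw by blast
  next
    assume "\<not> ?R"
    then obtain w where w: "w \<in> coord_space n" "\<forall>i<n. (\<Sum>j<n. M i j * w j) = 0" "w \<noteq> (\<lambda>_. 0)" by blast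
    then obtain i where "w i \<noteq> 0" by auto
    with w(1) have "i < n" by (auto simp: coord_space_def not_le[symmetric])
    then have "vec_index (vec n w) i \<noteq> vec_index (0\<^sub>v n) i" using \<open>w i \<noteq> 0\<close> by simp
    then have "vec n w \<noteq> 0\<^sub>v n" by metis
    then show "\<exists>v. v \<in> carrier_vec n \<and> v \<noteq> 0\<^sub>v n \<and> ?A *\<^sub>v v = 0\<^sub>v n"
      using w(2) eq0[of w] vec_carrier[of n w] by blast
  qed
  finally show ?thesis by blast
qed

lemma inverse_linear_system:
  fixes M :: "nat \<Rightarrow> nat \<Rightarrow> 'a::field"
  assumes "\<And>v. v \<in> coord_space n \<Longrightarrow> (\<And>i. i < n \<Longrightarrow> (\<Sum>j<n. M i j * v j) = 0) \<Longrightarrow> v = (\<lambda>_. 0)"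
  shows "\<exists>B. (\<forall>i<n. \<forall>j<n. (\<Sum>k<n. B i k * M k j) = (if j = i then 1 else 0)) \<and>
             (\<forall>i<n. \<forall>j<n. (\<Sum>k<n. M i k * B k j) = (if j = i then 1 else 0))"
proof -
  define A where "A = mat n n (\<lambda>(i, j). M i j)"
  have A: "A \<in> carrier_mat n n" by (simp add: A_def)
  have d: "det A \<noteq> 0" unfolding A_def det_nonzero_iff_injective using assms by blast
  note adj = adj_mat[OF A]
  define B where "B = (\<lambda>i j. adj_mat A $$ (i, j) / det A)"
  have 1: "(\<Sum>k<n. B i k * M k j) = (adj_mat A * A) $$ (i, j) / det A" if "i < n" "j < n" for i j
    using that adj(1) by (simp add: B_def A_def scalar_prod_def atLeast0LessThan sum_divide_distrib)
  have 2: "(\<Sum>k<n. M i k * B k j) = (A * adj_mat A) $$ (i, j) / det A" if "i < n" "j < n" for i j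
    using that adj(1) by (simp add: B_def A_def scalar_prod_def atLeast0LessThan sum_divide_distrib)
  show ?thesis
    by (intro exI[of _ B]) (auto simp: 1 2 adj(2,3) d)
qed

lemma linear_system_solvable:
  fixes M :: "nat \<Rightarrow> nat \<Rightarrow> 'a::field"
  assumes "\<And>v. v \<in> coord_space n \<Longrightarrow> (\<And>i. i < n \<Longrightarrow> (\<Sum>j<n. M i j * v j) = 0) \<Longrightarrow> v = (\<lambda>_. 0)"
    and k: "k < n"
  shows "\<exists>v\<in>coord_space n. \<forall>i<n. (\<Sum>j<n. M i j * v j) = unitv k i"
proof -
  obtain B where "\<forall>i<n. \<forall>j<n. (\<Sum>k<n. M i k * B k j) = (if j = i then 1 else 0)"
    using inverse_linear_system[of n M] assms(1) by blast
  then show ?thesis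
    using k by (intro bexI[of _ "\<lambda>j. if j < n then B j k else 0"]) (auto simp: unitv_def coord_space_def)
qed

lemma polymap_coord_space [simp]: "polymap n F x \<in> coord_space n"
  by (auto simp: polymap_def coord_space_def)

text \<open>
  Differentiating \<open>P \<circ> F = 0\<close> in a direction that \<open>DF(x)\<close> maps to the
  \<open>k\<close>-th unit vector shows that the \<open>k\<close>-th partial derivative of
  \<open>P\<close> vanishes on the image as well.
\<close>

lemma etale_algebraic_independence:
  fixes F :: "nat \<Rightarrow> 'a::real_normed_field mpoly"
  assumes F: "\<And>i. i < n \<Longrightarrow> F i \<in> mpolys n" and et: "etale n F" and P: "P \<in> mpolys n"
    and van: "\<And>x. x \<in> coord_space n \<Longrightarrow> meval (polymap n F x) P = 0"
  shows "P = 0"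
proof (rule mpoly_eq_0_if_mpderiv_closed[where V = "\<lambda>P. \<forall>x\<in>coord_space n. meval (polymap n F x) P = 0"])
  fix Q :: "'a mpoly" and k
  assume Q: "Q \<in> mpolys n" "\<forall>x\<in>coord_space n. meval (polymap n F x) Q = 0" and k: "k < n"
  show "\<forall>x\<in>coord_space n. meval (polymap n F x) (mpderiv k Q) = 0"
  proof
    fix x :: "nat \<Rightarrow> 'a" assume x: "x \<in> coord_space n"
    have "\<exists>v\<in>coord_space n. \<forall>i<n. (\<Sum>j<n. meval x (mpderiv j (F i)) * v j) = unitv k i"
      by (rule linear_system_solvable) (use etaleD[OF et x] k in blast)+
    then obtain v where v: "v \<in> coord_space n"
      "\<And>i. i < n \<Longrightarrow> (\<Sum>j<n. meval x (mpderiv j (F i)) * v j) = unitv k i" by blast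
    let ?l = "\<lambda>t i. x i + t * v i"
    have "((\<lambda>t. meval (polymap n F (?l t)) Q) has_field_derivative
        (\<Sum>i<n. meval (polymap n F (?l 0)) (mpderiv i Q) * unitv k i)) (at 0)"
    proof (rule DERIV_meval[OF Q(1)])
      fix i assume i: "i < n"
      have "((\<lambda>t. meval (?l t) (F i)) has_field_derivative (\<Sum>j<n. meval (?l 0) (mpderiv j (F i)) * v j)) (at 0)"
        by (rule DERIV_meval_line) (use F i in blast)
      then show "((\<lambda>t. polymap n F (?l t) i) has_field_derivative unitv k i) (at 0)"
        using i v(2)[OF i] by (simp add: polymap_def)
    qed
    moreover have "(\<lambda>t. meval (polymap n F (?l t)) Q) = (\<lambda>t. 0)"
      using Q(2) coord_space_line[OF x v(1)] by auto
    ultimately have "((\<lambda>t. 0) has_field_derivative meval (polymap n F x) (mpderiv k Q)) (at 0)"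
      using k by simp
    then show "meval (polymap n F x) (mpderiv k Q) = 0" by (rule DERIV_unique[OF _ DERIV_const])
  qed
next
  fix c :: 'a assume "\<forall>x\<in>coord_space n. meval (polymap n F x) (mconst c) = 0"
  then show "c = 0" using coord_space_0 by (metis meval_mconst)
qed (use P van in auto)

text \<open>
  An equation for \<open>x\<^sub>i\<close> over \<open>\<complex>[F]\<close> is a univariate polynomial
  with multivariate coefficients: the distinguished variable comes with a degree and with
  pseudo-division.
\<close>

definition peval :: "(nat \<Rightarrow> 'a) \<Rightarrow> 'a::comm_ring_1 mpoly poly \<Rightarrow> 'a \<Rightarrow> 'a" where
  "peval y P t = poly (map_poly (meval y) P) t"

definition coeffs_in :: "nat \<Rightarrow> 'a::comm_ring_1 mpoly poly \<Rightarrow> bool" where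
  "coeffs_in n P \<longleftrightarrow> (\<forall>j. coeff P j \<in> mpolys n)"

lemma coeff_map_poly_meval [simp]: "coeff (map_poly (meval y) P) j = meval y (coeff P j)"
  by (simp add: coeff_map_poly)

lemma map_poly_meval_mult: "map_poly (meval y) (P * Q) = map_poly (meval y) P * map_poly (meval y) Q"
  for P :: "'a::comm_ring_1 mpoly poly"
  by (rule poly_eqI) (simp add: coeff_mult meval_simps)

lemma peval_add: "peval y (P + Q) t = peval y P t + peval y Q t"
proof -
  have "map_poly (meval y) (P + Q) = map_poly (meval y) P + map_poly (meval y) Q"
    by (rule poly_eqI) (simp add: meval_simps)
  then show ?thesis by (simp add: peval_def)
qed

lemma peval_mult: "peval y (P * Q) t = peval y P t * peval y Q t"
  by (simp add: peval_def map_poly_meval_mult)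

lemma peval_0 [simp]: "peval y 0 t = 0"
  by (simp add: peval_def)

lemma peval_sum: "peval y (sum f A) t = (\<Sum>a\<in>A. peval y (f a) t)"
  by (induction A rule: infinite_finite_induct) (auto simp: peval_add)

lemma peval_monom: "peval y (monom c j) t = meval y c * t ^ j"
  by (simp add: peval_def map_poly_monom poly_monom)

lemma peval_const: "peval y [:c:] t = meval y c"
  using peval_monom[of y c 0 t] by (simp add: monom_0)

lemma peval_smult: "peval y (smult c P) t = meval y c * peval y P t"
  using peval_mult[of y "[:c:]" P t] by (simp add: peval_const)

lemma peval_uminus: "peval y (- P) t = - peval y P t"
  using peval_add[of y P "- P" t] by (simp add: eq_neg_iff_add_eq_0 add.commute)

lemma peval_minus: "peval y (P - Q) t = peval y P t - peval y Q t"
  using peval_add[of y P "- Q" t] by (simp add: peval_uminus)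

lemma peval_eq_sum: "degree P \<le> d \<Longrightarrow> peval y P t = (\<Sum>j\<le>d. meval y (coeff P j) * t ^ j)"
proof -
  assume d: "degree P \<le> d"
  then have "degree (map_poly (meval y) P) \<le> d"
    by (intro degree_le) (auto simp: coeff_eq_0)
  then have "poly (map_poly (meval y) P) t = (\<Sum>j\<le>d. coeff (map_poly (meval y) P) j * t ^ j)"
    unfolding poly_altdef
    by (intro sum.mono_neutral_left) (auto simp: coeff_eq_0 not_le simp del: coeff_map_poly_meval)
  then show ?thesis by (simp add: peval_def)
qed

lemma coeffs_in_0 [simp]: "coeffs_in n 0"
  by (simp add: coeffs_in_def)

lemma coeffs_in_add: "coeffs_in n P \<Longrightarrow> coeffs_in n Q \<Longrightarrow> coeffs_in n (P + Q)"
  by (simp add: coeffs_in_def mpolys_add)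

lemma coeffs_in_minus: "coeffs_in n P \<Longrightarrow> coeffs_in n Q \<Longrightarrow> coeffs_in n (P - Q)"
  by (simp add: coeffs_in_def mpolys_minus)

lemma coeffs_in_sum: "(\<And>a. a \<in> A \<Longrightarrow> coeffs_in n (f a)) \<Longrightarrow> coeffs_in n (sum f A)"
  by (induction A rule: infinite_finite_induct) (auto intro: coeffs_in_add)

lemma coeffs_in_mult: "coeffs_in n P \<Longrightarrow> coeffs_in n Q \<Longrightarrow> coeffs_in n (P * Q)"
  by (auto simp: coeffs_in_def coeff_mult intro!: mpolys_intros)

lemma coeffs_in_smult: "c \<in> mpolys n \<Longrightarrow> coeffs_in n Q \<Longrightarrow> coeffs_in n (smult c Q)"
  by (auto simp: coeffs_in_def intro!: mpolys_intros)

lemma coeffs_in_monom: "c \<in> mpolys n \<Longrightarrow> coeffs_in n (monom c j)"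
  by (auto simp: coeffs_in_def coeff_monom)

lemma coeffs_in_const: "c \<in> mpolys n \<Longrightarrow> coeffs_in n [:c:]"
  using coeffs_in_monom[of c n 0] by (simp add: monom_0)

text \<open>
  Gaussian elimination: an equation in which the unknown \<open>i0\<close> occurs is used to eliminate
  \<open>i0\<close>.
\<close>

lemma homogeneous_system_nontrivial_solution:
  fixes c :: "'i \<Rightarrow> 'j \<Rightarrow> 'a::field"
  assumes "finite J" "finite I" "card J < card I"
  shows "\<exists>l. (\<exists>i\<in>I. l i \<noteq> 0) \<and> (\<forall>j\<in>J. (\<Sum>i\<in>I. l i * c i j) = 0)"
  using assms
proof (induction J arbitrary: I c)
  case empty
  then obtain i where "i \<in> I" by fastforce
  then show ?case by (intro exI[of _ "\<lambda>_. 1"]) auto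
next
  case (insert j J)
  show ?case
  proof (cases "\<forall>i\<in>I. c i j = 0")
    case True
    have "\<exists>l. (\<exists>i\<in>I. l i \<noteq> 0) \<and> (\<forall>j\<in>J. (\<Sum>i\<in>I. l i * c i j) = 0)"
      by (rule insert.IH) (use insert in auto)
    then show ?thesis using True by auto
  next
    case False
    then obtain i0 where i0: "i0 \<in> I" "c i0 j \<noteq> 0" by blast
    let ?I = "I - {i0}"
    have "\<exists>l. (\<exists>i\<in>?I. l i \<noteq> 0) \<and> (\<forall>k\<in>J. (\<Sum>i\<in>?I. l i * (c i k - c i j / c i0 j * c i0 k)) = 0)"
      by (rule insert.IH) (use insert i0 in auto)
    then obtain l where l: "\<exists>i\<in>?I. l i \<noteq> 0"
      "\<And>k. k \<in> J \<Longrightarrow> (\<Sum>i\<in>?I. l i * (c i k - c i j / c i0 j * c i0 k)) = 0" by blast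
    define l' where "l' = l(i0 := - (\<Sum>i\<in>?I. l i * c i j) / c i0 j)"
    have *: "(\<Sum>i\<in>I. l' i * c i k) = (\<Sum>i\<in>?I. l i * (c i k - c i j / c i0 j * c i0 k))" for k
    proof -
      have "(\<Sum>i\<in>I. l' i * c i k) = l' i0 * c i0 k + (\<Sum>i\<in>?I. l' i * c i k)"
        using i0 insert.prems by (simp add: sum.remove)
      also have "(\<Sum>i\<in>?I. l' i * c i k) = (\<Sum>i\<in>?I. l i * c i k)"
        by (intro sum.cong) (auto simp: l'_def)
      also have "l' i0 * c i0 k = - (\<Sum>i\<in>?I. l i * (c i j / c i0 j * c i0 k))"
        by (simp add: l'_def sum_distrib_right sum_divide_distrib mult.assoc)
      finally show ?thesis by (simp add: algebra_simps sum_subtractf)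
    qed
    have "(\<Sum>i\<in>I. l' i * c i j) = 0" using i0 by (simp add: *)
    moreover have "\<exists>i\<in>I. l' i \<noteq> 0" using l(1) by (auto simp: l'_def)
    ultimately show ?thesis using l(2) * by (intro exI[of _ l']) auto
  qed
qed

definition expo_le :: "nat \<Rightarrow> 'a::zero mpoly \<Rightarrow> bool" where
  "expo_le b p \<longleftrightarrow> (\<forall>m\<in>keys p. \<forall>i. lookup m i \<le> b)"

lemma expo_le_exists: "\<exists>b. expo_le b p"
proof -
  have "lookup m i \<le> mdeg m" for m i
    by (cases "i \<in> keys m") (auto simp: mdeg_def in_keys_iff intro: member_le_sum)
  then show ?thesis using mdeg_le_exists[of p] unfolding mdeg_le_def expo_le_def
    by (meson order_trans)
qed

lemma expo_le_mono: "expo_le b p \<Longrightarrow> b \<le> c \<Longrightarrow> expo_le c p"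
  by (meson expo_le_def order_trans)

lemma expo_le_1 [simp]: "expo_le b (1 :: 'a::zero_neq_one mpoly)"
  by (simp add: expo_le_def)

lemma expo_le_mult: "expo_le b p \<Longrightarrow> expo_le c q \<Longrightarrow> expo_le (b + c) (p * q)" for p :: "'a::semiring_0 mpoly"
proof (unfold expo_le_def, intro ballI allI)
  fix m i assume *: "\<forall>m\<in>keys p. \<forall>i. lookup m i \<le> b" "\<forall>m\<in>keys q. \<forall>i. lookup m i \<le> c" "m \<in> keys (p * q)"
  then obtain u v where "m = u + v" "u \<in> keys p" "v \<in> keys q" using keys_mult by blast
  then show "lookup m i \<le> b + c" using * by (simp add: lookup_add add_mono)
qed

lemma expo_le_power: "expo_le b p \<Longrightarrow> expo_le (k * b) (p ^ k)" for p :: "'a::comm_semiring_1 mpoly"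
  by (induction k) (auto dest: expo_le_mult)

lemma expo_le_prod: "finite A \<Longrightarrow> (\<And>a. a \<in> A \<Longrightarrow> expo_le b (f a)) \<Longrightarrow> expo_le (card A * b) (prod f A)"
  for f :: "_ \<Rightarrow> 'a::comm_semiring_1 mpoly"
  by (induction A rule: finite_induct) (auto dest: expo_le_mult)

definition expo_box :: "nat \<Rightarrow> nat \<Rightarrow> (nat \<Rightarrow>\<^sub>0 nat) set" where
  "expo_box n b = {m. keys m \<subseteq> {..<n} \<and> (\<forall>i. lookup m i \<le> b)}"

lemma expo_box_inj: "inj_on (\<lambda>m. restrict (lookup m) {..<n}) (expo_box n b)"
proof (rule inj_onI, rule poly_mapping_eqI)
  fix m k i assume *: "m \<in> expo_box n b" "k \<in> expo_box n b"
    "restrict (lookup m) {..<n} = restrict (lookup k) {..<n}"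
  show "lookup m i = lookup k i"
  proof (cases "i < n")
    case True
    then show ?thesis using fun_cong[OF *(3), of i] by simp
  next
    case False
    then have "i \<notin> keys m" "i \<notin> keys k" using *(1,2) by (auto simp: expo_box_def)
    then show ?thesis by (simp add: in_keys_iff)
  qed
qed

lemma expo_box_card: "finite (expo_box n b)" "card (expo_box n b) \<le> Suc b ^ n"
proof -
  have sub: "(\<lambda>m. restrict (lookup m) {..<n}) ` expo_box n b \<subseteq> {..<n} \<rightarrow>\<^sub>E {..b}"
    by (auto simp: expo_box_def split: if_splits)
  have fin: "finite ({..<n} \<rightarrow>\<^sub>E {..b})" by (intro finite_PiE) auto
  show "finite (expo_box n b)" using finite_imageD[OF finite_subset[OF sub fin] expo_box_inj] .
  have "card (expo_box n b) \<le> card ({..<n} \<rightarrow>\<^sub>E {..b})"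
    by (rule card_inj_on_le[OF expo_box_inj sub fin])
  then show "card (expo_box n b) \<le> Suc b ^ n" by (simp add: card_PiE)
qed

text \<open>
  The products of powers of \<open>F 0\<close>, ..., \<open>F (n - 1)\<close>, \<open>g\<close> with
  exponents at most \<open>k\<close> are about \<open>k\<close> to the power \<open>n + 1\<close> in
  number, but the monomials that they involve are only about \<open>k\<close> to the power
  \<open>n\<close>.
\<close>

lemma algebraic_dependence:
  fixes F :: "nat \<Rightarrow> 'a::field mpoly"
  assumes F: "\<And>i. i < n \<Longrightarrow> F i \<in> mpolys n" and g: "g \<in> mpolys n"
  shows "\<exists>P. coeffs_in n P \<and> P \<noteq> 0 \<and> (\<forall>x. peval (polymap n F x) P (meval x g) = 0)"
proof -
  obtain b where b: "\<And>i. i < n \<Longrightarrow> expo_le b (F i)" "expo_le b g"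
  proof -
    obtain b0 where b0: "expo_le b0 g" using expo_le_exists by blast
    have "\<forall>i. \<exists>b. expo_le b (F i)" using expo_le_exists by blast
    then obtain bf where bf: "\<And>i. expo_le (bf i) (F i)" by metis
    show ?thesis
    proof (rule that[of "b0 + (\<Sum>i<n. bf i)"])
      fix i assume "i < n"
      then have "bf i \<le> (\<Sum>i<n. bf i)" by (intro member_le_sum) auto
      then show "expo_le (b0 + (\<Sum>i<n. bf i)) (F i)" using expo_le_mono[OF bf] by simp
    qed (use expo_le_mono[OF b0] in simp)
  qed
  \<comment> \<open>large enough for \<open>(c * Suc k) ^ n < Suc k ^ Suc n\<close>\<close>
  define c where "c = Suc n * b + 1"
  define k where "k = c ^ n"
  define I where "I = ({..<n} \<rightarrow>\<^sub>E {..k}) \<times> {..k}"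
  define J where "J = expo_box n (Suc n * (k * b))"
  define T where "T = (\<lambda>(\<alpha>, j). (\<Prod>i<n. F i ^ \<alpha> i) * g ^ j)"
  have finI: "finite I" by (auto simp: I_def intro!: finite_PiE)
  have cardI: "card I = Suc k ^ n * Suc k" by (simp add: I_def card_cartesian_product card_PiE)
  have "card J \<le> Suc (Suc n * (k * b)) ^ n" unfolding J_def by (rule expo_box_card)
  also have "\<dots> \<le> (c * Suc k) ^ n"
    by (intro power_mono) (auto simp: c_def algebra_simps)
  also have "\<dots> = k * Suc k ^ n" by (simp only: k_def power_mult_distrib)
  also have "\<dots> < card I" by (simp add: cardI)
  finally have lt: "card J < card I" .
  have finJ: "finite J" by (simp add: J_def expo_box_card)
  obtain l where l: "\<exists>i\<in>I. l i \<noteq> 0" "\<forall>m\<in>J. (\<Sum>i\<in>I. l i * lookup (T i) m) = 0"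
    using homogeneous_system_nontrivial_solution[OF finJ finI lt, of "\<lambda>i. lookup (T i)"] by blast
  have keysT: "keys (T u) \<subseteq> J" if "u \<in> I" for u
  proof -
    obtain \<alpha> j where u: "u = (\<alpha>, j)" by (cases u)
    have \<alpha>: "\<And>i. i < n \<Longrightarrow> \<alpha> i \<le> k" and j: "j \<le> k" using that by (auto simp: I_def u)
    have "expo_le (k * b) (F i ^ \<alpha> i)" if "i < n" for i
      by (rule expo_le_mono[OF expo_le_power[OF b(1)]]) (use \<alpha> that in auto)
    then have "expo_le (n * (k * b)) (\<Prod>i<n. F i ^ \<alpha> i)"
      using expo_le_prod[of "{..<n}" "k * b" "\<lambda>i. F i ^ \<alpha> i"] by simp
    moreover have "expo_le (k * b) (g ^ j)"
      by (rule expo_le_mono[OF expo_le_power[OF b(2)]]) (use j in auto)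
    ultimately have "expo_le (n * (k * b) + k * b) (T u)"
      unfolding T_def u by (simp add: expo_le_mult)
    moreover have "T u \<in> mpolys n"
      unfolding T_def u using F g by (auto intro!: mpolys_intros)
    ultimately show ?thesis by (auto simp: J_def expo_box_def mpolys_def expo_le_def add.commute)
  qed
  have zero: "(\<Sum>u\<in>I. mconst (l u) * T u) = 0"
  proof (rule poly_mapping_eqI)
    fix m
    have "lookup (mconst (l u) * T u) m = l u * lookup (T u) m" for u
      unfolding mconst_def mult_map_scale_conv_mult[symmetric] by (simp add: Poly_Mapping.map.rep_eq when_def)
    then have "lookup (\<Sum>u\<in>I. mconst (l u) * T u) m = (\<Sum>u\<in>I. l u * lookup (T u) m)"
      by (simp add: lookup_sum)
    also have "\<dots> = 0"
    proof (cases "m \<in> J")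
      case False
      then have "lookup (T u) m = 0" if "u \<in> I" for u using keysT[OF that] by (auto simp: in_keys_iff)
      then show ?thesis by simp
    qed (use l in blast)
    finally show "lookup (\<Sum>u\<in>I. mconst (l u) * T u) m = lookup 0 m" by simp
  qed
  define mo where "mo = (\<lambda>\<alpha>. \<Sum>i<n. single i (\<alpha> i :: nat))"
  have lmo: "lookup (mo \<alpha>) i = (if i < n then \<alpha> i else 0)" for \<alpha> i
    by (auto simp: mo_def lookup_sum lookup_single when_def sum.delta)
  define P where "P = (\<Sum>u\<in>I. monom (single (mo (fst u)) (l u)) (snd u))"
  have "coeffs_in n P"
    unfolding P_def
  proof (intro coeffs_in_sum coeffs_in_monom mpolys_single)
    fix u show "keys (mo (fst u)) \<subseteq> {..<n}" by (auto simp: in_keys_iff lmo split: if_splits)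
  qed
  moreover have "P \<noteq> 0"
  proof -
    obtain \<alpha> j where u: "(\<alpha>, j) \<in> I" "l (\<alpha>, j) \<noteq> 0" using l(1) by auto
    have "lookup (coeff P j) (mo \<alpha>) = (\<Sum>u\<in>I. if u = (\<alpha>, j) then l u else 0)"
      unfolding P_def coeff_sum lookup_sum coeff_monom
    proof (intro sum.cong refl)
      fix v assume v: "v \<in> I"
      obtain \<beta> i where vi: "v = (\<beta>, i)" by (cases v)
      have "mo \<beta> = mo \<alpha> \<longleftrightarrow> \<beta> = \<alpha>"
      proof
        assume eq: "mo \<beta> = mo \<alpha>"
        have "\<beta> i = \<alpha> i" for i
        proof (cases "i < n")
          case True
          then show ?thesis using lmo[of \<beta> i] lmo[of \<alpha> i] eq by simp
        next
          case False
          then show ?thesis using u(1) v by (auto simp: I_def vi PiE_def extensional_def)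
        qed
        then show "\<beta> = \<alpha>" by auto
      qed auto
      then show "lookup (if snd v = j then single (mo (fst v)) (l v) else 0) (mo \<alpha>) = (if v = (\<alpha>, j) then l v else 0)"
        by (auto simp: vi lookup_single when_def)
    qed
    also have "\<dots> = l (\<alpha>, j)" using u(1) finI by simp
    finally show ?thesis using u(2) by auto
  qed
  moreover have "peval (polymap n F x) P (meval x g) = 0" for x
  proof -
    have "meval (polymap n F x) (single (mo \<alpha>) c) = c * (\<Prod>i<n. meval x (F i) ^ \<alpha> i)" for \<alpha> c
    proof -
      have "keys (mo \<alpha>) \<subseteq> {..<n}" by (auto simp: in_keys_iff lmo split: if_splits)
      then show ?thesis
        by (simp add: meval_single monomial_value_superset[of "{..<n}"] lmo polymap_def)
    qed
    then have "peval (polymap n F x) P (meval x g) = (\<Sum>u\<in>I. l u * (\<Prod>i<n. meval x (F i) ^ fst u i) * meval x g ^ snd u)"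
      by (simp add: P_def peval_sum peval_monom)
    also have "\<dots> = meval x (\<Sum>u\<in>I. mconst (l u) * T u)"
      by (simp add: meval_simps T_def case_prod_unfold mult.assoc)
    finally show ?thesis by (simp add: zero)
  qed
  ultimately show ?thesis by blast
qed

text \<open>
  An equation of degree \<open>0\<close> in \<open>g\<close> would be a relation between the components
  of \<open>F\<close> alone.
\<close>

lemma etale_algebraic:
  fixes F :: "nat \<Rightarrow> 'a::real_normed_field mpoly"
  assumes F: "\<And>i. i < n \<Longrightarrow> F i \<in> mpolys n" and et: "etale n F" and g: "g \<in> mpolys n"
  shows "\<exists>P. coeffs_in n P \<and> degree P \<ge> 1 \<and> (\<forall>x. peval (polymap n F x) P (meval x g) = 0)"
proof -
  obtain P where P: "coeffs_in n P" "P \<noteq> 0" "\<And>x. peval (polymap n F x) P (meval x g) = 0"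
    using algebraic_dependence[of n F g, OF F g] by blast
  have "degree P \<noteq> 0"
  proof
    assume "degree P = 0"
    then have "meval (polymap n F x) (coeff P 0) = 0" for x using P(3)[of x] by (simp add: peval_eq_sum[OF order_refl])
    then have "coeff P 0 = 0"
      using P(1) by (intro etale_algebraic_independence[OF F et]) (auto simp: coeffs_in_def)
    then show False using P(2) \<open>degree P = 0\<close> by (metis leading_coeff_0_iff)
  qed
  with P show ?thesis by (auto simp: Suc_le_eq)
qed

section \<open>Polynomial growth\<close>

text \<open>
  The summand \<open>1\<close> makes the powers increasing, so that bounds can be added and multiplied.
\<close>

definition nrm :: "nat \<Rightarrow> (nat \<Rightarrow> 'a::real_normed_vector) \<Rightarrow> real" where
  "nrm n y = 1 + (\<Sum>i<n. norm (y i))"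

definition poly_bounded :: "nat \<Rightarrow> (nat \<Rightarrow> 'a::real_normed_vector) set \<Rightarrow> ((nat \<Rightarrow> 'a) \<Rightarrow> real) \<Rightarrow> bool" where
  "poly_bounded n S f \<longleftrightarrow> (\<exists>C\<ge>0. \<exists>M. \<forall>y\<in>S. \<bar>f y\<bar> \<le> C * nrm n y ^ M)"

lemma nrm_ge_1 [simp]: "nrm n y \<ge> 1"
  by (simp add: nrm_def sum_nonneg)

lemma nrm_pos [simp]: "nrm n y > 0"
  using nrm_ge_1[of n y] by linarith

lemma nrm_nonneg [simp]: "nrm n y \<ge> 0"
  using nrm_ge_1[of n y] by linarith

lemma poly_boundedI: "(\<And>y. y \<in> S \<Longrightarrow> \<bar>f y\<bar> \<le> C * nrm n y ^ M) \<Longrightarrow> C \<ge> 0 \<Longrightarrow> poly_bounded n S f"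
  by (auto simp: poly_bounded_def)

lemma poly_bounded_add:
  assumes "poly_bounded n S f" "poly_bounded n S g"
  shows "poly_bounded n S (\<lambda>y. f y + g y)"
proof -
  obtain C M where C: "C \<ge> 0" "\<And>y. y \<in> S \<Longrightarrow> \<bar>f y\<bar> \<le> C * nrm n y ^ M"
    using assms(1) by (auto simp: poly_bounded_def)
  obtain D N where D: "D \<ge> 0" "\<And>y. y \<in> S \<Longrightarrow> \<bar>g y\<bar> \<le> D * nrm n y ^ N"
    using assms(2) by (auto simp: poly_bounded_def)
  show ?thesis
  proof (rule poly_boundedI)
    fix y assume y: "y \<in> S"
    have "\<bar>f y + g y\<bar> \<le> C * nrm n y ^ M + D * nrm n y ^ N" using C(2)[OF y] D(2)[OF y] by linarith
    also have "\<dots> \<le> C * nrm n y ^ (M + N) + D * nrm n y ^ (M + N)"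
      by (intro add_mono mult_left_mono power_increasing C D) auto
    finally show "\<bar>f y + g y\<bar> \<le> (C + D) * nrm n y ^ (M + N)" by (simp add: algebra_simps)
  qed (use C D in simp)
qed

lemma poly_bounded_mult:
  assumes "poly_bounded n S f" "poly_bounded n S g"
  shows "poly_bounded n S (\<lambda>y. f y * g y)"
proof -
  obtain C M where C: "C \<ge> 0" "\<And>y. y \<in> S \<Longrightarrow> \<bar>f y\<bar> \<le> C * nrm n y ^ M"
    using assms(1) by (auto simp: poly_bounded_def)
  obtain D N where D: "D \<ge> 0" "\<And>y. y \<in> S \<Longrightarrow> \<bar>g y\<bar> \<le> D * nrm n y ^ N"
    using assms(2) by (auto simp: poly_bounded_def)
  show ?thesis
  proof (rule poly_boundedI)
    fix y assume y: "y \<in> S"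
    have "\<bar>f y * g y\<bar> \<le> (C * nrm n y ^ M) * (D * nrm n y ^ N)"
      unfolding abs_mult by (intro mult_mono C D y mult_nonneg_nonneg) auto
    then show "\<bar>f y * g y\<bar> \<le> (C * D) * nrm n y ^ (M + N)" by (simp add: power_add algebra_simps)
  qed (use C D in simp)
qed

lemma poly_bounded_const [simp]: "poly_bounded n S (\<lambda>y. c)"
  by (rule poly_boundedI[of _ _ "\<bar>c\<bar>" _ 0]) auto

lemma poly_bounded_sum: "(\<And>a. a \<in> A \<Longrightarrow> poly_bounded n S (f a)) \<Longrightarrow> poly_bounded n S (\<lambda>y. \<Sum>a\<in>A. f a y)"
  by (induction A rule: infinite_finite_induct) (auto intro: poly_bounded_add)

lemma poly_bounded_power: "poly_bounded n S f \<Longrightarrow> poly_bounded n S (\<lambda>y. f y ^ k)"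
  by (induction k) (auto intro: poly_bounded_mult)

lemma poly_bounded_le: "poly_bounded n S g \<Longrightarrow> (\<And>y. y \<in> S \<Longrightarrow> \<bar>f y\<bar> \<le> g y) \<Longrightarrow> poly_bounded n S f"
  unfolding poly_bounded_def by (meson abs_ge_self order_trans)

lemma poly_bounded_nrm: "poly_bounded n S (nrm n)"
  by (rule poly_boundedI[of _ _ 1 _ 1]) auto

lemma poly_bounded_meval:
  fixes p :: "'a::real_normed_field mpoly"
  assumes "p \<in> mpolys n" shows "poly_bounded n S (\<lambda>y. norm (meval y p))"
  using assms
proof (induction p rule: mpolys_induct)
  case (var i)
  show ?case
  proof (rule poly_bounded_le[OF poly_bounded_nrm])
    fix y :: "nat \<Rightarrow> 'a"
    have "norm (y i) \<le> (\<Sum>i<n. norm (y i))" using var by (intro member_le_sum) auto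
    then show "\<bar>norm (meval y (mvar i))\<bar> \<le> nrm n y" by (simp add: nrm_def)
  qed
next
  case (add p q)
  show ?case
    by (rule poly_bounded_le[OF poly_bounded_add[OF add.IH]]) (simp add: meval_simps norm_triangle_ineq)
next
  case (mult p q)
  show ?case
    by (rule poly_bounded_le[OF poly_bounded_mult[OF mult.IH]]) (simp add: meval_simps norm_mult)
qed simp

text \<open>
  Bounds \<open>c d * t\<close> instead of \<open>t\<close>, because the leading coefficient will be a
  polynomial that may vanish or be small.
\<close>

lemma root_bound:
  fixes c :: "nat \<Rightarrow> 'a::real_normed_field"
  assumes "(\<Sum>j\<le>d. c j * t ^ j) = 0" "d \<ge> 1"
  shows "norm (c d * t) \<le> (\<Sum>j\<le>d. norm (c j))"
proof (cases "norm t \<le> 1")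
  case True
  have "norm (c d * t) \<le> norm (c d)" using True by (simp add: norm_mult mult_left_le)
  also have "\<dots> \<le> (\<Sum>j\<le>d. norm (c j))" by (rule member_le_sum) auto
  finally show ?thesis .
next
  case False
  obtain e where e: "d = Suc e" using assms(2) by (cases d) auto
  have t: "t \<noteq> 0" using False by auto
  have "c d * t * t ^ e = - (\<Sum>j\<le>e. c j * t ^ j)"
    using assms(1) by (simp add: e eq_neg_iff_add_eq_0 algebra_simps)
  then have "norm (c d * t) * norm t ^ e = norm (\<Sum>j\<le>e. c j * t ^ j)"
    unfolding norm_power[symmetric] norm_mult[symmetric] by simp
  also have "\<dots> \<le> (\<Sum>j\<le>e. norm (c j) * norm t ^ e)"
  proof (rule sum_norm_le)
    fix j assume "j \<in> {..e}"
    then have "norm t ^ j \<le> norm t ^ e" using False by (intro power_increasing) auto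
    then show "norm (c j * t ^ j) \<le> norm (c j) * norm t ^ e" by (simp add: norm_mult norm_power mult_left_mono)
  qed
  also have "\<dots> = (\<Sum>j\<le>e. norm (c j)) * norm t ^ e" by (simp add: sum_distrib_right)
  finally have "norm (c d * t) \<le> (\<Sum>j\<le>e. norm (c j))" using t by simp
  also have "\<dots> \<le> (\<Sum>j\<le>d. norm (c j))" by (simp add: e)
  finally show ?thesis .
qed

text \<open>
  Where \<open>a\<close> is bounded away from \<open>0\<close>, the value of \<open>F\<close> controls
  the argument. The polynomial \<open>a\<close> is the product of the leading coefficients of equations
  for the coordinates over \<open>\<complex>[F]\<close>.
\<close>

lemma etale_growth:
  fixes F :: "nat \<Rightarrow> 'a::real_normed_field mpoly"
  assumes F: "\<And>i. i < n \<Longrightarrow> F i \<in> mpolys n" and et: "etale n F"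
  shows "\<exists>a\<in>mpolys n. a \<noteq> 0 \<and> (\<exists>C\<ge>0. \<exists>M. \<forall>x\<in>coord_space n. \<forall>i<n.
    norm (meval (polymap n F x) a * x i) \<le> C * nrm n (polymap n F x) ^ M)"
proof -
  have "\<exists>P. coeffs_in n P \<and> degree P \<ge> 1 \<and> (\<forall>x. peval (polymap n F x) P (x i) = 0)" if "i < n" for i
    using etale_algebraic[OF F et mpolys_mvar[OF that]] by simp
  then obtain P where P: "\<And>i. i < n \<Longrightarrow> coeffs_in n (P i)" "\<And>i. i < n \<Longrightarrow> degree (P i) \<ge> 1"
    "\<And>i x. i < n \<Longrightarrow> peval (polymap n F x) (P i) (x i) = 0" by metis
  define a where "a = (\<Prod>i<n. lead_coeff (P i))"
  have lc: "lead_coeff (P i) \<in> mpolys n" if "i < n" for i using P(1)[OF that] by (simp add: coeffs_in_def)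
  have a: "a \<in> mpolys n" unfolding a_def by (intro mpolys_prod) (use lc in auto)
  have a0: "a \<noteq> 0"
    unfolding a_def prod_zero_iff[OF finite_lessThan]
  proof
    assume "\<exists>i\<in>{..<n}. lead_coeff (P i) = 0"
    then show False using P(2) by fastforce
  qed
  define B where "B i y = norm (meval y (\<Prod>k\<in>{..<n} - {i}. lead_coeff (P k))) * (\<Sum>j\<le>degree (P i). norm (meval y (coeff (P i) j)))"
    for i and y :: "nat \<Rightarrow> 'a"
  have "poly_bounded n UNIV (\<lambda>y. \<Sum>i<n. B i y)"
    unfolding B_def
    by (intro poly_bounded_sum poly_bounded_mult poly_bounded_meval mpolys_prod)
      (use P(1) in \<open>auto simp: coeffs_in_def\<close>)
  then obtain C M where C: "C \<ge> 0" "\<And>y. \<bar>\<Sum>i<n. B i y\<bar> \<le> C * nrm n y ^ M"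
    by (auto simp: poly_bounded_def)
  have "norm (meval (polymap n F x) a * x i) \<le> C * nrm n (polymap n F x) ^ M" if "i < n" for x i
  proof -
    let ?y = "polymap n F x"
    have "a = (\<Prod>k\<in>{..<n} - {i}. lead_coeff (P k)) * lead_coeff (P i)"
      unfolding a_def using that by (simp add: prod.remove[of _ i] mult.commute)
    then have "norm (meval ?y a * x i)
       = norm (meval ?y (\<Prod>k\<in>{..<n} - {i}. lead_coeff (P k))) * norm (meval ?y (lead_coeff (P i)) * x i)"
      by (simp add: meval_mult norm_mult mult.assoc)
    also have "\<dots> \<le> B i ?y"
      unfolding B_def
    proof (rule mult_left_mono)
      show "norm (meval ?y (lead_coeff (P i)) * x i) \<le> (\<Sum>j\<le>degree (P i). norm (meval ?y (coeff (P i) j)))"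
        by (rule root_bound) (use P(3)[OF that, of x] P(2)[OF that] in \<open>auto simp: peval_eq_sum[OF order_refl]\<close>)
    qed simp
    also have "\<dots> \<le> (\<Sum>i<n. B i ?y)"
      by (rule member_le_sum) (use that in \<open>auto simp: B_def sum_nonneg\<close>)
    also have "\<dots> \<le> C * nrm n ?y ^ M" using C(2)[of ?y] by linarith
    finally show ?thesis .
  qed
  then show ?thesis using a a0 C(1) by blast
qed

section \<open>Coordinate spaces and invariance of domain\<close>

lemma Euclidean_space_eq_top_of_set: "Euclidean_space n = top_of_set (coord_space n)"
  by (simp add: Euclidean_space_def coord_space_def euclidean_product_topology)

lemma continuous_on_coordinate:
  "continuous_on S f \<Longrightarrow> continuous_on S (\<lambda>x. f x i)"
  by (rule continuous_on_product_then_coordinatewise)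

lemma continuous_on_meval:
  fixes p :: "'a::real_normed_field mpoly"
  assumes "continuous_on S f"
  shows "continuous_on S (\<lambda>x. meval (f x) p)"
proof -
  obtain n where "p \<in> mpolys n" using mpolys_exists by blast
  then show ?thesis
    by (induction p rule: mpolys_induct) (auto simp: meval_simps intro!: continuous_on_add continuous_on_mult continuous_on_const continuous_on_coordinate[OF assms])
qed

lemma continuous_on_polymap:
  fixes F :: "nat \<Rightarrow> 'a::real_normed_field mpoly"
  assumes "continuous_on S f"
  shows "continuous_on S (\<lambda>x. polymap n F (f x))"
proof (rule continuous_on_coordinatewise_then_product)
  fix i show "continuous_on S (\<lambda>x. polymap n F (f x) i)"
    by (cases "i < n") (auto simp: polymap_def intro!: continuous_on_meval assms)
qed

lemma continuous_on_nrm [continuous_intros]: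
  "continuous_on S f \<Longrightarrow> continuous_on S (\<lambda>x. nrm n (f x))"
  unfolding nrm_def
  by (intro continuous_on_add continuous_on_const continuous_on_sum continuous_on_norm) (rule continuous_on_coordinate)

lemma closed_coord_space: "closed (coord_space n :: (nat \<Rightarrow> 'a::real_normed_vector) set)"
proof -
  have "closed {x :: nat \<Rightarrow> 'a. x i = 0}" for i
    by (intro closed_Collect_eq continuous_on_const continuous_on_product_coordinates)
  then have "closed (\<Inter>i\<in>{n..}. {x :: nat \<Rightarrow> 'a. x i = 0})" by blast
  moreover have "(\<Inter>i\<in>{n..}. {x :: nat \<Rightarrow> 'a. x i = 0}) = coord_space n" by (auto simp: coord_space_def)
  ultimately show ?thesis by simp
qed

text \<open>
  By invariance of domain the image would be open in dimension \<open>d\<close>, but it lies in a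
  hyperplane.
\<close>

lemma no_injection_into_lower_dimension:
  fixes f :: "(nat \<Rightarrow> real) \<Rightarrow> nat \<Rightarrow> real"
  assumes U: "openin (Euclidean_space d) U" "U \<noteq> {}"
    and cont: "continuous_on U f" and im: "f ` U \<subseteq> coord_space k" and inj: "inj_on f U"
  shows "d \<le> k"
proof (rule ccontr)
  assume "\<not> d \<le> k"
  then have kd: "k < d" by simp
  have Usub: "U \<subseteq> coord_space d" using openin_subset[OF U(1)] by (simp add: Euclidean_space_eq_top_of_set)
  have "f ` U \<subseteq> coord_space d" using im kd by (force simp: coord_space_def)
  then have "continuous_map (subtopology (Euclidean_space d) U) (Euclidean_space d) f"
    unfolding cm_Euclidean_space_iff_continuous_on using cont Usub
    by (auto simp: topspace_Euclidean_space_coord_space Int_absorb1)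
  from invariance_of_domain_Euclidean_space[OF U(1) this inj]
  obtain T where T: "open T" "f ` U = coord_space d \<inter> T"
    by (auto simp: Euclidean_space_eq_top_of_set openin_open)
  obtain u where u: "u \<in> U" using U(2) by blast
  define g where "g = (\<lambda>t::real. (f u)(k := t))"
  have "continuous_on UNIV g"
    unfolding g_def fun_upd_def 
  proof (rule continuous_on_coordinatewise_then_product)
    fix i show "continuous_on UNIV (\<lambda>t. if i = k then t else f u i)" by (cases "i = k") auto
  qed
  then have "open (g -` T)" using T(1) by (simp add: continuous_open_vimage continuous_on_eq_continuous_at)
  moreover have "f u k = 0" using im u by (auto simp: coord_space_def)
  then have "g 0 = f u" by (auto simp: g_def)
  then have "0 \<in> g -` T" using T(2) u by auto
  ultimately obtain e where e: "e > 0" "ball 0 e \<subseteq> g -` T" by (meson open_contains_ball)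
  have "e / 2 \<in> ball 0 e" using e(1) by simp
  then have "e / 2 \<in> g -` T" using e(2) by blast
  then have "g (e / 2) \<in> T" by simp
  moreover have "g (e / 2) \<in> coord_space d" using im u kd by (auto simp: g_def coord_space_def)
  ultimately have "g (e / 2) \<in> coord_space k" using T(2) im by blast
  then have "g (e / 2) k = 0" by (auto simp: coord_space_def)
  then show False using e(1) by (simp add: g_def)
qed

definition to_complex :: "(nat \<Rightarrow> real) \<Rightarrow> nat \<Rightarrow> complex" where
  "to_complex x = (\<lambda>j. Complex (x (2 * j)) (x (2 * j + 1)))"

definition to_real :: "(nat \<Rightarrow> complex) \<Rightarrow> nat \<Rightarrow> real" where
  "to_real z = (\<lambda>k. if even k then Re (z (k div 2)) else Im (z (k div 2)))"

lemma to_complex_to_real [simp]: "to_complex (to_real z) = z"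
  by (auto simp: to_complex_def to_real_def)

lemma to_real_to_complex [simp]: "to_real (to_complex x) = x"
proof
  fix k show "to_real (to_complex x) k = x k"
    by (cases "even k") (auto simp: to_complex_def to_real_def elim!: evenE oddE)
qed

lemma to_complex_coord_space [simp]: "x \<in> coord_space (2 * n) \<Longrightarrow> to_complex x \<in> coord_space n"
  by (auto simp: coord_space_def to_complex_def complex_eq_iff)

lemma to_real_coord_space [simp]: "z \<in> coord_space n \<Longrightarrow> to_real z \<in> coord_space (2 * n)"
  by (auto simp: coord_space_def to_real_def)

lemma continuous_on_to_complex:
  assumes "continuous_on S f" shows "continuous_on S (\<lambda>x. to_complex (f x))"
  unfolding to_complex_def Complex_eq
  by (intro continuous_on_coordinatewise_then_product continuous_on_add continuous_on_mult continuous_on_const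
      continuous_on_of_real continuous_on_coordinate[OF assms])

lemma continuous_on_to_real: "continuous_on S f \<Longrightarrow> continuous_on S (\<lambda>x. to_real (f x))"
proof (rule continuous_on_coordinatewise_then_product)
  fix i assume f: "continuous_on S f"
  show "continuous_on S (\<lambda>x. to_real (f x) i)"
    by (cases "even i") (simp_all add: to_real_def continuous_on_Re continuous_on_Im continuous_on_coordinate[OF f])
qed

text \<open>
  Hadamard's lemma: difference quotients that extend continuously to the diagonal, where they are the
  partial derivatives.
\<close>

lemma meval_difference:
  fixes p :: "'a::real_normed_field mpoly"
  assumes "p \<in> mpolys n"
  shows "\<exists>q :: (nat \<Rightarrow> 'a) \<Rightarrow> (nat \<Rightarrow> 'a) \<Rightarrow> nat \<Rightarrow> 'a. (\<forall>j. continuous_on UNIV (\<lambda>z. q (fst z) (snd z) j)) \<and>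
     (\<forall>x y. meval x p - meval y p = (\<Sum>j<n. q x y j * (x j - y j))) \<and>
     (\<forall>y. \<forall>j<n. q y y j = meval y (mpderiv j p))"
  using assms
proof (induction p rule: mpolys_induct)
  case (const c)
  show ?case by (intro exI[of _ "\<lambda>x y j. 0"]) auto
next
  case (var i)
  have "(\<Sum>j<n. (if j = i then 1 else 0) * (x j - y j)) = x i - y i" for x y :: "nat \<Rightarrow> 'a"
  proof -
    have "(\<Sum>j<n. (if j = i then 1 else 0) * (x j - y j)) = (\<Sum>j<n. if j = i then x j - y j else 0)"
      by (rule sum.cong) auto
    then show ?thesis using var by simp
  qed
  then show ?case by (intro exI[of _ "\<lambda>x y j. if j = i then 1 else 0"]) (auto simp: mpderiv_mvar)
next
  case (add p q)
  obtain f where f: "\<And>j. continuous_on UNIV (\<lambda>z. f (fst z) (snd z) j)"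
    "\<And>x y. meval x p - meval y p = (\<Sum>j<n. f x y j * (x j - y j))"
    "\<And>y j. j < n \<Longrightarrow> f y y j = meval y (mpderiv j p)" using add.IH(1) by blast
  obtain g where g: "\<And>j. continuous_on UNIV (\<lambda>z. g (fst z) (snd z) j)"
    "\<And>x y. meval x q - meval y q = (\<Sum>j<n. g x y j * (x j - y j))"
    "\<And>y j. j < n \<Longrightarrow> g y y j = meval y (mpderiv j q)" using add.IH(2) by blast
  show ?case
  proof (intro exI[of _ "\<lambda>x y j. f x y j + g x y j"] conjI allI impI)
    show "continuous_on UNIV (\<lambda>z. f (fst z) (snd z) j + g (fst z) (snd z) j)" for j
      by (intro continuous_on_add f g)
    fix x y
    have "meval x (p + q) - meval y (p + q) = (meval x p - meval y p) + (meval x q - meval y q)"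
      by (simp add: meval_simps)
    then show "meval x (p + q) - meval y (p + q) = (\<Sum>j<n. (f x y j + g x y j) * (x j - y j))"
      unfolding f(2) g(2) sum.distrib[symmetric] by (simp add: algebra_simps)
  qed (simp add: f(3) g(3) meval_simps mpderiv_simps)
next
  case (mult p q)
  obtain f where f: "\<And>j. continuous_on UNIV (\<lambda>z. f (fst z) (snd z) j)"
    "\<And>x y. meval x p - meval y p = (\<Sum>j<n. f x y j * (x j - y j))"
    "\<And>y j. j < n \<Longrightarrow> f y y j = meval y (mpderiv j p)" using mult.IH(1) by blast
  obtain g where g: "\<And>j. continuous_on UNIV (\<lambda>z. g (fst z) (snd z) j)"
    "\<And>x y. meval x q - meval y q = (\<Sum>j<n. g x y j * (x j - y j))"
    "\<And>y j. j < n \<Longrightarrow> g y y j = meval y (mpderiv j q)" using mult.IH(2) by blast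
  show ?case
  proof (intro exI[of _ "\<lambda>x y j. f x y j * meval x q + meval y p * g x y j"] conjI allI impI)
    show "continuous_on UNIV (\<lambda>z. f (fst z) (snd z) j * meval (fst z) q + meval (snd z) p * g (fst z) (snd z) j)" for j
      by (intro continuous_on_add continuous_on_mult f(1) g(1) continuous_on_meval continuous_on_fst continuous_on_snd continuous_on_id)
    fix x y
    have "meval x (p * q) - meval y (p * q) = (meval x p - meval y p) * meval x q + meval y p * (meval x q - meval y q)"
      by (simp add: meval_simps algebra_simps)
    then show "meval x (p * q) - meval y (p * q) = (\<Sum>j<n. (f x y j * meval x q + meval y p * g x y j) * (x j - y j))"
      unfolding f(2) g(2) sum_distrib_left sum_distrib_right sum.distrib[symmetric] by (simp add: algebra_simps)
  qed (simp add: f(3) g(3) meval_simps mpderiv_simps)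
qed

section \<open>The codimension of a complex hypersurface\<close>

text \<open>
  Suppose that \<open>d\<close> is larger. If \<open>p\<close> vanishes on the set and some partial
  derivative \<open>\<partial>\<^sub>jp\<close> does not vanish at a point of it, then near this point
  the equation \<open>p = 0\<close> determines the coordinate \<open>j\<close> from the others. Dropping
  this coordinate is then injective on a nonempty open part and leads to real dimension \<open>2n -
  2\<close>, a contradiction. So the polynomials vanishing on the set are stable under differentiation.
\<close>

lemma dimension_in_complex_hypersurface:
  fixes a :: "complex mpoly"
  assumes a: "a \<in> mpolys n" "a \<noteq> 0"
    and U: "openin (Euclidean_space d) U" "U \<noteq> {}"
    and cont: "continuous_on U \<phi>" and im: "\<phi> ` U \<subseteq> coord_space n" and inj: "inj_on \<phi> U"
    and van: "\<And>u. u \<in> U \<Longrightarrow> meval (\<phi> u) a = 0"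
  shows "d + 2 \<le> 2 * n"
proof (rule ccontr)
  assume dim: "\<not> d + 2 \<le> 2 * n"
  have "a = 0"
  proof (rule mpoly_eq_0_if_mpderiv_closed[where V = "\<lambda>p. \<forall>u\<in>U. meval (\<phi> u) p = 0"])
    fix p and j assume p: "p \<in> mpolys n" "\<forall>u\<in>U. meval (\<phi> u) p = 0" and j: "j < n"
    show "\<forall>u\<in>U. meval (\<phi> u) (mpderiv j p) = 0"
    proof (rule ccontr)
      assume "\<not> ?thesis"
      then obtain u0 where u0: "u0 \<in> U" "meval (\<phi> u0) (mpderiv j p) \<noteq> 0" by blast
      obtain q where q: "\<And>k. continuous_on UNIV (\<lambda>z. q (fst z) (snd z) k)"
        "\<And>x y. meval x p - meval y p = (\<Sum>k<n. q x y k * (x k - y k))"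
        "\<And>y k. k < n \<Longrightarrow> q y y k = meval y (mpderiv k p)"
        using meval_difference[OF p(1)] by blast
      define Q where "Q = (\<lambda>w. q (\<phi> (fst w)) (\<phi> (snd w)) j)"
      have c: "continuous_on (U \<times> U) (\<lambda>w. \<phi> (fst w))" "continuous_on (U \<times> U) (\<lambda>w. \<phi> (snd w))"
        by (auto intro: continuous_on_compose2[OF cont] continuous_on_fst[OF continuous_on_id] continuous_on_snd[OF continuous_on_id])
      have "continuous_on (U \<times> U) (\<lambda>w. (\<lambda>z. q (fst z) (snd z) j) (\<phi> (fst w), \<phi> (snd w)))"
        by (rule continuous_on_compose2[OF q(1) continuous_on_Pair[OF c]]) simp
      then have "continuous_on (U \<times> U) Q" by (simp add: Q_def)
      then have "openin (top_of_set (U \<times> U)) (U \<times> U \<inter> Q -` (- {0}))"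
        by (rule continuous_openin_preimage_gen) auto
      then obtain T where T: "open T" "U \<times> U \<inter> Q -` (- {0}) = (U \<times> U) \<inter> T"
        by (auto simp: openin_open)
      have "(u0, u0) \<in> U \<times> U \<inter> Q -` (- {0})"
        using u0 q(3)[OF j, of "\<phi> u0"] by (simp add: Q_def)
      then have "(u0, u0) \<in> T" unfolding T(2) by simp
      then obtain A B where AB: "open A" "open B" "(u0, u0) \<in> A \<times> B" "A \<times> B \<subseteq> T"
        using open_prod_elim[OF T(1)] by metis
      define W where "W = U \<inter> (A \<inter> B)"
      have W: "openin (Euclidean_space d) W" "W \<noteq> {}"
        using U(1) AB u0 by (auto simp: W_def Euclidean_space_eq_top_of_set openin_Int_open open_Int)
      have nz: "q (\<phi> u) (\<phi> v) j \<noteq> 0" if "u \<in> W" "v \<in> W" for u v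
      proof -
        have "(u, v) \<in> (U \<times> U) \<inter> T" using that AB(4) by (auto simp: W_def)
        then have "(u, v) \<in> U \<times> U \<inter> Q -` (- {0})" unfolding T(2) .
        then show ?thesis by (simp add: Q_def)
      qed
      define drop where "drop = (\<lambda>z :: nat \<Rightarrow> complex. \<lambda>i. z (if i < j then i else Suc i))"
      have "d \<le> 2 * (n - 1)"
      proof (rule no_injection_into_lower_dimension[OF W])
        have "continuous_on W \<phi>" using cont by (rule continuous_on_subset) (auto simp: W_def)
        then show "continuous_on W (\<lambda>u. to_real (drop (\<phi> u)))"
          unfolding drop_def
          by (intro continuous_on_to_real continuous_on_coordinatewise_then_product) (rule continuous_on_coordinate)
        show "(\<lambda>u. to_real (drop (\<phi> u))) ` W \<subseteq> coord_space (2 * (n - 1))"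
        proof (rule image_subsetI, rule to_real_coord_space)
          fix u assume "u \<in> W"
          then have "\<phi> u \<in> coord_space n" using im by (auto simp: W_def)
          then show "drop (\<phi> u) \<in> coord_space (n - 1)" using j by (auto simp: drop_def coord_space_def)
        qed
        show "inj_on (\<lambda>u. to_real (drop (\<phi> u))) W"
        proof (rule inj_onI)
          fix u v assume uv: "u \<in> W" "v \<in> W" "to_real (drop (\<phi> u)) = to_real (drop (\<phi> v))"
          then have dr: "drop (\<phi> u) = drop (\<phi> v)" by (metis to_complex_to_real)
          have other: "\<phi> u i = \<phi> v i" if "i \<noteq> j" for i
          proof (cases "i < j")
            case True
            then show ?thesis using fun_cong[OF dr, of i] by (simp add: drop_def)
          next
            case False
            then show ?thesis using fun_cong[OF dr, of "i - 1"] that by (simp add: drop_def split: if_splits)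
          qed
          have "meval (\<phi> u) p - meval (\<phi> v) p = 0" using p(2) uv by (auto simp: W_def)
          moreover have "(\<Sum>k<n. q (\<phi> u) (\<phi> v) k * (\<phi> u k - \<phi> v k)) = q (\<phi> u) (\<phi> v) j * (\<phi> u j - \<phi> v j)"
            using j by (subst sum.remove[of _ j]) (auto simp: other intro!: sum.neutral)
          ultimately have "\<phi> u j = \<phi> v j" using q(2) nz uv by simp
          then have "\<phi> u = \<phi> v" using other by (metis ext)
          then show "u = v" using inj uv by (auto simp: W_def inj_on_def)
        qed
      qed
      then show False using j dim by simp
    qed
  next
    fix c :: complex assume "\<forall>u\<in>U. meval (\<phi> u) (mconst c) = 0"
    then show "c = 0" using U(2) by auto
  qed (use a van in auto)
  then show False using a(2) by simp
qed

lemma openin_open_cube: "openin (Euclidean_space d) (open_cube d)"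
proof -
  have "open (\<Inter>i\<in>{..<d}. {x :: nat \<Rightarrow> real. 0 < x i} \<inter> {x. x i < 1})"
    by (intro open_INT open_Int open_Collect_less ballI continuous_on_const continuous_on_product_coordinates) auto
  moreover have "open_cube d = coord_space d \<inter> (\<Inter>i\<in>{..<d}. {x. 0 < x i} \<inter> {x. x i < 1})"
    by (auto simp: open_cube_def)
  ultimately show ?thesis by (auto simp: Euclidean_space_eq_top_of_set openin_open)
qed

lemma cell_in_complex_hypersurface:
  assumes a: "a \<in> mpolys n" "a \<noteq> 0" and cell: "semialgebraic_cell (2 * n) d C"
    and C: "\<And>x. x \<in> C \<Longrightarrow> meval (to_complex x) a = 0"
  shows "d + 2 \<le> 2 * n"
proof -
  obtain \<phi> where hom: "homeomorphic_map (subtopology (Euclidean_space d) (open_cube d))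
      (subtopology (Euclidean_space (2 * n)) C) \<phi>" and Csub: "C \<subseteq> coord_space (2 * n)"
    using cell by (auto simp: semialgebraic_cell_def)
  have cube: "open_cube d \<subseteq> coord_space d" by (auto simp: open_cube_def)
  have top1: "subtopology (Euclidean_space d) (open_cube d) = top_of_set (open_cube d)"
    and top2: "subtopology (Euclidean_space (2 * n)) C = top_of_set C"
    using cube Csub by (auto simp: Euclidean_space_eq_top_of_set subtopology_subtopology Int_absorb1)
  have im: "\<phi> ` open_cube d = C" and inj: "inj_on \<phi> (open_cube d)"
    using homeomorphic_imp_surjective_map[OF hom] homeomorphic_imp_injective_map[OF hom]
    by (simp_all add: top1 top2)
  have cont: "continuous_on (open_cube d) \<phi>"
    using homeomorphic_imp_continuous_map[OF hom] by (simp add: top1 top2)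
  show ?thesis
  proof (rule dimension_in_complex_hypersurface[OF a openin_open_cube])
    have "(\<lambda>i. if i < d then 1/2 else 0) \<in> open_cube d" by (auto simp: open_cube_def coord_space_def)
    then show "open_cube d \<noteq> {}" by blast
    show "continuous_on (open_cube d) (\<lambda>u. to_complex (\<phi> u))" using cont by (rule continuous_on_to_complex)
    show "(\<lambda>u. to_complex (\<phi> u)) ` open_cube d \<subseteq> coord_space n" using im Csub by auto
    show "inj_on (\<lambda>u. to_complex (\<phi> u)) (open_cube d)"
      by (rule inj_onI) (metis inj inj_onD to_real_to_complex)
    show "meval (to_complex (\<phi> u)) a = 0" if "u \<in> open_cube d" for u using that im C by auto
  qed
qed

lemma meval_sum_of_squares: "meval x (\<Sum>i<n. (mvar i - mconst (p i))\<^sup>2) = (\<Sum>i<n. (x i - p i)\<^sup>2)" for x :: "nat \<Rightarrow> real"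
  by (simp add: meval_simps)

text \<open>
  Needed because the dimension is a greatest element, which means nothing unless some cell exists.
\<close>

lemma semialgebraic_cell_point:
  assumes p: "p \<in> coord_space n"
  shows "semialgebraic_cell n 0 {p}"
proof -
  have cube: "open_cube 0 = {\<lambda>_. 0}" by (auto simp: open_cube_def coord_space_def)
  have "semialgebraic n {x \<in> coord_space n. meval x (\<Sum>i<n. (mvar i - mconst (p i))\<^sup>2) = 0}"
    by (intro semialgebraic.eq mpolys_intros) auto
  moreover have "x = p" if "x \<in> coord_space n" "\<And>i. i < n \<Longrightarrow> x i = p i" for x
  proof
    fix i show "x i = p i" using that p by (cases "i < n") (auto simp: coord_space_def)
  qed
  then have "{x \<in> coord_space n. meval x (\<Sum>i<n. (mvar i - mconst (p i))\<^sup>2) = 0} = {p}"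
    unfolding meval_sum_of_squares using p by (auto simp: sum_nonneg_eq_0_iff)
  ultimately have sa: "semialgebraic n {p}" by simp
  have "homeomorphic_map (top_of_set {\<lambda>_::nat. 0::real}) (top_of_set {p}) (\<lambda>_. p)"
    unfolding homeomorphic_map_maps homeomorphic_maps_def
    by (intro exI[of _ "\<lambda>_ _. 0"]) auto
  then have "homeomorphic_map (subtopology (Euclidean_space 0) (open_cube 0)) (subtopology (Euclidean_space n) {p}) (\<lambda>_. p)"
    using p by (simp add: cube Euclidean_space_eq_top_of_set subtopology_subtopology Int_absorb1)
  moreover have "graph_on 0 (open_cube 0) (\<lambda>_. p) = {p}" by (auto simp: graph_on_def cube)
  ultimately show ?thesis unfolding semialgebraic_cell_def using sa p by auto
qed

lemma real_codim_in_complex_hypersurface: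
  assumes a: "a \<in> mpolys n" "a \<noteq> 0" and S: "S \<subseteq> coord_space (2 * n)" "S \<noteq> {}"
    and van: "\<And>x. x \<in> S \<Longrightarrow> meval (to_complex x) a = 0"
  shows "real_codim (2 * n) S \<ge> 2"
proof -
  obtain p where p: "p \<in> S" using S by blast
  let ?P = "\<lambda>d. \<exists>C\<subseteq>S. semialgebraic_cell (2 * n) d C"
  have bound: "d + 2 \<le> 2 * n" if "?P d" for d
    using that cell_in_complex_hypersurface[OF a] van by blast
  have "?P 0" using semialgebraic_cell_point[of p] p S(1) by blast
  moreover have "d \<le> 2 * n" if "?P d" for d using bound[OF that] by simp
  ultimately have "?P (Greatest ?P)" by (rule GreatestI_nat)
  from bound[OF this] show ?thesis by (simp add: real_codim_def semialgebraic_dim_def)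
qed

section \<open>Points at which an etale map is not proper\<close>

lemma compact_complex_box: "compact {x \<in> coord_space n. \<forall>i<n. norm (x i :: complex) \<le> B}"
proof -
  let ?S = "\<lambda>i. if i < n then cball 0 B else {0::complex}"
  have "compactin (product_topology (\<lambda>i. euclidean) UNIV) (PiE UNIV ?S)"
    unfolding compactin_PiE by auto
  moreover have "PiE UNIV ?S = {x \<in> coord_space n. \<forall>i<n. norm (x i :: complex) \<le> B}"
  proof (intro equalityI subsetI)
    fix x assume "x \<in> PiE UNIV ?S"
    then have S: "x i \<in> ?S i" for i by (rule PiE_mem) simp
    have "norm (x i) \<le> B" if "i < n" for i using S[of i] that by simp
    moreover have "x i = 0" if "i \<ge> n" for i using S[of i] that by simp
    ultimately show "x \<in> {x \<in> coord_space n. \<forall>i<n. norm (x i :: complex) \<le> B}" by (simp add: coord_space_def)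
  next
    fix x assume "x \<in> {x \<in> coord_space n. \<forall>i<n. norm (x i :: complex) \<le> B}"
    then have "x i \<in> ?S i" for i by (auto simp: coord_space_def)
    then show "x \<in> PiE UNIV ?S" by (simp add: PiE_UNIV_domain)
  qed
  ultimately show ?thesis by (simp add: euclidean_product_topology)
qed

text \<open>
  The growth estimate confines the preimage to a box.
\<close>

lemma compact_polymap_preimage:
  fixes F :: "nat \<Rightarrow> complex mpoly"
  assumes C: "C \<ge> 0"
    "\<And>x i. x \<in> coord_space n \<Longrightarrow> i < n \<Longrightarrow> norm (meval (polymap n F x) a * x i) \<le> C * nrm n (polymap n F x) ^ M"
    and \<delta>: "\<delta> > 0"
  shows "compact {x \<in> coord_space n. \<delta> \<le> norm (meval (polymap n F x) a) \<and> nrm n (polymap n F x) \<le> R}" (is "compact ?D")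
proof -
  let ?box = "{x \<in> coord_space n. \<forall>i<n. norm (x i :: complex) \<le> C * R ^ M / \<delta>}"
  have "norm (x i) \<le> C * R ^ M / \<delta>" if x: "x \<in> ?D" and i: "i < n" for x i
  proof -
    let ?y = "polymap n F x"
    have "\<delta> * norm (x i) \<le> norm (meval ?y a) * norm (x i)" using x by (intro mult_right_mono) auto
    also have "\<dots> \<le> C * nrm n ?y ^ M" using C(2)[OF _ i] x by (simp add: norm_mult)
    also have "\<dots> \<le> C * R ^ M" using x C(1) by (intro mult_left_mono power_mono) auto
    finally show ?thesis using \<delta> by (simp add: field_simps)
  qed
  then have D: "?box \<inter> ?D = ?D" by blast
  have "closed ?D"
  proof -
    have cF: "continuous_on UNIV (polymap n F)" using continuous_on_polymap[OF continuous_on_id] by simp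
    have "closed (coord_space n \<inter> ({x. \<delta> \<le> norm (meval (polymap n F x) a)} \<inter> {x. nrm n (polymap n F x) \<le> R}))"
      by (intro closed_Int closed_coord_space closed_Collect_le continuous_on_const continuous_on_norm
          continuous_on_meval continuous_on_nrm cF)
    moreover have "coord_space n \<inter> ({x. \<delta> \<le> norm (meval (polymap n F x) a)} \<inter> {x. nrm n (polymap n F x) \<le> R}) = ?D"
      by blast
    ultimately show ?thesis by simp
  qed
  then have "compact (?box \<inter> ?D)" by (rule compact_Int_closed[OF compact_complex_box])
  then show ?thesis unfolding D .
qed

text \<open>
  If \<open>a \<noteq> 0\<close> at a point, the inequalities \<open>\<bar>a\<bar> > \<delta>\<close>
  and \<open>nrm < R\<close> define a neighbourhood that witnesses properness.
\<close>

lemma nonproper_set_in_hypersurface: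
  fixes K :: "nat \<Rightarrow> complex mpoly" and G :: "nat \<Rightarrow> real mpoly"
  assumes K: "\<And>i. i < n \<Longrightarrow> K i \<in> mpolys n" and et: "etale n K"
    and G: "\<And>x. x \<in> coord_space (2 * n) \<Longrightarrow> polymap (2 * n) G x = to_real (polymap n K (to_complex x))"
  shows "\<exists>a\<in>mpolys n. a \<noteq> 0 \<and> (\<forall>y \<in> nonproper_set (Euclidean_space (2 * n)) (Euclidean_space (2 * n)) (polymap (2 * n) G).
     meval (to_complex y) a = 0)"
proof -
  let ?E = "Euclidean_space (2 * n)" and ?G = "polymap (2 * n) G"
  obtain a C M where a: "a \<in> mpolys n" "a \<noteq> 0" and C: "C \<ge> 0"
    "\<And>x i. x \<in> coord_space n \<Longrightarrow> i < n \<Longrightarrow> norm (meval (polymap n K x) a * x i) \<le> C * nrm n (polymap n K x) ^ M"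
    using etale_growth[OF K et] by blast
  have "meval (to_complex y) a = 0" if y: "y \<in> nonproper_set ?E ?E ?G" for y
  proof (rule ccontr)
    assume nz: "meval (to_complex y) a \<noteq> 0"
    have yE: "y \<in> coord_space (2 * n)" using y by (simp add: nonproper_set_def topspace_Euclidean_space_coord_space)
    define \<delta> where "\<delta> = norm (meval (to_complex y) a) / 2"
    define R where "R = nrm n (to_complex y) + 1"
    have \<delta>: "\<delta> > 0" using nz by (simp add: \<delta>_def)
    have c1: "continuous_on UNIV (\<lambda>x. norm (meval (to_complex x) a))"
      by (intro continuous_intros continuous_on_meval continuous_on_to_complex)
    have c2: "continuous_on UNIV (\<lambda>x. nrm n (to_complex x))"
      by (intro continuous_intros continuous_on_to_complex)
    define V where "V = coord_space (2 * n) \<inter> ({x. \<delta> < norm (meval (to_complex x) a)} \<inter> {x. nrm n (to_complex x) < R})"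
    define T where "T = coord_space (2 * n) \<inter> ({x. \<delta> \<le> norm (meval (to_complex x) a)} \<inter> {x. nrm n (to_complex x) \<le> R})"
    have V: "openin ?E V"
      unfolding V_def Euclidean_space_eq_top_of_set openin_open
      by (rule exI[of _ "{x. \<delta> < norm (meval (to_complex x) a)} \<inter> {x. nrm n (to_complex x) < R}"])
        (intro conjI refl open_Int open_Collect_less c1 c2 continuous_on_const)
    have T: "closedin ?E T"
      unfolding T_def closedin_Euclidean_space_iff
      by (intro conjI closed_Int closed_coord_space closed_Collect_le c1 c2 continuous_on_const)
        (auto simp: topspace_Euclidean_space_coord_space)
    have VT: "?E closure_of V \<subseteq> T" by (rule closure_of_minimal[OF _ T]) (auto simp: V_def T_def)
    define D where "D = {x \<in> topspace ?E. ?G x \<in> ?E closure_of V}"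
    define D' where "D' = {z \<in> coord_space n. \<delta> \<le> norm (meval (polymap n K z) a) \<and> nrm n (polymap n K z) \<le> R}"
    have "compact D'" unfolding D'_def by (rule compact_polymap_preimage[OF C \<delta>])
    then have "compact (to_real ` D')"
      by (intro compact_continuous_image continuous_on_to_real continuous_on_id)
    moreover have "to_real ` D' \<subseteq> coord_space (2 * n)" by (auto simp: D'_def)
    ultimately have "compactin ?E (to_real ` D')"
      by (simp add: Euclidean_space_eq_top_of_set compactin_subtopology)
    moreover have "D \<subseteq> to_real ` D'"
    proof
      fix x assume "x \<in> D"
      then have x: "x \<in> coord_space (2 * n)" "?G x \<in> T"
        using VT by (auto simp: D_def topspace_Euclidean_space_coord_space)
      then have "to_complex x \<in> D'" by (auto simp: D'_def T_def G)
      then show "x \<in> to_real ` D'" by (metis imageI to_real_to_complex)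
    qed
    moreover have "closedin ?E D"
      unfolding D_def
    proof (rule closedin_continuous_map_preimage)
      show "continuous_map ?E ?E ?G"
        unfolding Euclidean_space_eq_top_of_set using continuous_on_polymap[OF continuous_on_id] by auto
    qed simp
    ultimately have "compactin ?E D" by (rule closed_compactin)
    moreover have "y \<in> V" using yE nz by (auto simp: V_def \<delta>_def R_def)
    moreover have "V \<subseteq> topspace ?E" by (auto simp: V_def topspace_Euclidean_space_coord_space)
    ultimately show False using y V by (auto simp: nonproper_set_def D_def)
  qed
  with a show ?thesis by blast
qed

lemma codim_nonproper_set:
  fixes K :: "nat \<Rightarrow> complex mpoly" and G :: "nat \<Rightarrow> real mpoly"
  assumes K: "\<And>i. i < n \<Longrightarrow> K i \<in> mpolys n" and et: "etale n K"
    and G: "\<And>x. x \<in> coord_space (2 * n) \<Longrightarrow> polymap (2 * n) G x = to_real (polymap n K (to_complex x))"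
    and S: "S = nonproper_set (Euclidean_space (2 * n)) (Euclidean_space (2 * n)) (polymap (2 * n) G)"
  shows "S = {} \<or> real_codim (2 * n) S \<ge> 2"
proof -
  obtain a where a: "a \<in> mpolys n" "a \<noteq> 0" "\<And>y. y \<in> S \<Longrightarrow> meval (to_complex y) a = 0"
    using nonproper_set_in_hypersurface[OF K et G] S by metis
  have "S \<subseteq> coord_space (2 * n)" by (auto simp: S nonproper_set_def topspace_Euclidean_space_coord_space)
  with a show ?thesis using real_codim_in_complex_hypersurface by blast
qed

section \<open>Nilpotency of the Jacobian matrix of the cubic part\<close>

lemma strictly_upper_triangular_power:
  fixes B :: "'a::comm_ring_1 mat"
  assumes B: "B \<in> carrier_mat n n" and z: "\<And>i j. j \<le> i \<Longrightarrow> i < n \<Longrightarrow> B $$ (i, j) = 0"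
  shows "B ^\<^sub>m n = 0\<^sub>m n n"
proof -
  have "(B ^\<^sub>m k) $$ (i, j) = 0" if "i < n" "j < n" "j < i + k" for i j k
    using that
  proof (induction k arbitrary: i j)
    case 0
    then show ?case using B by simp
  next
    case (Suc k)
    have "(B ^\<^sub>m k) $$ (i, l) * B $$ (l, j) = 0" if l: "l < n" for l
    proof (cases "l < i + k")
      case True
      then show ?thesis using Suc.IH[OF Suc.prems(1) l True] by simp
    next
      case False
      then have "j \<le> l" using Suc.prems by simp
      then show ?thesis using z[OF _ l] by simp
    qed
    moreover have "(B ^\<^sub>m Suc k) $$ (i, j) = (\<Sum>l = 0..<n. (B ^\<^sub>m k) $$ (i, l) * B $$ (l, j))"
      using B Suc.prems by (simp add: scalar_prod_def)
    ultimately show ?case by simp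
  qed
  then show ?thesis using B by (intro eq_matI) auto
qed

lemma nilpotent_if_no_nonzero_eigenvalue:
  fixes A :: "complex mat"
  assumes A: "A \<in> carrier_mat n n" and ev: "\<And>l. eigenvalue A l \<Longrightarrow> l = 0"
  shows "A ^\<^sub>m n = 0\<^sub>m n n"
proof -
  obtain as where as: "char_poly A = (\<Prod>a\<leftarrow>as. [:- a, 1:])" using char_poly_factorized[OF A] by blast
  obtain B P Q where s: "schur_decomposition A as = (B, P, Q)" by (cases "schur_decomposition A as") auto
  have wit: "similar_mat_wit A B P Q" and ut: "upper_triangular B" and d: "diag_mat B = as"
    using schur_decomposition[OF A as s] by auto
  have B: "B \<in> carrier_mat n n" and P: "P \<in> carrier_mat n n" and Q: "Q \<in> carrier_mat n n"
    using similar_mat_witD2[OF A wit] by auto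
  have "a = 0" if "a \<in> set as" for a
  proof -
    have "poly (char_poly A) a = 0" unfolding as using that
      by (auto simp: poly_prod_list prod_list_zero_iff)
    then show ?thesis using ev eigenvalue_root_char_poly[OF A] by blast
  qed
  then have "B $$ (i, i) = 0" if "i < n" for i
    using that B d[symmetric] by (auto simp: diag_mat_def)
  then have "B ^\<^sub>m n = 0\<^sub>m n n"
    using ut B by (intro strictly_upper_triangular_power) (auto simp: le_less upper_triangular_def)
  then show ?thesis using similar_mat_wit_pow_id[OF wit, of n] P Q by simp
qed

lemma homogeneous_0 [simp]: "homogeneous d 0"
  by (simp add: homogeneous_def)

lemma homogeneous_1 [simp]: "homogeneous 0 (1 :: 'a::zero_neq_one mpoly)"
  by (simp add: homogeneous_def)

lemma homogeneous_mconst [simp]: "homogeneous 0 (mconst c)"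
  by (simp add: homogeneous_def mconst_def)

lemma homogeneous_mvar [simp]: "homogeneous 1 (mvar i :: 'a::zero_neq_one mpoly)"
  by (simp add: homogeneous_def mvar_def)

lemma homogeneous_add: "homogeneous d p \<Longrightarrow> homogeneous d q \<Longrightarrow> homogeneous d (p + q)" for p :: "'a::monoid_add mpoly"
  using keys_add[of p q] by (auto simp: homogeneous_def)

lemma homogeneous_uminus: "homogeneous d p \<Longrightarrow> homogeneous d (- p)" for p :: "'a::ab_group_add mpoly"
  by (auto simp: homogeneous_def in_keys_iff)

lemma homogeneous_sum: "(\<And>a. a \<in> A \<Longrightarrow> homogeneous d (f a)) \<Longrightarrow> homogeneous d (sum f A)"
  for f :: "_ \<Rightarrow> 'a::comm_monoid_add mpoly"
  by (induction A rule: infinite_finite_induct) (auto intro: homogeneous_add)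

lemma homogeneous_mult: "homogeneous d p \<Longrightarrow> homogeneous e q \<Longrightarrow> homogeneous (d + e) (p * q)" for p :: "'a::semiring_0 mpoly"
  using keys_mult[of p q] by (fastforce simp: homogeneous_def mdeg_add)

lemma homogeneous_power: "homogeneous d p \<Longrightarrow> homogeneous (k * d) (p ^ k)" for p :: "'a::comm_semiring_1 mpoly"
  by (induction k) (auto dest: homogeneous_mult)

lemma homogeneous_prod: "finite A \<Longrightarrow> (\<And>a. a \<in> A \<Longrightarrow> homogeneous (e a) (f a)) \<Longrightarrow> homogeneous (sum e A) (prod f A)"
  for f :: "_ \<Rightarrow> 'a::comm_semiring_1 mpoly"
  by (induction A rule: finite_induct) (auto intro: homogeneous_mult)

lemma homogeneous_mpderiv: "homogeneous (Suc d) p \<Longrightarrow> homogeneous d (mpderiv i p)"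
proof (unfold homogeneous_def, intro ballI)
  fix m assume *: "\<forall>m\<in>keys p. mdeg m = Suc d" "m \<in> keys (mpderiv i p)"
  then have "m + single i 1 \<in> keys p" by (auto simp: in_keys_iff lookup_mpderiv)
  with * show "mdeg m = d" by (fastforce simp: mdeg_add)
qed

lemma meval_homogeneous:
  assumes "homogeneous d p" shows "meval (\<lambda>i. c * x i) p = c ^ d * meval x p"
proof -
  have "monomial_value (\<lambda>i. c * x i) m = c ^ d * monomial_value x m" if "m \<in> keys p" for m
    using assms that
    by (simp add: homogeneous_def monomial_value_def power_mult_distrib prod.distrib power_sum[symmetric] mdeg_def)
  then show ?thesis
    by (simp add: meval_eq_msubst msubst_def sum_distrib_left mult_ac)
qed

definition ddir :: "nat \<Rightarrow> 'a::comm_ring_1 mpoly \<Rightarrow> (nat \<Rightarrow> 'a) \<Rightarrow> (nat \<Rightarrow> 'a) \<Rightarrow> 'a" where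
  "ddir n p x v = (\<Sum>j<n. meval x (mpderiv j p) * v j)"

lemma etale_ddir: "etale n F \<longleftrightarrow> (\<forall>x\<in>coord_space n. \<forall>v\<in>coord_space n.
     (\<forall>i<n. ddir n (F i) x v = 0) \<longrightarrow> v = (\<lambda>_. 0))"
  by (simp add: etale_def ddir_def)

lemma ddir_add: "ddir n (p + q) x v = ddir n p x v + ddir n q x v"
  by (simp add: ddir_def mpderiv_simps meval_simps algebra_simps sum.distrib)

lemma ddir_uminus: "ddir n (- p) x v = - ddir n p x v"
  by (simp add: ddir_def mpderiv_simps meval_simps sum_negf)

lemma ddir_minus: "ddir n (p - q) x v = ddir n p x v - ddir n q x v"
  using ddir_add[of n p "- q"] by (simp add: ddir_uminus)

lemma ddir_mult: "ddir n (p * q) x v = ddir n p x v * meval x q + meval x p * ddir n q x v"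
  by (simp add: ddir_def mpderiv_simps meval_simps algebra_simps sum.distrib sum_distrib_left)

lemma ddir_mconst [simp]: "ddir n (mconst c) x v = 0"
  by (simp add: ddir_def)

lemma ddir_0 [simp]: "ddir n 0 x v = 0"
  by (simp add: ddir_def)

lemma ddir_mvar: "i < n \<Longrightarrow> ddir n (mvar i) x v = v i"
proof -
  assume "i < n"
  have "ddir n (mvar i) x v = (\<Sum>j<n. if j = i then v j else 0)"
    unfolding ddir_def by (intro sum.cong) (auto simp: mpderiv_mvar)
  with \<open>i < n\<close> show ?thesis by simp
qed

lemma ddir_sum: "ddir n (sum f A) x v = (\<Sum>a\<in>A. ddir n (f a) x v)"
  by (induction A rule: infinite_finite_induct) (auto simp: ddir_add)

lemmas ddir_simps = ddir_add ddir_uminus ddir_minus ddir_mult ddir_sum ddir_mvar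

lemma ddir_mono: "p \<in> mpolys n \<Longrightarrow> n \<le> N \<Longrightarrow> ddir N p x v = ddir n p x v"
  unfolding ddir_def by (rule sum.mono_neutral_right) (auto simp: mpderiv_outside)

lemma ddir_cong:
  assumes "p \<in> mpolys n" "\<And>i. i < n \<Longrightarrow> x i = y i" "\<And>i. i < n \<Longrightarrow> v i = w i"
  shows "ddir n p x v = ddir n p y w"
  unfolding ddir_def using assms
  by (intro sum.cong refl arg_cong2[of _ _ _ _ "(*)"] meval_cong[OF mpolys_mpderiv[OF assms(1)]]) auto

lemma ddir_homogeneous:
  "homogeneous (Suc d) p \<Longrightarrow> ddir n p (\<lambda>i. c * x i) v = c ^ d * ddir n p x v"
  by (simp add: ddir_def meval_homogeneous[OF homogeneous_mpderiv] sum_distrib_left mult_ac)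

lemma DERIV_ddir:
  fixes p :: "'a::real_normed_field mpoly"
  assumes "p \<in> mpolys n"
  shows "((\<lambda>t. meval (\<lambda>i. x i + t * v i) p) has_field_derivative ddir n p x v) (at 0)"
  using DERIV_meval_line[OF assms, of x v 0] by (simp add: ddir_def)

text \<open>
  The entries of \<open>JH\<close> are homogeneous of degree two. So an eigenvector of
  \<open>JH(x)\<close> for an eigenvalue \<open>l \<noteq> 0\<close> is annihilated by \<open>-1 +
  JH(cx)\<close>, where \<open>c\<^sup>2 = 1 / l\<close>.
\<close>

lemma etale_homogeneous_nilpotent:
  fixes H :: "nat \<Rightarrow> complex mpoly"
  assumes hom: "\<And>i. i < n \<Longrightarrow> homogeneous 3 (H i)" and et: "etale n (\<lambda>i. - mvar i + H i)"
    and x: "x \<in> coord_space n"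
  shows "mat n n (\<lambda>(i, j). meval x (mpderiv j (H i))) ^\<^sub>m n = 0\<^sub>m n n" (is "?A ^\<^sub>m n = _")
proof (rule nilpotent_if_no_nonzero_eigenvalue)
  fix l assume "eigenvalue ?A l"
  then obtain u where u: "u \<in> carrier_vec n" "u \<noteq> 0\<^sub>v n" "?A *\<^sub>v u = l \<cdot>\<^sub>v u"
    by (auto simp: eigenvalue_def eigenvector_def)
  show "l = 0"
  proof (rule ccontr)
    assume l: "l \<noteq> 0"
    define v where "v = (\<lambda>i. if i < n then vec_index u i else 0)"
    have uv: "u = vec n v" using u(1) by (intro eq_vecI) (auto simp: v_def)
    have v: "v \<in> coord_space n" by (auto simp: v_def coord_space_def)
    have Hv: "ddir n (H i) x v = l * v i" if "i < n" for i
    proof -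
      have "ddir n (H i) x v = vec_index (?A *\<^sub>v vec n v) i"
        unfolding ddir_def by (rule mult_mat_vec_eq_sum[OF that, symmetric])
      also have "\<dots> = l * v i" unfolding u(3)[unfolded uv] using that by simp
      finally show ?thesis .
    qed
    define c where "c = csqrt (1 / l)"
    have "homogeneous (Suc 2) (H i)" if "i < n" for i using hom[OF that] by (simp add: eval_nat_numeral)
    then have "ddir n (H i) (\<lambda>i. c * x i) v = c\<^sup>2 * (l * v i)" if "i < n" for i
      using ddir_homogeneous Hv that by metis
    also have "c\<^sup>2 * (l * v i) = v i" for i using l by (simp add: c_def)
    finally have "ddir n (- mvar i + H i) (\<lambda>i. c * x i) v = 0" if "i < n" for i
      using that by (simp add: ddir_simps)
    moreover have "(\<lambda>i. c * x i) \<in> coord_space n" using x by (simp add: coord_space_def)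
    ultimately have "v = (\<lambda>_. 0)" using et v by (auto simp: etale_ddir)
    then show False using u(2) uv by auto
  qed
qed simp

section \<open>The real map underlying a complex map\<close>

text \<open>
  The substitution \<open>z\<^sub>j = x\<^sub>2\<^sub>j + \<i>
  x\<^sub>2\<^sub>j\<^sub>+\<^sub>1\<close>, still with complex coefficients; real and imaginary parts
  are taken afterwards, coefficient by coefficient.
\<close>

definition complex_coords :: "complex mpoly \<Rightarrow> complex mpoly" where
  "complex_coords p = msubst mconst (\<lambda>j. mvar (2 * j) + mconst \<i> * mvar (2 * j + 1)) p"

definition realify :: "(nat \<Rightarrow> complex mpoly) \<Rightarrow> nat \<Rightarrow> real mpoly" where
  "realify F k = Poly_Mapping.map (if even k then Re else Im) (complex_coords (F (k div 2)))"

lemma comm_semiring_hom_mconst: "comm_semiring_hom (mconst :: 'a::comm_semiring_1 \<Rightarrow> _)"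
  by unfold_locales (simp_all add: mconst_def single_add mult_single)

lemmas msubst_mconst_simps =
  comm_semiring_hom.msubst_add[OF comm_semiring_hom_mconst]
  comm_semiring_hom.msubst_mult[OF comm_semiring_hom_mconst]
  comm_semiring_hom.msubst_mconst[OF comm_semiring_hom_mconst]
  comm_semiring_hom.msubst_mvar[OF comm_semiring_hom_mconst]

lemma complex_coords_mpolys: "p \<in> mpolys n \<Longrightarrow> complex_coords p \<in> mpolys (2 * n)"
  by (induction p rule: mpolys_induct)
    (auto simp: complex_coords_def msubst_mconst_simps intro!: mpolys_intros)

lemma complex_coords_homogeneous: "homogeneous d p \<Longrightarrow> homogeneous d (complex_coords p)"
  unfolding complex_coords_def msubst_def
proof (rule homogeneous_sum)
  fix m assume "homogeneous d p" "m \<in> keys p"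
  then have d: "d = (\<Sum>i\<in>keys m. lookup m i * 1)" by (simp add: homogeneous_def mdeg_def)
  have lin: "homogeneous 1 (mvar (2 * j) + mconst \<i> * mvar (2 * j + 1))" for j
  proof (intro homogeneous_add homogeneous_mvar)
    have "homogeneous (0 + 1) (mconst \<i> * mvar (2 * j + 1))"
      by (intro homogeneous_mult homogeneous_mconst homogeneous_mvar)
    then show "homogeneous 1 (mconst \<i> * mvar (2 * j + 1))" by (simp only: add_0)
  qed
  have "homogeneous d (monomial_value (\<lambda>j. mvar (2 * j) + mconst \<i> * mvar (2 * j + 1)) m)"
    unfolding monomial_value_def d by (intro homogeneous_prod homogeneous_power lin finite_keys)
  then show "homogeneous d (mconst (lookup p m) * monomial_value (\<lambda>j. mvar (2 * j) + mconst \<i> * mvar (2 * j + 1)) m)"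
    using homogeneous_mult[OF homogeneous_mconst] by fastforce
qed

lemma meval_complex_coords:
  "meval (\<lambda>i. complex_of_real (x i)) (complex_coords p) = meval (to_complex x) p"
proof -
  obtain n where "p \<in> mpolys n" using mpolys_exists by blast
  then show ?thesis
    by (induction p rule: mpolys_induct)
      (auto simp: complex_coords_def msubst_mconst_simps meval_simps to_complex_def Complex_eq)
qed

lemma keys_map_subset: "h 0 = 0 \<Longrightarrow> keys (Poly_Mapping.map h p) \<subseteq> keys p"
  by (auto simp: in_keys_iff Poly_Mapping.map.rep_eq when_def)

lemma meval_map_real_part:
  assumes h: "h = Re \<or> h = Im"
  shows "meval x (Poly_Mapping.map h p) = h (meval (\<lambda>i. complex_of_real (x i)) p)"
proof -
  have h0: "h 0 = 0" and hm: "h (c * complex_of_real r) = h c * r" and hs: "h (sum f A) = (\<Sum>a\<in>A. h (f a))" for c r f A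
    using h by auto
  have lk: "lookup (Poly_Mapping.map h p) m = h (lookup p m)" for m
    using h0 by (simp add: Poly_Mapping.map.rep_eq when_def)
  have "meval x (Poly_Mapping.map h p) = (\<Sum>m\<in>keys p. lookup (Poly_Mapping.map h p) m * monomial_value x m)"
    unfolding meval_eq_msubst msubst_def
    by (rule sum.mono_neutral_left) (use keys_map_subset[of h p] h0 in \<open>auto simp: in_keys_iff\<close>)
  also have "\<dots> = (\<Sum>m\<in>keys p. h (lookup p m * complex_of_real (monomial_value x m)))"
    by (simp add: lk hm)
  also have "\<dots> = h (meval (\<lambda>i. complex_of_real (x i)) p)"
    by (simp add: hs[symmetric] meval_eq_msubst msubst_def monomial_value_def)
  finally show ?thesis .
qed

lemma meval_realify: "meval x (realify F k) = to_real (\<lambda>j. meval (to_complex x) (F j)) k"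
  by (simp add: realify_def meval_map_real_part meval_complex_coords to_real_def)

lemma keys_realify_subset: "keys (realify F k) \<subseteq> keys (complex_coords (F (k div 2)))"
  unfolding realify_def by (rule keys_map_subset) simp

lemma realify_mpolys: "k < 2 * n \<Longrightarrow> (\<And>i. i < n \<Longrightarrow> F i \<in> mpolys n) \<Longrightarrow> realify F k \<in> mpolys (2 * n)"
proof -
  assume "k < 2 * n" "\<And>i. i < n \<Longrightarrow> F i \<in> mpolys n"
  then have "complex_coords (F (k div 2)) \<in> mpolys (2 * n)" by (intro complex_coords_mpolys) auto
  then show ?thesis using keys_realify_subset unfolding mpolys_def by blast
qed

lemma realify_homogeneous: "homogeneous d (F (k div 2)) \<Longrightarrow> homogeneous d (realify F k)"
  using complex_coords_homogeneous[of d "F (k div 2)"] keys_realify_subset unfolding homogeneous_def by blast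

text \<open>
  Both sides are the derivative of the same function along a real line.
\<close>

lemma ddir_realify:
  assumes F: "\<And>i. i < n \<Longrightarrow> F i \<in> mpolys n" and k: "k < 2 * n"
  shows "ddir (2 * n) (realify F k) x (to_real v) = to_real (\<lambda>j. ddir n (F j) (to_complex x) v) k"
proof -
  define h where "h = (if even k then Re else Im)"
  let ?j = "k div 2"
  have j: "?j < n" using k by auto
  have bl: "bounded_linear h" using bounded_linear_Re bounded_linear_Im by (auto simp: h_def)
  have tr: "to_real g k = h (g ?j)" for g by (simp add: to_real_def h_def)
  have line: "to_complex (\<lambda>i. x i + t * to_real v i) = (\<lambda>j. to_complex x j + of_real t * v j)" for t
    by (auto simp: to_complex_def to_real_def complex_eq_iff)
  have "((\<lambda>t. meval (\<lambda>i. to_complex x i + t * v i) (F ?j)) has_field_derivative ddir n (F ?j) (to_complex x) v) (at (of_real 0))"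
    using DERIV_ddir[OF F[OF j]] by simp
  then have "((\<lambda>t. meval (\<lambda>i. to_complex x i + of_real t * v i) (F ?j)) has_vector_derivative ddir n (F ?j) (to_complex x) v) (at 0)"
    by (rule has_vector_derivative_real_field)
  then have "((\<lambda>t. h (meval (\<lambda>i. to_complex x i + of_real t * v i) (F ?j))) has_vector_derivative h (ddir n (F ?j) (to_complex x) v)) (at 0)"
    by (rule bounded_linear.has_vector_derivative[OF bl])
  then have 1: "((\<lambda>t. meval (\<lambda>i. x i + t * to_real v i) (realify F k)) has_field_derivative h (ddir n (F ?j) (to_complex x) v)) (at 0)"
    unfolding meval_realify line tr by (simp add: has_real_derivative_iff_has_vector_derivative)
  have 2: "((\<lambda>t. meval (\<lambda>i. x i + t * to_real v i) (realify F k)) has_field_derivative ddir (2 * n) (realify F k) x (to_real v)) (at 0)"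
    by (rule DERIV_ddir[OF realify_mpolys[OF k F]])
  show ?thesis using DERIV_unique[OF 2 1] by (simp add: tr)
qed

lemma mat_pow_mult_vec_funpow:
  fixes M :: "nat \<Rightarrow> nat \<Rightarrow> 'a::comm_ring_1"
  shows "(mat n n (\<lambda>(i, j). M i j) ^\<^sub>m k) *\<^sub>v vec n v =
     vec n (((\<lambda>v i. if i < n then \<Sum>j<n. M i j * v j else 0) ^^ k) v)" (is "(?A ^\<^sub>m k) *\<^sub>v _ = vec n ((?L ^^ k) v)")
proof (induction k arbitrary: v)
  case 0
  show ?case by simp
next
  case (Suc k)
  have A: "?A \<in> carrier_mat n n" by simp
  have "(?A ^\<^sub>m Suc k) *\<^sub>v vec n v = (?A ^\<^sub>m k) *\<^sub>v (?A *\<^sub>v vec n v)"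
    using A by (simp add: assoc_mult_mat_vec[of _ n n _ n] pow_carrier_mat)
  also have "?A *\<^sub>v vec n v = vec n (?L v)"
    by (rule eq_vecI) (use mult_mat_vec_eq_sum[of _ n M v] in auto)
  finally show ?case using Suc[of "?L v"] by (simp add: funpow_Suc_right del: funpow.simps)
qed

text \<open>
  A polynomial matrix is \<open>0\<close> if all its values are. At a real point the real Jacobian
  matrix acts on real vectors as the complex one acts on the corresponding complex vectors.
\<close>

lemma realify_nilpotent:
  fixes H :: "nat \<Rightarrow> complex mpoly"
  assumes H: "\<And>i. i < n \<Longrightarrow> H i \<in> mpolys n"
    and nil: "\<And>z. z \<in> coord_space n \<Longrightarrow> mat n n (\<lambda>(i, j). meval z (mpderiv j (H i))) ^\<^sub>m n = 0\<^sub>m n n"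
  shows "nilpotent_mat (jacobian_mat (2 * n) (realify H))"
proof -
  let ?N = "2 * n" and ?J = "jacobian_mat (2 * n) (realify H)"
  have J: "?J \<in> carrier_mat ?N ?N" by (simp add: jacobian_mat_def)
  have "(?J ^\<^sub>m n) $$ (i, j) = 0" if ij: "i < ?N" "j < ?N" for i j
  proof (rule mpoly_eq_0_if_vanishing)
    have "(?J ^\<^sub>m k) $$ (i, j) \<in> mpolys ?N" if "i < ?N" "j < ?N" for i j k
      using that
    proof (induction k arbitrary: i j)
      case 0
      then show ?case using J by simp
    next
      case (Suc k)
      have "?J $$ (l, j) \<in> mpolys ?N" if "l < ?N" for l
        using that Suc.prems realify_mpolys[of l n H] H by (simp add: jacobian_mat_def mpolys_mpderiv)
      then show ?case using J Suc by (auto simp: scalar_prod_def intro!: mpolys_intros)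
    qed
    then show "(?J ^\<^sub>m n) $$ (i, j) \<in> mpolys ?N" using ij by blast
    fix x :: "nat \<Rightarrow> real" assume x: "x \<in> coord_space ?N"
    let ?z = "to_complex x"
    define L where "L = (\<lambda>v i. if i < n then ddir n (H i) ?z v else 0)"
    define R where "R = (\<lambda>v i. if i < ?N then ddir ?N (realify H i) x v else 0)"
    have RL: "R (to_real v) = to_real (L v)" for v
    proof
      fix k show "R (to_real v) k = to_real (L v) k"
        using ddir_realify[of n H k x v, OF H] by (auto simp: R_def L_def to_real_def)
    qed
    have RLk: "(R ^^ k) (to_real v) = to_real ((L ^^ k) v)" for k v
      by (induction k) (auto simp: RL)
    have Lzero: "to_real ((L ^^ n) v) i = 0" for v
    proof -
      have "vec n ((L ^^ n) v) = mat n n (\<lambda>(i, j). meval ?z (mpderiv j (H i))) ^\<^sub>m n *\<^sub>v vec n v"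
        unfolding L_def ddir_def by (rule mat_pow_mult_vec_funpow[symmetric])
      also have "\<dots> = 0\<^sub>v n" unfolding nil[OF to_complex_coord_space[OF x]]
        by (rule eq_vecI) (auto simp: scalar_prod_def)
      finally have e: "vec n ((L ^^ n) v) = 0\<^sub>v n" .
      have "(L ^^ n) v (i div 2) = vec_index (vec n ((L ^^ n) v)) (i div 2)" using ij by simp
      then have "(L ^^ n) v (i div 2) = 0" unfolding e using ij by simp
      then show ?thesis by (simp add: to_real_def)
    qed
    interpret ev: comm_ring_hom "meval x" by (rule comm_ring_hom_meval)
    have mm: "map_mat (meval x) ?J = mat ?N ?N (\<lambda>(i, j). meval x (mpderiv j (realify H i)))"
      by (rule eq_matI) (auto simp: jacobian_mat_def)
    have "meval x ((?J ^\<^sub>m n) $$ (i, j)) = (map_mat (meval x) (?J ^\<^sub>m n)) $$ (i, j)"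
      using J ij by simp
    also have "map_mat (meval x) (?J ^\<^sub>m n) = map_mat (meval x) ?J ^\<^sub>m n"
      by (rule ev.mat_hom_pow[OF J])
    also have "(map_mat (meval x) ?J ^\<^sub>m n) $$ (i, j) = vec_index ((map_mat (meval x) ?J ^\<^sub>m n) *\<^sub>v vec ?N (unitv j)) i"
      using J ij by (simp add: scalar_prod_def atLeast0LessThan)
    also have "(map_mat (meval x) ?J ^\<^sub>m n) *\<^sub>v vec ?N (unitv j) = vec ?N ((R ^^ n) (unitv j))"
      unfolding mm R_def ddir_def by (rule mat_pow_mult_vec_funpow)
    also have "vec_index (vec ?N ((R ^^ n) (unitv j))) i = (R ^^ n) (to_real (to_complex (unitv j))) i"
      using ij by simp
    also have "\<dots> = 0" unfolding RLk by (rule Lzero)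
    finally show "meval x ((?J ^\<^sub>m n) $$ (i, j)) = 0" .
  qed
  then have "?J ^\<^sub>m n = 0\<^sub>m (dim_row ?J) (dim_col ?J)" using J by (intro eq_matI) auto
  then show ?thesis unfolding nilpotent_mat_def by blast
qed

section \<open>Etale maps are injective\<close>

definition real_cubic_injectivity :: bool where
  "real_cubic_injectivity \<longleftrightarrow> (\<forall>(n::nat) (H :: nat \<Rightarrow> real mpoly) (F :: nat \<Rightarrow> real mpoly) (S :: (nat \<Rightarrow> real) set).
      n \<ge> 2 \<longrightarrow> (\<forall>i<n. H i \<in> mpolys n) \<longrightarrow> (\<forall>i<n. H i = 0 \<or> homogeneous 3 (H i)) \<longrightarrow>
      nilpotent_mat (jacobian_mat n H) \<longrightarrow> (\<forall>i<n. F i = - mvar i + H i) \<longrightarrow>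
      S = nonproper_set (Euclidean_space n) (Euclidean_space n) (polymap n F) \<longrightarrow>
      S = {} \<or> real_codim n S \<ge> 2 \<longrightarrow> inj_on (polymap n F) (coord_space n))"

lemma coord_space_eqI:
  "x \<in> coord_space n \<Longrightarrow> y \<in> coord_space n \<Longrightarrow> (\<And>i. i < n \<Longrightarrow> x i = y i) \<Longrightarrow> x = y"
  by (rule ext, rename_tac i, case_tac "i < n") (auto simp: coord_space_def)

lemma inj_complex_cubic:
  fixes H :: "nat \<Rightarrow> complex mpoly"
  assumes hyp: real_cubic_injectivity and n: "n \<ge> 1"
    and H: "\<And>i. i < n \<Longrightarrow> H i \<in> mpolys n" and hom: "\<And>i. i < n \<Longrightarrow> homogeneous 3 (H i)"
    and et: "etale n (\<lambda>i. - mvar i + H i)"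
  shows "inj_on (polymap n (\<lambda>i. - mvar i + H i)) (coord_space n)"
proof -
  define K where "K = (\<lambda>i. - mvar i + H i)"
  define G where "G = (\<lambda>i. - mvar i + realify H i)"
  have K: "K i \<in> mpolys n" if "i < n" for i
    unfolding K_def using H that by (intro mpolys_intros) auto
  have GK: "polymap (2 * n) G x = to_real (polymap n K (to_complex x))" if x: "x \<in> coord_space (2 * n)" for x
  proof
    fix k
    show "polymap (2 * n) G x k = to_real (polymap n K (to_complex x)) k"
    proof (cases "k < 2 * n")
      case True
      have "x k = to_real (to_complex x) k" by simp
      with True show ?thesis
        by (auto simp: polymap_def G_def K_def meval_simps meval_realify to_real_def)
    next
      case False
      then show ?thesis by (simp add: polymap_def to_real_def)
    qed
  qed
  have nil: "nilpotent_mat (jacobian_mat (2 * n) (realify H))"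
    using etale_homogeneous_nilpotent[of n H, OF hom et] by (intro realify_nilpotent H)
  define S where "S = nonproper_set (Euclidean_space (2 * n)) (Euclidean_space (2 * n)) (polymap (2 * n) G)"
  have "S = {} \<or> real_codim (2 * n) S \<ge> 2"
    using codim_nonproper_set[OF K et[folded K_def] GK S_def] by simp
  moreover have "realify H i \<in> mpolys (2 * n)" "homogeneous 3 (realify H i)" if "i < 2 * n" for i
    using that by (auto intro!: realify_mpolys H realify_homogeneous hom)
  ultimately have inj: "inj_on (polymap (2 * n) G) (coord_space (2 * n))"
    using hyp[unfolded real_cubic_injectivity_def, rule_format, of "2 * n" "realify H" G S] n nil S_def
    by (simp add: G_def)
  show ?thesis
    unfolding K_def[symmetric]
  proof (rule inj_onI)
    fix z w assume zw: "z \<in> coord_space n" "w \<in> coord_space n" "polymap n K z = polymap n K w"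
    then have "polymap (2 * n) G (to_real z) = polymap (2 * n) G (to_real w)"
      by (simp add: GK)
    then have "to_real z = to_real w" using inj zw by (auto dest: inj_onD)
    then show "z = w" by (metis to_complex_to_real)
  qed
qed

lemma cubic_decomposition:
  fixes p :: "'a::ab_group_add mpoly"
  assumes p: "p \<in> mpolys n" "mdeg_le 3 p"
  shows "\<exists>q\<in>mpolys n. \<exists>r\<in>mpolys n. homogeneous 2 q \<and> homogeneous 3 r \<and> mdeg_le 1 (p - q - r)"
proof -
  define part where "part d = (\<Sum>m\<in>{m\<in>keys p. mdeg m = d}. single m (lookup p m))" for d
  have lk: "lookup (part d) m = (if mdeg m = d then lookup p m else 0)" for d m
  proof -
    have "lookup (part d) m = (\<Sum>k\<in>{m\<in>keys p. mdeg m = d}. if k = m then lookup p m else 0)"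
      unfolding part_def lookup_sum by (intro sum.cong) (auto simp: lookup_single when_def)
    then show ?thesis by (auto simp: in_keys_iff)
  qed
  have "part d \<in> mpolys n" for d
    unfolding part_def using p(1) by (intro mpolys_sum mpolys_single) (auto simp: mpolys_def)
  moreover have "homogeneous d (part d)" for d
    by (auto simp: homogeneous_def in_keys_iff lk split: if_splits)
  moreover have "mdeg_le 1 (p - part 2 - part 3)"
  proof (unfold mdeg_le_def, intro ballI)
    fix m assume m: "m \<in> keys (p - part 2 - part 3)"
    then have "lookup p m \<noteq> 0" "mdeg m \<noteq> 2" "mdeg m \<noteq> 3"
      by (auto simp: in_keys_iff lk lookup_minus split: if_splits)
    moreover have "mdeg m \<le> 3" using p(2) calculation(1) by (auto simp: mdeg_le_def in_keys_iff)
    ultimately show "mdeg m \<le> 1" by linarith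
  qed
  ultimately show ?thesis by blast
qed

lemma meval_homogeneous_0: "homogeneous (Suc d) p \<Longrightarrow> meval (\<lambda>_. 0) p = 0"
  using meval_homogeneous[of "Suc d" p 0 "\<lambda>_. 0"] by simp

lemma normalized_cubic_form:
  fixes p :: "'a::{idom,ring_char_0} mpoly"
  assumes p: "p \<in> mpolys n" "mdeg_le 3 p" and i: "i < n"
    and p0: "meval (\<lambda>_. 0) p = 0" and dp: "\<And>j. j < n \<Longrightarrow> meval (\<lambda>_. 0) (mpderiv j p) = (if j = i then 1 else 0)"
  shows "\<exists>q\<in>mpolys n. \<exists>r\<in>mpolys n. homogeneous 2 q \<and> homogeneous 3 r \<and> p = mvar i + q + r"
proof -
  obtain q r where q: "q \<in> mpolys n" "homogeneous 2 q" and r: "r \<in> mpolys n" "homogeneous 3 r"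
    and le: "mdeg_le 1 (p - q - r)" using cubic_decomposition[OF p] by blast
  define l where "l = p - q - r - mvar i"
  have q': "homogeneous (Suc (Suc 0)) q" and r': "homogeneous (Suc (Suc (Suc 0))) r"
    using q r by (simp_all add: eval_nat_numeral)
  have l: "l \<in> mpolys n" unfolding l_def by (intro mpolys_intros p q r i)
  have "mpderiv j l = 0" if j: "j < n" for j
  proof -
    have "mdeg_le 0 (mpderiv j (p - q - r))" using le by (intro mdeg_le_mpderiv) simp
    then obtain c where c: "mpderiv j (p - q - r) = mconst c" using mdeg_le_0 by blast
    have "mpderiv j l = mconst c - (if j = i then 1 else 0)"
      unfolding l_def by (subst mpderiv_minus) (simp add: c mpderiv_mvar)
    moreover have "meval (\<lambda>_. 0) (mpderiv j l) = 0"
      using dp[OF j] meval_homogeneous_0[OF homogeneous_mpderiv[OF q']] meval_homogeneous_0[OF homogeneous_mpderiv[OF r']]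
      by (auto simp: l_def mpderiv_simps meval_simps)
    ultimately have "c = (if j = i then 1 else 0)" by (auto simp: meval_simps split: if_splits)
    with \<open>mpderiv j l = _\<close> show ?thesis by (auto simp: mconst_def)
  qed
  then obtain c where c: "l = mconst c" using const_if_mpderivs_0[OF l] by blast
  have "meval (\<lambda>_. 0) l = 0"
    using p0 meval_homogeneous_0[OF q'] meval_homogeneous_0[OF r'] by (simp add: l_def meval_simps)
  then have "c = 0" by (simp add: c)
  then have "l = 0" using c by (simp add: mconst_def)
  then have "p = mvar i + q + r" by (simp add: l_def algebra_simps)
  with q r show ?thesis by blast
qed

text \<open>
  Let \<open>F = X + q + r\<close> with \<open>q\<close> quadratic and \<open>r\<close> cubic. The cubic
  homogeneous map used here is, up to sign, \<open>(x, y, t) \<mapsto> (x + t q(x) - t\<^sup>2 y, y +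
  r(x), t)\<close>. Eliminating \<open>y\<close> from its differential at \<open>(x, y, t)\<close>
  leaves the differential of \<open>F\<close> at \<open>tx\<close>, and over the points \<open>(x,
  -r(x), 1)\<close> the map is \<open>F\<close>.
\<close>

lemma inj_normalized_cubic:
  fixes F :: "nat \<Rightarrow> complex mpoly"
  assumes hyp: real_cubic_injectivity
    and F: "\<And>i. i < n \<Longrightarrow> F i \<in> mpolys n" and et: "etale n F" and deg: "\<And>i. i < n \<Longrightarrow> mdeg_le 3 (F i)"
    and F0: "\<And>i. i < n \<Longrightarrow> meval (\<lambda>_. 0) (F i) = 0"
    and dF: "\<And>i j. i < n \<Longrightarrow> j < n \<Longrightarrow> meval (\<lambda>_. 0) (mpderiv j (F i)) = (if j = i then 1 else 0)"
  shows "inj_on (polymap n F) (coord_space n)"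
proof -
  have "\<exists>q r. q \<in> mpolys n \<and> r \<in> mpolys n \<and> homogeneous 2 q \<and> homogeneous 3 r \<and> F i = mvar i + q + r" if "i < n" for i
    using normalized_cubic_form[OF F[OF that] deg[OF that] that F0[OF that] dF[OF that]] by blast
  then obtain q r where q: "\<And>i. i < n \<Longrightarrow> q i \<in> mpolys n" "\<And>i. i < n \<Longrightarrow> homogeneous 2 (q i)"
    and r: "\<And>i. i < n \<Longrightarrow> r i \<in> mpolys n" "\<And>i. i < n \<Longrightarrow> homogeneous 3 (r i)"
    and Fqr: "\<And>i. i < n \<Longrightarrow> F i = mvar i + q i + r i" by metis
  define N where "N = 2 * n + 1"
  define t :: "complex mpoly" where "t = mvar (2 * n)"
  define H where "H = (\<lambda>i. if i < n then t * t * mvar (n + i) - t * q i else if i < 2 * n then - r (i - n) else 0)"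
  define K where "K = (\<lambda>i. - mvar i + H i)"
  have qN: "q i \<in> mpolys N" "r i \<in> mpolys N" if "i < n" for i
    using q(1)[OF that] r(1)[OF that] by (auto simp: N_def intro: mpolys_mono)
  have HN: "H i \<in> mpolys N" if "i < N" for i
    using that by (auto simp: H_def t_def N_def[symmetric] intro!: mpolys_intros qN) (auto simp: N_def)
  have hom: "homogeneous 3 (H i)" for i
  proof -
    have "homogeneous (1 + 1 + 1) (t * t * mvar (n + i))" unfolding t_def
      by (intro homogeneous_mult homogeneous_mvar)
    then have 1: "homogeneous 3 (t * t * mvar (n + i))" by (simp add: numeral_3_eq_3)
    have 2: "homogeneous 3 (- (t * q i))" if "i < n"
    proof -
      have "homogeneous (1 + 2) (t * q i)" unfolding t_def
        by (intro homogeneous_mult homogeneous_mvar q that)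
      then show ?thesis by (intro homogeneous_uminus) (simp add: numeral_3_eq_3)
    qed
    show ?thesis
      using homogeneous_add[OF 1 2] r(2)[of "i - n"] by (auto simp: H_def homogeneous_uminus)
  qed
  have etK: "etale N K"
    unfolding etale_ddir
  proof (intro ballI impI)
    fix X V :: "nat \<Rightarrow> complex"
    assume X: "X \<in> coord_space N" and V: "V \<in> coord_space N" and z: "\<forall>i<N. ddir N (K i) X V = 0"
    define s where "s = X (2 * n)"
    have "ddir N (K (2 * n)) X V = 0" using z by (simp add: N_def)
    then have Vt: "V (2 * n) = 0" by (simp add: K_def H_def ddir_simps N_def)
    have Vy: "V (n + i) = - ddir n (r i) X V" if "i < n" for i
    proof -
      have "ddir N (K (n + i)) X V = 0" using z that by (simp add: N_def)
      moreover have "ddir N (K (n + i)) X V = - V (n + i) - ddir N (r i) X V"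
        using that by (simp add: K_def H_def ddir_simps N_def)
      moreover have "ddir N (r i) X V = ddir n (r i) X V" by (rule ddir_mono) (use r that in \<open>auto simp: N_def\<close>)
      ultimately have "- V (n + i) = ddir n (r i) X V" by simp
      then have "- ddir n (r i) X V = V (n + i)" by (rule minus_equation_iff[THEN iffD1])
      then show ?thesis by (rule sym)
    qed
    define W where "W = (\<lambda>i. if i < n then V i else 0)"
    define Z where "Z = (\<lambda>i. if i < n then s * X i else 0)"
    have "W = (\<lambda>_. 0)"
    proof (rule etale_ddir[THEN iffD1, OF et, rule_format])
      show "Z \<in> coord_space n" "W \<in> coord_space n" by (auto simp: Z_def W_def coord_space_def)
      fix i assume i: "i < n"
      have "ddir N (K i) X V = 0" using z i by (simp add: N_def)
      moreover have "ddir N (K i) X V = - V i + s * s * V (n + i) - s * ddir N (q i) X V"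
        using i Vt by (simp add: K_def H_def ddir_simps t_def meval_simps N_def s_def)
      moreover have "ddir N (q i) X V = ddir n (q i) X V" by (rule ddir_mono) (use q i in \<open>auto simp: N_def\<close>)
      moreover have "V i + s * ddir n (q i) X V + s\<^sup>2 * ddir n (r i) X V
          = - (- V i + s * s * V (n + i) - s * ddir n (q i) X V)"
        using Vy[OF i] by (simp add: power2_eq_square)
      ultimately have e: "V i + s * ddir n (q i) X V + s\<^sup>2 * ddir n (r i) X V = 0" by simp
      have hq: "homogeneous (Suc 1) (q i)" and hr: "homogeneous (Suc 2) (r i)"
        using q(2)[OF i] r(2)[OF i] by (simp_all add: eval_nat_numeral)
      have c: "ddir n p Z W = ddir n p (\<lambda>i. s * X i) V" if "p \<in> mpolys n" for p
        by (rule ddir_cong[OF that]) (auto simp: Z_def W_def)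
      have "ddir n (F i) Z W = W i + s * ddir n (q i) X V + s\<^sup>2 * ddir n (r i) X V"
        unfolding Fqr[OF i] using i q(1)[OF i] r(1)[OF i] ddir_homogeneous[OF hq] ddir_homogeneous[OF hr]
        by (simp add: ddir_simps c)
      then show "ddir n (F i) Z W = 0" using e i by (simp add: W_def)
    qed
    then have Vx: "V i = 0" if "i < n" for i using that by (metis W_def)
    have "ddir n (r i) X V = 0" for i by (simp add: ddir_def Vx)
    then have Vy0: "V (n + i) = 0" if "i < n" for i using Vy that by simp
    show "V = (\<lambda>_. 0)"
    proof
      fix i
      consider "i < n" | "n \<le> i" "i < 2 * n" | "i = 2 * n" | "i \<ge> N" unfolding N_def by linarith
      then show "V i = 0"
      proof cases
        case 2
        then show ?thesis using Vy0[of "i - n"] by simp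
      qed (use Vx Vt V in \<open>auto simp: coord_space_def\<close>)
    qed
  qed
  have injK: "inj_on (polymap N K) (coord_space N)"
    unfolding K_def by (rule inj_complex_cubic[OF hyp]) (use HN hom etK in \<open>auto simp: N_def K_def\<close>)
  define lift where "lift = (\<lambda>x i. if i < n then x i else if i < 2 * n then - meval x (r (i - n)) else if i = 2 * n then 1 else (0::complex))"
  have liftN: "lift x \<in> coord_space N" for x by (auto simp: lift_def coord_space_def N_def)
  have ev: "meval (lift x) p = meval x p" if "p \<in> mpolys n" for x p
    by (rule meval_cong[OF that]) (auto simp: lift_def)
  have Kl: "polymap N K (lift x) = (\<lambda>i. if i < n then - polymap n F x i else if i = 2 * n then - 1 else 0)" for x
  proof
    fix i
    consider "i < n" | "n \<le> i" "i < 2 * n" | "i = 2 * n" | "i \<ge> N" unfolding N_def by linarith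
    then show "polymap N K (lift x) i = (if i < n then - polymap n F x i else if i = 2 * n then - 1 else 0)"
    proof cases
      case 1
      then show ?thesis
        using q(1) by (simp add: polymap_def N_def K_def H_def t_def meval_simps ev Fqr) (simp add: lift_def)
    next
      case 2
      then show ?thesis
        using r(1)[of "i - n"] by (simp add: polymap_def N_def K_def H_def meval_simps ev) (simp add: lift_def)
    next
      case 3
      then show ?thesis by (simp add: polymap_def N_def K_def H_def meval_simps lift_def)
    next
      case 4
      then show ?thesis by (simp add: polymap_def N_def)
    qed
  qed
  show ?thesis
  proof (rule inj_onI)
    fix x y assume xy: "x \<in> coord_space n" "y \<in> coord_space n" "polymap n F x = polymap n F y"
    have "polymap N K (lift x) = polymap N K (lift y)" unfolding Kl xy(3) ..
    then have l: "lift x = lift y" by (rule inj_onD[OF injK]) (rule liftN)+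
    show "x = y"
    proof (rule coord_space_eqI[OF xy(1,2)])
      fix i assume "i < n"
      moreover have "lift x i = lift y i" by (simp add: l)
      ultimately show "x i = y i" by (simp add: lift_def)
    qed
  qed
qed

text \<open>
  Composing with a translation and with the inverse of \<open>DF(0)\<close> on the left raises no
  degree.
\<close>

lemma inj_cubic:
  fixes F :: "nat \<Rightarrow> complex mpoly"
  assumes hyp: real_cubic_injectivity
    and F: "\<And>i. i < n \<Longrightarrow> F i \<in> mpolys n" and et: "etale n F" and deg: "\<And>i. i < n \<Longrightarrow> mdeg_le 3 (F i)"
  shows "inj_on (polymap n F) (coord_space n)"
proof -
  define M where "M = (\<lambda>i j. meval (\<lambda>_. 0) (mpderiv j (F i)))"
  obtain B where BM: "\<And>i j. i < n \<Longrightarrow> j < n \<Longrightarrow> (\<Sum>k<n. B i k * M k j) = (if j = i then 1 else 0)"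
    and MB: "\<And>i j. i < n \<Longrightarrow> j < n \<Longrightarrow> (\<Sum>k<n. M i k * B k j) = (if j = i then 1 else 0)"
    using inverse_linear_system[of n M] etaleD[OF et coord_space_0] unfolding M_def by blast
  define F' where "F' = (\<lambda>i. \<Sum>k<n. mconst (B i k) * (F k - mconst (meval (\<lambda>_. 0) (F k))))"
  have F': "F' i \<in> mpolys n" for i unfolding F'_def using F by (intro mpolys_intros) auto
  have keys_cp: "keys (mconst c * p) \<subseteq> keys p" for c and p :: "complex mpoly"
    using keys_mult[of "mconst c" p] by (auto simp: mconst_def split: if_splits)
  have deg': "mdeg_le 3 (F' i)" for i
  proof (unfold mdeg_le_def, intro ballI)
    fix m assume "m \<in> keys (F' i)"
    then obtain k where k: "k < n" "m \<in> keys (F k - mconst (meval (\<lambda>_. 0) (F k)))"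
      unfolding F'_def using keys_sum[of "\<lambda>k. mconst (B i k) * (F k - mconst (meval (\<lambda>_. 0) (F k)))" "{..<n}"] keys_cp
      by blast
    then have "m \<in> keys (F k) \<or> m = 0"
      by (auto simp: in_keys_iff lookup_minus mconst_def lookup_single when_def split: if_splits)
    then show "mdeg m \<le> 3" using deg[OF k(1)] by (auto simp: mdeg_le_def)
  qed
  have et': "etale n F'"
    unfolding etale_ddir
  proof (intro ballI impI)
    fix x v assume x: "x \<in> coord_space n" and v: "v \<in> coord_space n" and z: "\<forall>i<n. ddir n (F' i) x v = 0"
    let ?w = "\<lambda>k. ddir n (F k) x v"
    have Bw: "(\<Sum>k<n. B i k * ?w k) = 0" if "i < n" for i
      using z that by (simp add: F'_def ddir_simps)
    have "?w i = 0" if i: "i < n" for i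
    proof -
      have "?w i = (\<Sum>j<n. if j = i then ?w j else 0)" using i by simp
      also have "\<dots> = (\<Sum>j<n. (if j = i then 1 else 0) * ?w j)" by (rule sum.cong) auto
      also have "\<dots> = (\<Sum>j<n. (\<Sum>k<n. M i k * B k j) * ?w j)" using MB[OF i] by simp
      also have "\<dots> = (\<Sum>j<n. \<Sum>k<n. M i k * (B k j * ?w j))" by (simp add: sum_distrib_right mult.assoc)
      also have "\<dots> = (\<Sum>k<n. \<Sum>j<n. M i k * (B k j * ?w j))" by (rule sum.swap)
      also have "\<dots> = (\<Sum>k<n. M i k * (\<Sum>j<n. B k j * ?w j))" by (simp add: sum_distrib_left)
      also have "\<dots> = 0" using Bw by simp
      finally show ?thesis .
    qed
    then show "v = (\<lambda>_. 0)" using et x v by (auto simp: etale_ddir)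
  qed
  have "inj_on (polymap n F') (coord_space n)"
  proof (rule inj_normalized_cubic[OF hyp F' et' deg'])
    fix i assume i: "i < n"
    show "meval (\<lambda>_. 0) (F' i) = 0" by (simp add: F'_def meval_simps)
    fix j assume j: "j < n"
    have "meval (\<lambda>_. 0) (mpderiv j (F' i)) = (\<Sum>k<n. B i k * M k j)"
      by (simp add: F'_def meval_simps mpderiv_simps M_def)
    then show "meval (\<lambda>_. 0) (mpderiv j (F' i)) = (if j = i then 1 else 0)" using BM[OF i j] by simp
  qed
  moreover have "polymap n F' x = polymap n F' y" if "polymap n F x = polymap n F y" for x y
  proof -
    have "meval x (F k) = meval y (F k)" if "k < n" for k
      using fun_cong[OF \<open>polymap n F x = polymap n F y\<close>, of k] that by (simp add: polymap_def)
    then show ?thesis by (auto simp: polymap_def F'_def meval_simps fun_eq_iff)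
  qed
  ultimately show ?thesis unfolding inj_on_def by blast
qed

text \<open>
  A monomial of degree \<open>d\<close> will be replaced by monomials of degrees at most \<open>d -
  1\<close> and \<open>d - 2\<close> (twice), and by others of degree at most three; the weight \<open>3
  ^ d\<close> outweighs them.
\<close>

definition excess :: "'a::zero mpoly \<Rightarrow> nat" where
  "excess p = (\<Sum>m\<in>keys p. if mdeg m \<ge> 4 then 3 ^ mdeg m else 0)"

lemma excess_subset: "finite A \<Longrightarrow> keys p \<subseteq> A \<Longrightarrow> excess p \<le> (\<Sum>m\<in>A. if mdeg m \<ge> 4 then 3 ^ mdeg m else 0)"
  unfolding excess_def by (rule sum_mono2) auto

lemma excess_add: "excess (p + q) \<le> excess p + excess q" for p q :: "'a::monoid_add mpoly"
proof -
  have "excess (p + q) \<le> (\<Sum>m\<in>keys p \<union> keys q. if mdeg m \<ge> 4 then 3 ^ mdeg m else 0)"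
    by (rule excess_subset) (auto simp: keys_add)
  also have "\<dots> \<le> excess p + excess q"
    unfolding excess_def
    using sum.union_inter[OF finite_keys[of p] finite_keys[of q], of "\<lambda>m. if mdeg m \<ge> 4 then 3 ^ mdeg m else (0::nat)"]
    by linarith
  finally show ?thesis .
qed

lemma excess_single: "excess (single m c) \<le> (if mdeg m \<ge> 4 then 3 ^ mdeg m else 0)"
  by (simp add: excess_def)

lemma excess_remove:
  fixes p :: "'a::ab_group_add mpoly"
  assumes "m \<in> keys p" "mdeg m \<ge> 4"
  shows "excess (p - single m (lookup p m)) + 3 ^ mdeg m = excess p"
proof -
  have "keys (p - single m (lookup p m)) = keys p - {m}"
    by (auto simp: in_keys_iff lookup_minus lookup_single when_def split: if_splits)
  then show ?thesis
    using assms unfolding excess_def by (simp add: sum.remove[of "keys p" m])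
qed

lemma split_monomial: "d \<le> mdeg m \<Longrightarrow> \<exists>a b. m = a + b \<and> mdeg a = d"
proof (induction d)
  case 0
  then show ?case by (intro exI[of _ 0] exI[of _ m]) simp
next
  case (Suc d)
  then obtain a b where ab: "m = a + b" "mdeg a = d" by auto
  then have "mdeg b \<noteq> 0" using Suc.prems by (auto simp: mdeg_add)
  then obtain i where i: "lookup b i \<noteq> 0" by (metis lookup_zero mdeg_eq_0 poly_mapping_eqI)
  have "b = single i 1 + (b - single i 1)"
    by (rule poly_mapping_eqI) (use i in \<open>auto simp: lookup_add lookup_minus lookup_single when_def\<close>)
  then have "m = (a + single i 1) + (b - single i 1)" using ab(1) by (simp add: add.assoc)
  moreover have "mdeg (a + single i 1) = Suc d" using ab(2) by (simp add: mdeg_add)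
  ultimately show ?case by blast
qed

text \<open>
  Induction on the total weight of the monomials of degree at least four. One such monomial
  \<open>cPQ\<close>, with \<open>P\<close> of degree two, is removed with the help of two new variables
  \<open>u\<close> and \<open>v\<close>.
\<close>

lemma inj_etale:
  fixes F :: "nat \<Rightarrow> complex mpoly"
  assumes hyp: real_cubic_injectivity
    and F: "\<And>i. i < n \<Longrightarrow> F i \<in> mpolys n" and et: "etale n F"
  shows "inj_on (polymap n F) (coord_space n)"
  using F et
proof (induction "\<Sum>i<n. excess (F i)" arbitrary: n F rule: less_induct)
  case less
  show ?case
  proof (cases "\<forall>i<n. mdeg_le 3 (F i)")
    case True
    then show ?thesis using less.prems by (intro inj_cubic[OF hyp]) auto
  next
    case False
    then obtain k m where k: "k < n" and m: "m \<in> keys (F k)" "mdeg m \<ge> 4"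
      by (auto simp: mdeg_le_def not_le)
    obtain a b where ab: "m = a + b" "mdeg a = 2" using split_monomial[of 2 m] m(2) by auto
    have mb: "mdeg m = Suc (Suc (mdeg b))" using ab by (simp add: mdeg_add)
    define c where "c = lookup (F k) m"
    define P Q :: "complex mpoly" where "P = single a 1" and "Q = single b 1"
    have sPQ: "single m c = mconst c * P * Q" by (simp add: P_def Q_def ab mconst_def mult_single)
    have "keys m \<subseteq> {..<n}" using less.prems(1)[OF k] m(1) by (auto simp: mpolys_def)
    moreover have "keys m = keys a \<union> keys b" by (auto simp: ab in_keys_iff lookup_add)
    ultimately have PQ: "P \<in> mpolys n" "Q \<in> mpolys n" by (auto simp: P_def Q_def intro!: mpolys_single)
    define u v :: "complex mpoly" where "u = mvar n" and "v = mvar (Suc n)"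
    define R where "R = F k - mconst c * (P + u) * (Q + v)"
    define F' where "F' = (\<lambda>i. if i = n then P + u else if i = Suc n then Q + v else if i = k then R else F i)"
    let ?N = "Suc (Suc n)"
    have up: "p \<in> mpolys ?N" if "p \<in> mpolys n" for p :: "complex mpoly" using that by (rule mpolys_mono) simp
    have uv: "u \<in> mpolys ?N" "v \<in> mpolys ?N" by (auto simp: u_def v_def intro: mpolys_mvar)
    have F'N: "F' i \<in> mpolys ?N" if "i < ?N" for i
      using that less.prems(1) k unfolding F'_def R_def
      by (auto intro!: mpolys_add mpolys_minus mpolys_mult mpolys_mconst up[OF PQ(1)] up[OF PQ(2)] up[OF less.prems(1)] uv)
    have F'k: "F' i = F i" if "i < n" "i \<noteq> k" for i using that by (simp add: F'_def)
    have F'kk: "F' k = R" and F'n: "F' n = P + u" and F'Sn: "F' (Suc n) = Q + v" using k by (auto simp: F'_def)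
    have "excess (F' i) = excess (F i)" if "i < n" "i \<noteq> k" for i using F'k[OF that] by simp
    have R: "R = (F k - single m c) + single (a + single (Suc n) 1) (- c) + single (b + single n 1) (- c) + single (single n 1 + single (Suc n) 1) (- c)"
    proof -
      have "single (a + single (Suc n) 1) (- c) = - (mconst c * P * v)"
        "single (b + single n 1) (- c) = - (mconst c * u * Q)"
        "single (single n 1 + single (Suc n) 1) (- c) = - (mconst c * u * v)"
        by (simp_all add: P_def Q_def u_def v_def mvar_def mconst_def mult_single single_uminus add.commute)
      then show ?thesis unfolding R_def sPQ by (simp add: algebra_simps)
    qed
    define e where "e = (3::nat) ^ mdeg b"
    have e3: "3 ^ mdeg m = 9 * e" by (simp add: mb e_def)
    have "excess R \<le> excess (F k - single m c) + excess (single (a + single (Suc n) 1) (- c))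
       + excess (single (b + single n 1) (- c)) + excess (single (single n 1 + single (Suc n) 1) (- c))"
      unfolding R by (intro order_trans[OF excess_add] add_mono order_refl)
    also have "excess (single (a + single (Suc n) 1) (- c)) = 0"
      by (auto simp: excess_def mdeg_add ab)
    also have "excess (single (single n 1 + single (Suc n) 1) (- c)) = 0"
      by (auto simp: excess_def mdeg_add)
    also have "excess (single (b + single n 1) (- c)) \<le> 3 * e"
      using excess_single[of "b + single n 1" "- c"] by (auto simp: mdeg_add e_def split: if_splits)
    finally have eR: "excess R \<le> excess (F k - single m c) + 3 * e" by simp
    have eP: "excess (P + u) = 0"
      using excess_add[of P u] by (simp add: P_def u_def mvar_def excess_def ab(2) split: if_splits)
    have "excess (Q + v) \<le> excess Q + excess v" by (rule excess_add)
    also have "excess v = 0" by (simp add: v_def mvar_def excess_def)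
    also have "excess Q \<le> e" using excess_single[of b "1::complex"] by (simp add: Q_def e_def split: if_splits)
    finally have eQ: "excess (Q + v) \<le> e" by simp
    have "(\<Sum>i<?N. excess (F' i)) = (\<Sum>i<n. excess (F' i)) + excess (P + u) + excess (Q + v)"
      using k by (simp add: F'n F'Sn)
    also have "(\<Sum>i<n. excess (F' i)) = excess R + (\<Sum>i\<in>{..<n} - {k}. excess (F i))"
      using k by (simp add: sum.remove[of _ k] F'kk F'k)
    also have "\<dots> + excess (P + u) + excess (Q + v)
       \<le> excess (F k - single m c) + 4 * e + (\<Sum>i\<in>{..<n} - {k}. excess (F i))"
      using eR eP eQ by simp
    also have "\<dots> < excess (F k - single m c) + 3 ^ mdeg m + (\<Sum>i\<in>{..<n} - {k}. excess (F i))"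
      by (simp add: e3) (simp add: e_def)
    also have "\<dots> = (\<Sum>i<n. excess (F i))"
      using excess_remove[OF m] k by (simp add: c_def sum.remove[of _ k])
    finally have dec: "(\<Sum>i<?N. excess (F' i)) < (\<Sum>i<n. excess (F i))" .
    have et': "etale ?N F'"
      unfolding etale_ddir
    proof (intro ballI impI)
      fix X V assume X: "X \<in> coord_space ?N" and V: "V \<in> coord_space ?N" and z: "\<forall>i<?N. ddir ?N (F' i) X V = 0"
      have zP: "ddir ?N (P + u) X V = 0" and zQ: "ddir ?N (Q + v) X V = 0"
        using z[rule_format, of n] z[rule_format, of "Suc n"] by (simp_all add: F'n F'Sn)
      have zF: "ddir ?N (F i) X V = 0" if "i < n" for i
      proof (cases "i = k")
        case True
        have "ddir ?N R X V = 0" using z[rule_format, of k] k by (simp add: F'kk)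
        then show ?thesis unfolding R_def True ddir_minus ddir_mult zP zQ by simp
      next
        case False
        then show ?thesis using z[rule_format, of i] that by (simp add: F'k)
      qed
      define x w where "x = (\<lambda>i. if i < n then X i else 0)" and "w = (\<lambda>i. if i < n then V i else 0)"
      have cut: "ddir ?N p X V = ddir n p x w" if "p \<in> mpolys n" for p
      proof -
        have "ddir ?N p X V = ddir n p X V" by (rule ddir_mono[OF that]) simp
        also have "\<dots> = ddir n p x w" by (rule ddir_cong[OF that]) (auto simp: x_def w_def)
        finally show ?thesis .
      qed
      have "w = (\<lambda>_. 0)"
      proof (rule etale_ddir[THEN iffD1, OF less.prems(2), rule_format])
        show "x \<in> coord_space n" "w \<in> coord_space n" by (auto simp: x_def w_def coord_space_def)
        show "ddir n (F i) x w = 0" if "i < n" for i using zF[OF that] cut[OF less.prems(1)[OF that]] by simp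
      qed
      then have V0: "V i = 0" if "i < n" for i using that by (metis w_def)
      have "ddir ?N P X V = 0" "ddir ?N Q X V = 0"
        using cut PQ \<open>w = (\<lambda>_. 0)\<close> by (simp_all add: ddir_def)
      then have "V n = 0" "V (Suc n) = 0"
        using zP zQ by (simp_all add: ddir_add u_def v_def ddir_mvar)
      show "V = (\<lambda>_. 0)"
      proof
        fix i
        consider "i < n" | "i = n" | "i = Suc n" | "i \<ge> ?N" by linarith
        then show "V i = 0"
          by cases (use V0 \<open>V n = 0\<close> \<open>V (Suc n) = 0\<close> V in \<open>auto simp: coord_space_def\<close>)
      qed
    qed
    have inj: "inj_on (polymap ?N F') (coord_space ?N)" by (rule less.hyps[OF dec F'N et'])
    \<comment> \<open>the points at which the two new components vanish, so that component \<open>k\<close> is unchanged\<close>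
    define lift where "lift = (\<lambda>x i. if i < n then x i else if i = n then - meval x P else if i = Suc n then - meval x Q else 0)"
    have liftN: "lift x \<in> coord_space ?N" for x by (auto simp: lift_def coord_space_def)
    have ev: "meval (lift x) p = meval x p" if "p \<in> mpolys n" for x p
      by (rule meval_cong[OF that]) (auto simp: lift_def)
    have lu: "meval (lift x) (P + u) = 0" and lv: "meval (lift x) (Q + v) = 0" for x
      using ev[of P x] ev[of Q x] PQ by (simp_all add: meval_simps u_def v_def lift_def)
    have Fl: "polymap ?N F' (lift x) = polymap n F x" for x
    proof
      fix i
      consider "i = k" | "i < n" "i \<noteq> k" | "i = n" | "i = Suc n" | "i \<ge> ?N" by linarith
      then show "polymap ?N F' (lift x) i = polymap n F x i"
      proof cases
        case 1
        have "meval (lift x) R = meval x (F k)"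
          unfolding R_def meval_minus meval_mult lu using ev[OF less.prems(1)[OF k]] by simp
        then show ?thesis using 1 k by (simp add: polymap_def F'kk)
      next
        case 2
        then show ?thesis using ev less.prems(1) by (simp add: polymap_def F'k)
      qed (auto simp: polymap_def F'n F'Sn lu lv)
    qed
    show ?thesis
    proof (rule inj_onI)
      fix x y assume xy: "x \<in> coord_space n" "y \<in> coord_space n" "polymap n F x = polymap n F y"
      have "polymap ?N F' (lift x) = polymap ?N F' (lift y)" unfolding Fl by (rule xy(3))
      then have l: "lift x = lift y" by (rule inj_onD[OF inj]) (rule liftN)+
      show "x = y"
      proof (rule coord_space_eqI[OF xy(1,2)])
        fix i assume "i < n"
        moreover have "lift x i = lift y i" by (simp add: l)
        ultimately show "x i = y i" by (simp add: lift_def)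
      qed
    qed
  qed
qed

section \<open>Functions of polynomial growth are polynomials\<close>

text \<open>
  The bound makes the singularities removable; then Liouville's theorem applies.
\<close>

lemma polynomial_growth_polynomial:
  fixes h :: "complex \<Rightarrow> complex"
  assumes Z: "finite Z" and hol: "\<And>s. s \<notin> Z \<Longrightarrow> h field_differentiable (at s)"
    and gr: "\<And>s. s \<notin> Z \<Longrightarrow> norm (h s) \<le> K * (1 + norm s) ^ M"
  shows "\<exists>P :: complex poly. degree P \<le> M \<and> (\<forall>s. s \<notin> Z \<longrightarrow> h s = poly P s)"
proof -
  obtain s0 where "s0 \<notin> Z" using ex_new_if_finite[OF infinite_UNIV_char_0 Z] by blast
  from gr[OF this] have "0 \<le> K * (1 + norm s0) ^ M" using norm_ge_zero order_trans by blast
  moreover have "(1 + norm s0) ^ M > 0" by (simp add: add_pos_nonneg)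
  ultimately have K: "K \<ge> 0" by (simp add: zero_le_mult_iff not_le)
  have "\<exists>g. g holomorphic_on UNIV \<and> (\<forall>z\<in>UNIV - Z. g z = h z)"
  proof (rule removable_singularities[OF Z])
    have "open (- Z)" using Z by (simp add: finite_imp_closed open_Compl)
    then show "h holomorphic_on UNIV - Z"
      using hol by (auto simp: holomorphic_on_def intro: field_differentiable_at_within)
    fix z assume z: "z \<in> Z"
    show "h \<in> O[at z](\<lambda>_. 1)"
    proof (rule landau_o.bigI)
      have "eventually (\<lambda>w. w \<in> - (Z - {z})) (nhds z)"
        by (intro eventually_nhds_in_open open_Compl finite_imp_closed finite_Diff Z) simp
      moreover have "eventually (\<lambda>w. w \<in> ball z 1) (nhds z)"
        by (intro eventually_nhds_in_open) auto
      ultimately have "eventually (\<lambda>w. w \<notin> Z \<and> dist z w < 1) (at z)"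
        unfolding eventually_at_filter by eventually_elim auto
      then show "eventually (\<lambda>w. norm (h w) \<le> (K * (2 + norm z) ^ M + 1) * norm (1 :: complex)) (at z)"
      proof eventually_elim
        case (elim w)
        have "norm w \<le> norm z + dist z w" by (metis dist_commute dist_norm norm_triangle_sub)
        then have "(1 + norm w) ^ M \<le> (2 + norm z) ^ M" using elim by (intro power_mono) auto
        then have "K * (1 + norm w) ^ M \<le> K * (2 + norm z) ^ M" using K by (rule mult_left_mono)
        moreover have "norm (h w) \<le> K * (1 + norm w) ^ M" using elim gr by blast
        ultimately show ?case by simp
      qed
      show "K * (2 + norm z) ^ M + 1 > 0" using K by (intro add_nonneg_pos mult_nonneg_nonneg) auto
    qed
  qed auto
  then obtain g where g: "g holomorphic_on UNIV" "\<And>z. z \<notin> Z \<Longrightarrow> g z = h z" by auto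
  define A where "A = 1 + (\<Sum>z\<in>Z. norm z)"
  have gb: "norm (g z) \<le> (K * 2 ^ M) * norm z ^ M" if "A \<le> norm z" for z
  proof -
    have "z \<notin> Z"
    proof
      assume "z \<in> Z"
      then have "norm z \<le> (\<Sum>z\<in>Z. norm z)" using Z by (intro member_le_sum) auto
      with that show False by (simp add: A_def)
    qed
    then have "norm (g z) \<le> K * (1 + norm z) ^ M" using g(2) gr by simp
    also have "1 \<le> norm z" using that sum_nonneg[of Z norm] by (simp add: A_def)
    then have "(1 + norm z) ^ M \<le> (2 * norm z) ^ M" by (intro power_mono) auto
    then have "K * (1 + norm z) ^ M \<le> K * (2 * norm z) ^ M" using K by (rule mult_left_mono)
    finally show ?thesis by (simp add: power_mult_distrib mult.assoc)
  qed
  define P :: "complex poly" where "P = (\<Sum>k\<le>M. monom ((deriv ^^ k) g 0 / fact k) k)"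
  have "g s = poly P s" for s
    using Liouville_polynomial[OF g(1) gb] by (simp add: P_def poly_sum poly_monom)
  moreover have "degree P \<le> M"
    unfolding P_def by (intro degree_sum_le) (auto intro: order_trans[OF degree_monom_le])
  ultimately show ?thesis using g(2) by metis
qed

lemma lagrange_interpolation:
  fixes P :: "'a::field poly"
  assumes S: "finite S" "card S > degree P"
  shows "poly P x = (\<Sum>a\<in>S. poly P a * (\<Prod>b\<in>S - {a}. (x - b) / (a - b)))"
proof -
  define L where "L = (\<Sum>a\<in>S. smult (poly P a) (\<Prod>b\<in>S - {a}. smult (1 / (a - b)) [:- b, 1:]))"
  have ev: "poly L x = (\<Sum>a\<in>S. poly P a * (\<Prod>b\<in>S - {a}. (x - b) / (a - b)))" for x
    by (simp add: L_def poly_sum poly_prod diff_divide_distrib)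
  have "P = L"
  proof (rule poly_eqI_degree[of S])
    fix x assume x: "x \<in> S"
    have "poly L x = (\<Sum>a\<in>S. if a = x then poly P x else 0)"
      unfolding ev
    proof (intro sum.cong refl)
      fix a assume a: "a \<in> S"
      show "poly P a * (\<Prod>b\<in>S - {a}. (x - b) / (a - b)) = (if a = x then poly P x else 0)"
      proof (cases "a = x")
        case True
        have "(\<Prod>b\<in>S - {x}. (x - b) / (x - b)) = 1" by (rule prod.neutral) auto
        then show ?thesis using True by simp
      next
        case False
        then have "(\<Prod>b\<in>S - {a}. (x - b) / (a - b)) = 0"
          using x S(1) by (intro prod_zero) auto
        then show ?thesis using False by simp
      qed
    qed
    then show "poly P x = poly L x" using x S(1) by simp
  next
    have c: "card S > 0" using S(2) by simp
    have "degree (smult (poly P a) (\<Prod>b\<in>S - {a}. smult (1 / (a - b)) [:- b, 1:])) \<le> card S - 1" if "a \<in> S" for a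
    proof -
      have "degree (\<Prod>b\<in>S - {a}. smult (1 / (a - b)) [:- b, 1:]) \<le> (\<Sum>b\<in>S - {a}. degree (smult (1 / (a - b)) [:- b, 1:]))"
        using degree_prod_sum_le[of "S - {a}" "\<lambda>b. smult (1 / (a - b)) [:- b, 1:]"] S(1) by (simp add: o_def)
      also have "\<dots> \<le> (\<Sum>b\<in>S - {a}. 1)"
        by (intro sum_mono) (auto intro: order_trans[OF degree_smult_le])
      also have "\<dots> = card S - 1" using that S(1) by simp
      finally show ?thesis using order_trans[OF degree_smult_le] by blast
    qed
    then have "degree L \<le> card S - 1" unfolding L_def using S(1) by (intro degree_sum_le) auto
    then show "card S > degree L" using c by simp
  qed (use S in simp)
  then show ?thesis using ev by metis
qed

lemma meval_line_poly:
  assumes "p \<in> mpolys n"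
  shows "\<exists>q. \<forall>s. meval (\<lambda>i. x i + s * v i) p = poly q s"
  using assms
proof (induction p rule: mpolys_induct)
  case (const c)
  show ?case by (intro exI[of _ "[:c:]"]) simp
next
  case (var i)
  show ?case by (intro exI[of _ "[:x i, v i:]"]) simp
next
  case (add p q)
  then obtain f g where "\<forall>s. meval (\<lambda>i. x i + s * v i) p = poly f s" "\<forall>s. meval (\<lambda>i. x i + s * v i) q = poly g s"
    by blast
  then show ?case by (intro exI[of _ "f + g"]) (simp add: meval_simps)
next
  case (mult p q)
  then obtain f g where "\<forall>s. meval (\<lambda>i. x i + s * v i) p = poly f s" "\<forall>s. meval (\<lambda>i. x i + s * v i) q = poly g s"
    by blast
  then show ?case by (intro exI[of _ "f * g"]) (simp add: meval_simps)
qed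

lemma finite_zeros_on_line:
  fixes p :: "'a::{idom,ring_char_0} mpoly"
  assumes "p \<in> mpolys n" "meval (\<lambda>i. x i + s0 * v i) p \<noteq> 0"
  shows "finite {s. meval (\<lambda>i. x i + s * v i) p = 0}"
proof -
  obtain q where q: "\<And>s. meval (\<lambda>i. x i + s * v i) p = poly q s" using meval_line_poly[OF assms(1)] by blast
  have "q \<noteq> 0" using assms(2) q[of s0] by auto
  then show ?thesis unfolding q by (rule poly_roots_finite)
qed

lemma nonzero_point:
  fixes p :: "'a::real_normed_field mpoly"
  assumes "p \<in> mpolys n" "p \<noteq> 0" shows "\<exists>x\<in>coord_space n. meval x p \<noteq> 0"
  using mpoly_eq_0_if_vanishing[OF assms(1)] assms(2) by blast

definition fix_var :: "nat \<Rightarrow> 'a \<Rightarrow> 'a::comm_semiring_1 mpoly \<Rightarrow> 'a mpoly" where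
  "fix_var n s p = msubst mconst (\<lambda>i. if i = n then mconst s else mvar i) p"

lemma meval_fix_var: "meval x (fix_var n s p) = meval (x(n := s)) p"
proof -
  obtain k where "p \<in> mpolys k" using mpolys_exists by blast
  then show ?thesis
    by (induction p rule: mpolys_induct) (auto simp: fix_var_def msubst_mconst_simps meval_simps)
qed

lemma fix_var_mpolys: "p \<in> mpolys (Suc n) \<Longrightarrow> fix_var n s p \<in> mpolys n"
  by (induction p rule: mpolys_induct)
    (auto simp: fix_var_def msubst_mconst_simps intro!: mpolys_intros)

text \<open>
  On almost every line in the last coordinate direction \<open>f\<close> is a polynomial of degree at
  most \<open>M\<close>, hence determined by its values on \<open>M + 1\<close> hyperplanes
  \<open>x\<^sub>n = \<sigma>\<close>. They are chosen so that \<open>c\<close> does not vanish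
  identically on them, and the induction hypothesis applies there. This settles the points over which
  \<open>c\<close> vanishes on none of the hyperplanes; the others are limits of such points along
  lines.
\<close>

lemma polynomial_if_polynomial_growth:
  fixes c :: "complex mpoly" and f :: "(nat \<Rightarrow> complex) \<Rightarrow> complex"
  assumes c: "c \<in> mpolys n" "c \<noteq> 0"
    and hol: "\<And>y e s. y \<in> coord_space n \<Longrightarrow> e \<in> coord_space n \<Longrightarrow> meval (\<lambda>i. y i + s * e i) c \<noteq> 0 \<Longrightarrow>
        (\<lambda>s. f (\<lambda>i. y i + s * e i)) field_differentiable (at s)"
    and gr: "\<And>y. y \<in> coord_space n \<Longrightarrow> meval y c \<noteq> 0 \<Longrightarrow> norm (f y) \<le> C * nrm n y ^ M"
  shows "\<exists>p\<in>mpolys n. \<forall>y\<in>coord_space n. meval y c \<noteq> 0 \<longrightarrow> f y = meval y p"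
  using assms
proof (induction n arbitrary: c f C)
  case 0
  have "y = (\<lambda>_. 0)" if "y \<in> coord_space 0" for y :: "nat \<Rightarrow> complex" using that by (auto simp: coord_space_def)
  then show ?case by (intro bexI[of _ "mconst (f (\<lambda>_. 0))"]) auto
next
  case (Suc n)
  note c = Suc.prems(1,2) and hol = Suc.prems(3) and gr = Suc.prems(4)
  have C: "C \<ge> 0"
  proof -
    obtain y where y: "y \<in> coord_space (Suc n)" "meval y c \<noteq> 0" using nonzero_point[OF c] by blast
    have "0 \<le> C * nrm (Suc n) y ^ M" using gr[OF y] norm_ge_zero order_trans by blast
    moreover have "nrm (Suc n) y ^ M > 0" by simp
    ultimately show ?thesis by (meson linorder_not_le mult_neg_pos)
  qed
  have updS: "y(n := s) \<in> coord_space (Suc n)" if "y \<in> coord_space (Suc n)" for y and s :: complex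
    using that by (auto simp: coord_space_def)
  have up: "y \<in> coord_space (Suc n)" if "y \<in> coord_space n" for y :: "nat \<Rightarrow> complex"
    using that by (auto simp: coord_space_def)
  have line_upd: "(\<lambda>i. (y(n := 0)) i + s * unitv n i) = y(n := s)" for y and s :: complex
    by (auto simp: unitv_def)
  have finz: "finite {s. meval (y(n := s)) c = 0}" if "meval y c \<noteq> 0" for y
    using finite_zeros_on_line[OF c(1), of "y(n := 0)" "y n" "unitv n"] that unfolding line_upd by simp
  have nrm_upd: "nrm (Suc n) (y(n := s)) \<le> nrm n y * (1 + norm s)" for y and s :: complex
  proof -
    have "nrm (Suc n) (y(n := s)) = nrm n y + norm s" by (simp add: nrm_def)
    also have "\<dots> \<le> nrm n y + nrm n y * norm s" by (simp add: mult_le_cancel_right1)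
    finally show ?thesis by (simp add: algebra_simps)
  qed
  have gr_upd: "norm (f (y(n := s))) \<le> (C * nrm n y ^ M) * (1 + norm s) ^ M"
    if "y \<in> coord_space (Suc n)" "meval (y(n := s)) c \<noteq> 0" for y s
  proof -
    have "norm (f (y(n := s))) \<le> C * nrm (Suc n) (y(n := s)) ^ M" by (rule gr[OF updS[OF that(1)] that(2)])
    also have "\<dots> \<le> C * (nrm n y * (1 + norm s)) ^ M"
      by (intro mult_left_mono power_mono nrm_upd C) auto
    finally show ?thesis by (simp add: power_mult_distrib mult.assoc)
  qed
  obtain \<Sigma> where \<Sigma>: "finite \<Sigma>" "card \<Sigma> = Suc M" and c\<Sigma>: "\<And>\<sigma>. \<sigma> \<in> \<Sigma> \<Longrightarrow> fix_var n \<sigma> c \<noteq> 0"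
  proof -
    obtain y where y: "meval y c \<noteq> 0" using nonzero_point[OF c] by blast
    have "infinite (UNIV - {s. meval (y(n := s)) c = 0})"
      using finz[OF y] infinite_UNIV_char_0 by (intro Diff_infinite_finite) auto
    then obtain \<Sigma> where "finite \<Sigma>" "card \<Sigma> = Suc M" "\<Sigma> \<subseteq> UNIV - {s. meval (y(n := s)) c = 0}"
      by (metis infinite_arbitrarily_large)
    moreover from this have "fix_var n \<sigma> c \<noteq> 0" if "\<sigma> \<in> \<Sigma>" for \<sigma>
      using that meval_fix_var[of y n \<sigma> c] by auto
    ultimately show ?thesis using that by blast
  qed
  have "\<exists>p\<in>mpolys n. \<forall>y\<in>coord_space n. meval y (fix_var n \<sigma> c) \<noteq> 0 \<longrightarrow> f (y(n := \<sigma>)) = meval y p" if \<sigma>: "\<sigma> \<in> \<Sigma>" for \<sigma>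
  proof (rule Suc.IH[of _ _ "C * (1 + norm \<sigma>) ^ M"])
    show "fix_var n \<sigma> c \<in> mpolys n" "fix_var n \<sigma> c \<noteq> 0" using c(1) \<sigma> c\<Sigma> fix_var_mpolys by auto
    fix y :: "nat \<Rightarrow> complex" assume y: "y \<in> coord_space n"
    show "norm (f (y(n := \<sigma>))) \<le> C * (1 + norm \<sigma>) ^ M * nrm n y ^ M" if "meval y (fix_var n \<sigma> c) \<noteq> 0"
      using gr_upd[OF up[OF y], of \<sigma>] that by (simp add: meval_fix_var mult_ac)
    fix e :: "nat \<Rightarrow> complex" and s assume e: "e \<in> coord_space n" and nz: "meval (\<lambda>i. y i + s * e i) (fix_var n \<sigma> c) \<noteq> 0"
    have l: "(\<lambda>i. y i + s * e i)(n := \<sigma>) = (\<lambda>i. (y(n := \<sigma>)) i + s * e i)" for s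
      using e by (auto simp: coord_space_def)
    show "(\<lambda>s. f ((\<lambda>i. y i + s * e i)(n := \<sigma>))) field_differentiable (at s)"
      unfolding l using nz by (intro hol updS up y e) (simp add: meval_fix_var l)
  qed
  then obtain p where p: "\<And>\<sigma>. \<sigma> \<in> \<Sigma> \<Longrightarrow> p \<sigma> \<in> mpolys n"
    "\<And>\<sigma> y. \<sigma> \<in> \<Sigma> \<Longrightarrow> y \<in> coord_space n \<Longrightarrow> meval y (fix_var n \<sigma> c) \<noteq> 0 \<Longrightarrow> f (y(n := \<sigma>)) = meval y (p \<sigma>)"
    by metis
  define g where "g = (\<Sum>\<sigma>\<in>\<Sigma>. p \<sigma> * (\<Prod>\<tau>\<in>\<Sigma> - {\<sigma>}. (mvar n - mconst \<tau>) * mconst (1 / (\<sigma> - \<tau>))))"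
  have "p \<sigma> \<in> mpolys (Suc n)" if "\<sigma> \<in> \<Sigma>" for \<sigma> using p(1)[OF that] by (rule mpolys_mono) simp
  then have g: "g \<in> mpolys (Suc n)" unfolding g_def by (intro mpolys_intros) auto
  have generic: "f y = meval y g"
    if y: "y \<in> coord_space (Suc n)" "meval y c \<noteq> 0" "\<And>\<sigma>. \<sigma> \<in> \<Sigma> \<Longrightarrow> meval y (fix_var n \<sigma> c) \<noteq> 0" for y
  proof -
    let ?Z = "{s. meval (y(n := s)) c = 0}"
    have "\<exists>P. degree P \<le> M \<and> (\<forall>s. s \<notin> ?Z \<longrightarrow> f (y(n := s)) = poly P s)"
    proof (rule polynomial_growth_polynomial[OF finz[OF y(2)]])
      fix s assume s: "s \<notin> ?Z"
      then show "norm (f (y(n := s))) \<le> (C * nrm n y ^ M) * (1 + norm s) ^ M" by (intro gr_upd y) simp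
      have "(\<lambda>s. f (\<lambda>i. (y(n := 0)) i + s * unitv n i)) field_differentiable (at s)"
        by (rule hol[OF updS[OF y(1)] unitv_coord_space]) (use s in \<open>simp_all add: line_upd del: fun_upd_apply\<close>)
      then show "(\<lambda>s. f (y(n := s))) field_differentiable (at s)" unfolding line_upd .
    qed
    then obtain P where P: "degree P \<le> M" "\<And>s. meval (y(n := s)) c \<noteq> 0 \<Longrightarrow> f (y(n := s)) = poly P s" by auto
    have P\<sigma>: "poly P \<sigma> = meval y (p \<sigma>)" if "\<sigma> \<in> \<Sigma>" for \<sigma>
    proof -
      let ?y = "y(n := 0)"
      have yn: "?y \<in> coord_space n" using y(1) by (auto simp: coord_space_def)
      have nz: "meval (y(n := \<sigma>)) c \<noteq> 0" using y(3)[OF that] by (simp add: meval_fix_var)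
      have "poly P \<sigma> = f (?y(n := \<sigma>))" using P(2)[OF nz] by simp
      also have "\<dots> = meval ?y (p \<sigma>)" by (rule p(2)[OF that yn]) (use nz in \<open>simp add: meval_fix_var\<close>)
      also have "\<dots> = meval y (p \<sigma>)" by (rule meval_cong[OF p(1)[OF that]]) auto
      finally show ?thesis .
    qed
    have "f y = poly P (y n)" using P(2)[of "y n"] y(2) by simp
    also have "\<dots> = (\<Sum>\<sigma>\<in>\<Sigma>. poly P \<sigma> * (\<Prod>\<tau>\<in>\<Sigma> - {\<sigma>}. (y n - \<tau>) / (\<sigma> - \<tau>)))"
      by (rule lagrange_interpolation) (use \<Sigma> P in auto)
    also have "\<dots> = meval y g" by (simp add: g_def meval_simps P\<sigma> divide_inverse prod.distrib)
    finally show ?thesis .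
  qed
  define D where "D = c * (\<Prod>\<sigma>\<in>\<Sigma>. fix_var n \<sigma> c)"
  have "fix_var n \<sigma> c \<in> mpolys (Suc n)" for \<sigma> using fix_var_mpolys[OF c(1)] by (rule mpolys_mono) simp
  then have D: "D \<in> mpolys (Suc n)" unfolding D_def using c by (intro mpolys_intros) auto
  have "D \<noteq> 0" using c \<Sigma> c\<Sigma> by (simp add: D_def)
  then obtain y1 where y1: "y1 \<in> coord_space (Suc n)" "meval y1 D \<noteq> 0" using nonzero_point[OF D] by blast
  have "f y = meval y g" if y: "y \<in> coord_space (Suc n)" "meval y c \<noteq> 0" for y
  proof -
    define e where "e = (\<lambda>i. y1 i - y i)"
    have e: "e \<in> coord_space (Suc n)" using y(1) y1(1) by (simp add: e_def coord_space_def)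
    let ?l = "\<lambda>s i. y i + s * e i"
    have l: "?l s \<in> coord_space (Suc n)" for s by (rule coord_space_line[OF y(1) e])
    have "finite {s. meval (?l s) D = 0}"
      by (rule finite_zeros_on_line[OF D, of _ 1]) (use y1 in \<open>simp add: e_def\<close>)
    then have "eventually (\<lambda>s. s \<in> - ({s. meval (?l s) D = 0} - {0})) (nhds 0)"
      by (intro eventually_nhds_in_open open_Compl finite_imp_closed finite_Diff) simp_all
    then have ev: "eventually (\<lambda>s. f (?l s) = meval (?l s) g) (at 0)"
      unfolding eventually_at_filter
    proof eventually_elim
      case (elim s)
      show ?case
      proof (intro impI)
        assume "s \<noteq> 0"
        then have "meval (?l s) D \<noteq> 0" using elim by auto
        then show "f (?l s) = meval (?l s) g"
          using \<Sigma>(1) by (intro generic l) (auto simp: D_def meval_simps)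
      qed
    qed
    have "(\<lambda>s. f (?l s)) field_differentiable (at 0)" by (rule hol) (use y e in auto)
    then have "isCont (\<lambda>s. f (?l s)) 0" by (rule field_differentiable_imp_continuous_at)
    then have 1: "((\<lambda>s. f (?l s)) \<longlongrightarrow> f y) (at 0)" by (simp add: isCont_def)
    have "isCont (\<lambda>s. meval (?l s) g) 0" using DERIV_meval_line[OF g, of y e 0] by (rule DERIV_isCont)
    then have 2: "((\<lambda>s. meval (?l s) g) \<longlongrightarrow> meval y g) (at 0)" by (simp add: isCont_def)
    show ?thesis
      using tendsto_unique[OF _ 1, of "meval y g"] tendsto_cong[OF ev] 2 by simp
  qed
  then show ?case using g by blast
qed

section \<open>The inverse of an injective etale map\<close>

lemma inj_polymap_open:
  fixes F :: "nat \<Rightarrow> complex mpoly"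
  assumes inj: "inj_on (polymap n F) (coord_space n)" and S: "openin (top_of_set (coord_space n)) S"
  shows "openin (top_of_set (coord_space n)) (polymap n F ` S)"
proof -
  let ?g = "\<lambda>x. to_real (polymap n F (to_complex x))"
  obtain T where T: "open T" "S = coord_space n \<inter> T" using S by (auto simp: openin_open)
  define U where "U = coord_space (2 * n) \<inter> to_complex -` T"
  have "open (to_complex -` T)"
    using T(1) continuous_on_to_complex[OF continuous_on_id, of UNIV] by (simp add: continuous_on_open_vimage)
  then have U: "openin (Euclidean_space (2 * n)) U"
    by (auto simp: U_def Euclidean_space_eq_top_of_set openin_open)
  have US: "to_complex ` U = S"
  proof
    show "S \<subseteq> to_complex ` U"
    proof
      fix z assume "z \<in> S"
      then have "to_real z \<in> U" by (auto simp: U_def T(2))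
      then show "z \<in> to_complex ` U" by (metis imageI to_complex_to_real)
    qed
  qed (auto simp: U_def T(2))
  have cont: "continuous_on UNIV ?g"
    by (intro continuous_on_to_real continuous_on_polymap continuous_on_to_complex continuous_on_id)
  have "openin (Euclidean_space (2 * n)) (?g ` U)"
  proof (rule invariance_of_domain_Euclidean_space[OF U])
    show "continuous_map (subtopology (Euclidean_space (2 * n)) U) (Euclidean_space (2 * n)) ?g"
      unfolding cm_Euclidean_space_iff_continuous_on
      using continuous_on_subset[OF cont] by (auto simp: topspace_Euclidean_space_coord_space)
    show "inj_on ?g U"
    proof (rule inj_onI)
      fix x y assume xy: "x \<in> U" "y \<in> U" "?g x = ?g y"
      have "polymap n F (to_complex x) = polymap n F (to_complex y)"
        using arg_cong[OF xy(3), of to_complex] by simp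
      then have "to_complex x = to_complex y"
        by (rule inj_onD[OF inj]) (use xy(1,2) in \<open>simp_all add: U_def\<close>)
      then show "x = y" by (metis to_real_to_complex)
    qed
  qed
  then obtain T' where T': "open T'" "?g ` U = coord_space (2 * n) \<inter> T'"
    by (auto simp: Euclidean_space_eq_top_of_set openin_open)
  have "open (to_real -` T')"
    using T'(1) continuous_on_to_real[OF continuous_on_id, of UNIV] by (simp add: continuous_on_open_vimage)
  moreover have "polymap n F ` S = coord_space n \<inter> to_real -` T'"
  proof (intro equalityI subsetI)
    fix z assume "z \<in> polymap n F ` S"
    then obtain x where x: "x \<in> U" "z = polymap n F (to_complex x)" using US by auto
    then have "to_real z \<in> ?g ` U" by auto
    then show "z \<in> coord_space n \<inter> to_real -` T'" using x(2) T'(2) by auto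
  next
    fix z assume z: "z \<in> coord_space n \<inter> to_real -` T'"
    then have "to_real z \<in> ?g ` U" using T'(2) by auto
    then obtain x where x: "x \<in> U" "to_real z = ?g x" by blast
    then have "z = polymap n F (to_complex x)" by (metis to_complex_to_real)
    then show "z \<in> polymap n F ` S" using US x(1) by blast
  qed
  ultimately show ?thesis by (auto simp: openin_open)
qed

lemma image_locally_closed:
  fixes F :: "nat \<Rightarrow> complex mpoly"
  assumes C: "C \<ge> 0"
    "\<And>x i. x \<in> coord_space n \<Longrightarrow> i < n \<Longrightarrow> norm (meval (polymap n F x) a * x i) \<le> C * nrm n (polymap n F x) ^ M"
    and y: "y \<in> closure (polymap n F ` coord_space n)" "meval y a \<noteq> 0"
  shows "y \<in> polymap n F ` coord_space n"
proof -
  let ?I = "polymap n F ` coord_space n"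
  define \<delta> where "\<delta> = norm (meval y a) / 2"
  define R where "R = nrm n y + 1"
  have \<delta>: "\<delta> > 0" using y(2) by (simp add: \<delta>_def)
  define V where "V = {x. \<delta> < norm (meval x a)} \<inter> {x. nrm n x < R}"
  define D where "D = {x \<in> coord_space n. \<delta> \<le> norm (meval (polymap n F x) a) \<and> nrm n (polymap n F x) \<le> R}"
  have V: "open V" unfolding V_def
    by (intro open_Int open_Collect_less continuous_on_const continuous_on_norm continuous_on_meval
        continuous_on_nrm continuous_on_id)
  have "compact D" unfolding D_def by (rule compact_polymap_preimage[OF C \<delta>])
  then have "compact (polymap n F ` D)"
    by (intro compact_continuous_image continuous_on_polymap continuous_on_id)
  then have cl: "closed (polymap n F ` D)" by (rule compact_imp_closed)
  have "y \<in> V" using y(2) by (simp add: V_def \<delta>_def R_def)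
  then have "y \<in> closure (V \<inter> ?I)" using y(1) open_Int_closure_subset[OF V, of ?I] by blast
  moreover have "V \<inter> ?I \<subseteq> polymap n F ` D" by (auto simp: V_def D_def)
  ultimately have "y \<in> polymap n F ` D" using closure_minimal[OF _ cl] by blast
  then show ?thesis by (auto simp: D_def)
qed

text \<open>
  On a complex line through a known point of the image, the part where \<open>a \<noteq> 0\<close> is a
  plane without finitely many points, hence connected; the image is open and closed in it.
\<close>

lemma image_contains_nonvanishing:
  fixes F :: "nat \<Rightarrow> complex mpoly"
  assumes F: "\<And>i. i < n \<Longrightarrow> F i \<in> mpolys n" and et: "etale n F"
    and inj: "inj_on (polymap n F) (coord_space n)"
    and a: "a \<in> mpolys n" "a \<noteq> 0" and C: "C \<ge> 0"
    "\<And>x i. x \<in> coord_space n \<Longrightarrow> i < n \<Longrightarrow> norm (meval (polymap n F x) a * x i) \<le> C * nrm n (polymap n F x) ^ M"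
    and y: "y \<in> coord_space n" "meval y a \<noteq> 0"
  shows "y \<in> polymap n F ` coord_space n"
proof -
  let ?I = "polymap n F ` coord_space n"
  obtain x0 where x0: "x0 \<in> coord_space n" "meval (polymap n F x0) a \<noteq> 0"
    using etale_algebraic_independence[OF F et a(1)] a(2) by blast
  define y0 where "y0 = polymap n F x0"
  define e where "e = (\<lambda>i. y i - y0 i)"
  let ?l = "\<lambda>s i. y0 i + s * e i"
  have y0: "y0 \<in> coord_space n" by (simp add: y0_def)
  have e: "e \<in> coord_space n" using y(1) y0 by (simp add: e_def coord_space_def)
  have l: "?l s \<in> coord_space n" for s by (rule coord_space_line[OF y0 e])
  have l1: "?l 1 = y" by (simp add: e_def)
  have cl: "continuous_on UNIV (\<lambda>s. ?l s)"
    by (intro continuous_on_coordinatewise_then_product continuous_intros)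
  define T where "T = UNIV - {s. meval (?l s) a = 0}"
  have "finite {s. meval (?l s) a = 0}"
    by (rule finite_zeros_on_line[OF a(1), of _ 1]) (use y in \<open>simp add: e_def\<close>)
  then have T: "connected T" unfolding T_def by (intro connected_open_delete_finite) auto
  define T' where "T' = T \<inter> (\<lambda>s. ?l s) -` ?I"
  obtain O' where O': "open O'" "?I = coord_space n \<inter> O'"
    using inj_polymap_open[OF inj, of "coord_space n"] by (auto simp: openin_open)
  have "T' = T \<inter> (\<lambda>s. ?l s) -` O'" unfolding T'_def O'(2) using l by auto
  then have op: "openin (top_of_set T) T'"
    using continuous_openin_preimage_gen[OF continuous_on_subset[OF cl subset_UNIV[of T]] O'(1)] by simp
  have "closedin (top_of_set T) T'"
    unfolding closedin_closed
  proof (intro exI conjI)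
    show "closed (closure T')" by simp
    show "T' = T \<inter> closure T'"
    proof
      show "T \<inter> closure T' \<subseteq> T'"
      proof
        fix s assume s: "s \<in> T \<inter> closure T'"
        have "(\<lambda>s. ?l s) ` closure T' \<subseteq> closure ?I"
          by (rule image_closure_subset[OF continuous_on_subset[OF cl]])
            (auto simp: T'_def intro!: subsetD[OF closure_subset])
        then have "?l s \<in> closure ?I" using s by blast
        moreover have "meval (?l s) a \<noteq> 0" using s by (auto simp: T_def)
        ultimately have "?l s \<in> ?I" by (intro image_locally_closed[OF C])
        then show "s \<in> T'" using s by (simp add: T'_def)
      qed
      have "T' \<subseteq> T" by (auto simp: T'_def)
      then show "T' \<subseteq> T \<inter> closure T'" using closure_subset[of T'] by blast
    qed
  qed
  then have "T' = {} \<or> T' = T" using T op connected_clopen by blast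
  moreover have "0 \<in> T'" using x0 by (auto simp: T'_def T_def y0_def)
  moreover have "1 \<in> T" using y(2) unfolding T_def l1[symmetric] by simp
  ultimately have "1 \<in> T'" by blast
  then show ?thesis using l1 by (simp add: T'_def)
qed

text \<open>
  The inverse function theorem along a line. By Hadamard's lemma the difference quotient
  \<open>w\<close> of \<open>\<gamma>\<close> satisfies \<open>M w = e\<close> with a matrix
  \<open>M\<close> that converges to \<open>M0 = DF(\<gamma> s0)\<close>. If \<open>B\<close> is the
  inverse of \<open>M0\<close> and \<open>v = B e\<close>, then \<open>w - v = B (M0 - M) w\<close>,
  which bounds \<open>w\<close> and then makes \<open>w - v\<close> small.
\<close>

lemma field_differentiable_lift:
  fixes F :: "nat \<Rightarrow> 'a::real_normed_field mpoly"
  assumes F: "\<And>i. i < n \<Longrightarrow> F i \<in> mpolys n" and et: "etale n F"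
    and cont: "(\<gamma> \<longlongrightarrow> \<gamma> s0) (at s0)" and g0: "\<gamma> s0 \<in> coord_space n" "polymap n F (\<gamma> s0) = (\<lambda>i. y i + s0 * e i)"
    and ev: "eventually (\<lambda>s. polymap n F (\<gamma> s) = (\<lambda>i. y i + s * e i)) (at s0)" and i: "i < n"
  shows "(\<lambda>s. \<gamma> s i) field_differentiable (at s0)"
proof -
  let ?x = "\<gamma> s0"
  define quot where "quot k q \<longleftrightarrow> (\<forall>j. continuous_on UNIV (\<lambda>z. q (fst z) (snd z) j)) \<and>
     (\<forall>x y. meval x (F k) - meval y (F k) = (\<Sum>j<n. q x y j * (x j - y j))) \<and>
     (\<forall>y. \<forall>j<n. q y y j = meval y (mpderiv j (F k)))" for k and q :: "(nat \<Rightarrow> 'a) \<Rightarrow> (nat \<Rightarrow> 'a) \<Rightarrow> nat \<Rightarrow> 'a"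
  have "\<forall>k. \<exists>q. k < n \<longrightarrow> quot k q" unfolding quot_def using meval_difference[OF F] by blast
  then obtain q where "\<forall>k. k < n \<longrightarrow> quot k (q k)" by (rule choice[THEN exE])
  then have q: "\<And>k j. k < n \<Longrightarrow> continuous_on UNIV (\<lambda>z. q k (fst z) (snd z) j)"
    "\<And>k x y. k < n \<Longrightarrow> meval x (F k) - meval y (F k) = (\<Sum>j<n. q k x y j * (x j - y j))"
    "\<And>k y j. k < n \<Longrightarrow> j < n \<Longrightarrow> q k y y j = meval y (mpderiv j (F k))"
    unfolding quot_def by blast+
  define M where "M = (\<lambda>s k j. q k (\<gamma> s) ?x j)"
  define M0 where "M0 = (\<lambda>k j. meval ?x (mpderiv j (F k)))"
  have M: "((\<lambda>s. M s k j) \<longlongrightarrow> M0 k j) (at s0)" if "k < n" "j < n" for k j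
  proof -
    have "((\<lambda>s. (\<gamma> s, ?x)) \<longlongrightarrow> (?x, ?x)) (at s0)" by (intro tendsto_Pair cont tendsto_const)
    moreover have "isCont (\<lambda>z. q k (fst z) (snd z) j) (?x, ?x)"
      using q(1)[OF that(1)] by (simp add: continuous_on_eq_continuous_at)
    ultimately have "((\<lambda>s. q k (fst (\<gamma> s, ?x)) (snd (\<gamma> s, ?x)) j) \<longlongrightarrow> q k (fst (?x, ?x)) (snd (?x, ?x)) j) (at s0)"
      by (rule isCont_tendsto_compose[rotated])
    then show ?thesis using q(3)[OF that] by (simp add: M_def M0_def)
  qed
  obtain B where B: "\<And>i j. i < n \<Longrightarrow> j < n \<Longrightarrow> (\<Sum>k<n. B i k * M0 k j) = (if j = i then 1 else 0)"
    using inverse_linear_system[of n M0] etaleD[OF et g0(1)] unfolding M0_def by blast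
  define w where "w = (\<lambda>s j. (\<gamma> s j - ?x j) / (s - s0))"
  define v where "v = (\<lambda>i. \<Sum>k<n. B i k * e k)"
  define N where "N = (\<lambda>s. \<Sum>j<n. norm (w s j))"
  define \<eta> where "\<eta> = (\<lambda>s. \<Sum>i<n. \<Sum>k<n. \<Sum>j<n. norm (B i k) * norm (M0 k j - M s k j))"
  have "(\<eta> \<longlongrightarrow> (\<Sum>i<n. \<Sum>k<n. \<Sum>j<n. norm (B i k) * norm (M0 k j - M0 k j))) (at s0)"
    unfolding \<eta>_def by (intro tendsto_sum tendsto_mult tendsto_norm tendsto_diff tendsto_const M) auto
  then have \<eta>0: "(\<eta> \<longlongrightarrow> 0) (at s0)" by simp
  define V where "V = (\<Sum>i<n. norm (v i))"
  have bound: "\<forall>i<n. norm (w s i - v i) \<le> 2 * V * \<eta> s"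
    if s: "s \<noteq> s0" "polymap n F (\<gamma> s) = (\<lambda>i. y i + s * e i)" "\<eta> s < 1 / 2" for s
  proof -
    have Mw: "(\<Sum>j<n. M s k j * w s j) = e k" if k: "k < n" for k
    proof -
      have "meval (\<gamma> s) (F k) - meval ?x (F k) = (s - s0) * e k"
        using fun_cong[OF s(2), of k] fun_cong[OF g0(2), of k] k by (simp add: polymap_def algebra_simps)
      then have "(\<Sum>j<n. M s k j * (\<gamma> s j - ?x j)) = (s - s0) * e k"
        unfolding q(2)[OF k] M_def .
      then have "(\<Sum>j<n. M s k j * (\<gamma> s j - ?x j)) / (s - s0) = e k" using s(1) by simp
      then show ?thesis by (simp add: w_def sum_divide_distrib)
    qed
    have diff: "w s i - v i = (\<Sum>k<n. \<Sum>j<n. B i k * (M0 k j - M s k j) * w s j)" if i: "i < n" for i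
    proof -
      have "w s i = (\<Sum>j<n. if j = i then w s j else 0)" using i by simp
      also have "\<dots> = (\<Sum>j<n. (if j = i then 1 else 0) * w s j)" by (rule sum.cong) auto
      also have "\<dots> = (\<Sum>j<n. (\<Sum>k<n. B i k * M0 k j) * w s j)" using B[OF i] by simp
      also have "\<dots> = (\<Sum>j<n. \<Sum>k<n. B i k * M0 k j * w s j)" by (simp add: sum_distrib_right)
      also have "\<dots> = (\<Sum>k<n. \<Sum>j<n. B i k * M0 k j * w s j)" by (rule sum.swap)
      finally have 1: "w s i = \<dots>" .
      have "v i = (\<Sum>k<n. B i k * (\<Sum>j<n. M s k j * w s j))" unfolding v_def using Mw by simp
      also have "\<dots> = (\<Sum>k<n. \<Sum>j<n. B i k * M s k j * w s j)" by (simp add: sum_distrib_left mult.assoc)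
      finally show ?thesis unfolding 1 by (simp add: sum_subtractf[symmetric] algebra_simps)
    qed
    define h where "h = (\<lambda>i. \<Sum>k<n. \<Sum>j<n. norm (B i k) * norm (M0 k j - M s k j))"
    have h: "norm (w s i - v i) \<le> h i * N s" if "i < n" for i
    proof -
      have "norm (w s i - v i) \<le> (\<Sum>k<n. \<Sum>j<n. norm (B i k) * norm (M0 k j - M s k j) * N s)"
        unfolding diff[OF that]
      proof (intro sum_norm_le)
        fix k j assume "k \<in> {..<n}" "j \<in> {..<n}"
        then have "norm (w s j) \<le> N s" unfolding N_def by (intro member_le_sum) auto
        then show "norm (B i k * (M0 k j - M s k j) * w s j) \<le> norm (B i k) * norm (M0 k j - M s k j) * N s"
          unfolding norm_mult by (intro mult_left_mono) auto
      qed
      then show ?thesis by (simp add: h_def sum_distrib_right)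
    qed
    have \<eta>h: "\<eta> s = (\<Sum>i<n. h i)" by (simp add: \<eta>_def h_def)
    have h0: "h i \<ge> 0" for i by (auto simp: h_def intro!: sum_nonneg)
    have N0: "N s \<ge> 0" by (auto simp: N_def intro!: sum_nonneg)
    have "N s \<le> (\<Sum>i<n. norm (v i) + h i * N s)"
      unfolding N_def[of ] 
    proof (rule sum_mono)
      fix i assume "i \<in> {..<n}"
      then have "norm (w s i - v i) \<le> h i * N s" using h by simp
      moreover have "norm (w s i) \<le> norm (v i) + norm (w s i - v i)" by (rule norm_triangle_sub)
      ultimately show "norm (w s i) \<le> norm (v i) + h i * (\<Sum>j<n. norm (w s j))" by (simp add: N_def)
    qed
    also have "\<dots> = V + \<eta> s * N s" by (simp add: V_def \<eta>h sum.distrib sum_distrib_right)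
    also have "\<eta> s * N s \<le> (1 / 2) * N s" using s(3) N0 by (intro mult_right_mono) auto
    finally have N: "N s \<le> 2 * V" by simp
    show ?thesis
    proof (intro allI impI)
      fix i assume i: "i < n"
      have "h i \<le> \<eta> s" unfolding \<eta>h by (rule member_le_sum) (use i h0 in auto)
      then have "h i * N s \<le> \<eta> s * (2 * V)" using N N0 h0[of i] by (intro mult_mono) (auto intro: order_trans)
      then show "norm (w s i - v i) \<le> 2 * V * \<eta> s" using h[OF i] by (simp add: mult_ac)
    qed
  qed
  have "eventually (\<lambda>s. \<eta> s < 1 / 2) (at s0)" using \<eta>0 by (rule order_tendstoD) simp
  moreover have "eventually (\<lambda>s. s \<noteq> s0) (at s0)" by (simp add: eventually_at_filter)
  ultimately have "eventually (\<lambda>s. norm (w s i - v i) \<le> 2 * V * \<eta> s) (at s0)"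
    using ev by eventually_elim (use bound i in blast)
  moreover have "((\<lambda>s. 2 * V * \<eta> s) \<longlongrightarrow> 0) (at s0)" using tendsto_mult_right_zero[OF \<eta>0] .
  ultimately have "((\<lambda>s. w s i - v i) \<longlongrightarrow> 0) (at s0)" by (rule Lim_null_comparison)
  then have "((\<lambda>s. w s i) \<longlongrightarrow> v i) (at s0)" by (simp add: LIM_zero_iff)
  then have "((\<lambda>s. \<gamma> s i) has_field_derivative v i) (at s0)"
    unfolding w_def has_field_derivative_iff .
  then show ?thesis by (auto simp: field_differentiable_def)
qed

lemma inverse_holomorphic_on_lines:
  fixes F :: "nat \<Rightarrow> complex mpoly"
  assumes F: "\<And>i. i < n \<Longrightarrow> F i \<in> mpolys n" and et: "etale n F"
    and inj: "inj_on (polymap n F) (coord_space n)"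
    and a: "a \<in> mpolys n"
    and im: "\<And>y. y \<in> coord_space n \<Longrightarrow> meval y a \<noteq> 0 \<Longrightarrow> y \<in> polymap n F ` coord_space n"
    and y: "y \<in> coord_space n" "e \<in> coord_space n" "meval (\<lambda>i. y i + s0 * e i) a \<noteq> 0" and i: "i < n"
  shows "(\<lambda>s. inv_into (coord_space n) (polymap n F) (\<lambda>i. y i + s * e i) i) field_differentiable (at s0)"
proof -
  let ?l = "\<lambda>s i. y i + s * e i"
  let ?G = "inv_into (coord_space n) (polymap n F)"
  have l: "?l s \<in> coord_space n" for s by (rule coord_space_line[OF y(1,2)])
  have cl: "continuous_on UNIV (\<lambda>s. ?l s)"
    by (intro continuous_on_coordinatewise_then_product continuous_intros)
  have im0: "?l s0 \<in> polymap n F ` coord_space n" by (rule im[OF l y(3)])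
  have "open {s. meval (?l s) a \<noteq> 0}"
    by (intro open_Collect_neq continuous_on_meval cl continuous_on_const)
  then have "eventually (\<lambda>s. s \<in> {s. meval (?l s) a \<noteq> 0}) (nhds s0)"
    by (rule eventually_nhds_in_open) (use y in simp)
  then have evi: "eventually (\<lambda>s. ?l s \<in> polymap n F ` coord_space n) (nhds s0)"
    by eventually_elim (use im l in blast)
  show ?thesis
  proof (rule field_differentiable_lift[OF F et _ _ _ _ i])
    show "?G (?l s0) \<in> coord_space n" by (rule inv_into_into[OF im0])
    show "polymap n F (?G (?l s0)) = ?l s0" by (rule f_inv_into_f[OF im0])
    have "eventually (\<lambda>s. polymap n F (?G (?l s)) = ?l s) (nhds s0)"
      using evi by eventually_elim (simp add: f_inv_into_f)
    then show "eventually (\<lambda>s. polymap n F (?G (?l s)) = ?l s) (at s0)"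
      by (simp add: eventually_at_filter eventually_mono)
    show "((\<lambda>s. ?G (?l s)) \<longlongrightarrow> ?G (?l s0)) (at s0)"
    proof (rule topological_tendstoI)
      fix S assume S: "open S" "?G (?l s0) \<in> S"
      have "openin (top_of_set (coord_space n)) (coord_space n \<inter> S)"
        using S(1) by (auto simp: openin_open)
      from inj_polymap_open[OF inj this] obtain O' where O': "open O'"
        "polymap n F ` (coord_space n \<inter> S) = coord_space n \<inter> O'" by (auto simp: openin_open)
      have "?l s0 = polymap n F (?G (?l s0))" by (rule f_inv_into_f[OF im0, symmetric])
      moreover have "?G (?l s0) \<in> coord_space n" by (rule inv_into_into[OF im0])
      ultimately have "?l s0 \<in> polymap n F ` (coord_space n \<inter> S)" using S(2) by blast
      then have "?l s0 \<in> O'" unfolding O'(2) by blast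
      then have "eventually (\<lambda>s. s \<in> (\<lambda>s. ?l s) -` O') (nhds s0)"
        using cl O'(1) by (intro eventually_nhds_in_open) (simp_all add: continuous_on_open_vimage)
      then have "eventually (\<lambda>s. ?G (?l s) \<in> S) (nhds s0)"
      proof eventually_elim
        case (elim s)
        then have "?l s \<in> polymap n F ` (coord_space n \<inter> S)" unfolding O'(2) using l by blast
        then obtain x where x: "x \<in> coord_space n" "x \<in> S" "?l s = polymap n F x" by blast
        have "?G (?l s) = x" unfolding x(3) by (rule inv_into_f_f[OF inj x(1)])
        then show ?case using x(2) by simp
      qed
      then show "eventually (\<lambda>s. ?G (?l s) \<in> S) (at s0)" by (simp add: eventually_at_filter eventually_mono)
    qed
  qed
qed

definition mcomp :: "(nat \<Rightarrow> 'a mpoly) \<Rightarrow> 'a::comm_semiring_1 mpoly \<Rightarrow> 'a mpoly" where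
  "mcomp F p = msubst mconst F p"

lemma mcomp_mpolys: "p \<in> mpolys n \<Longrightarrow> (\<And>i. i < n \<Longrightarrow> F i \<in> mpolys k) \<Longrightarrow> mcomp F p \<in> mpolys k"
  by (induction p rule: mpolys_induct) (auto simp: mcomp_def msubst_mconst_simps intro!: mpolys_intros)

lemma meval_mcomp:
  assumes "p \<in> mpolys n" shows "meval x (mcomp F p) = meval (polymap n F x) p"
  using assms
  by (induction p rule: mpolys_induct) (auto simp: mcomp_def msubst_mconst_simps meval_simps polymap_def)

lemma mcomp_eq_0:
  fixes F :: "nat \<Rightarrow> 'a::real_normed_field mpoly"
  assumes F: "\<And>i. i < n \<Longrightarrow> F i \<in> mpolys n" and et: "etale n F" and p: "p \<in> mpolys n" "mcomp F p = 0"
  shows "p = 0"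
proof (rule etale_algebraic_independence[OF F et p(1)])
  show "meval (polymap n F x) p = 0" for x using meval_mcomp[OF p(1), of x F] p(2) by simp
qed

text \<open>
  The inverse \<open>G\<close> is only defined on the image. The product \<open>aG\<^sub>i\<close> is a
  polynomial \<open>A i\<close> by its growth; the last conjunct expresses this on the source, where no
  exception has to be made.
\<close>

lemma rational_inverse:
  fixes F :: "nat \<Rightarrow> complex mpoly"
  assumes F: "\<And>i. i < n \<Longrightarrow> F i \<in> mpolys n" and et: "etale n F"
    and inj: "inj_on (polymap n F) (coord_space n)"
  shows "\<exists>a A. a \<in> mpolys n \<and> a \<noteq> 0 \<and> (\<forall>i<n. A i \<in> mpolys n) \<and>
    (\<forall>y\<in>coord_space n. meval y a \<noteq> 0 \<longrightarrow> y \<in> polymap n F ` coord_space n) \<and>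
    (\<forall>x\<in>coord_space n. \<forall>i<n. meval (polymap n F x) (A i) = meval (polymap n F x) a * x i)"
proof -
  obtain a C M where a: "a \<in> mpolys n" "a \<noteq> 0" and C: "C \<ge> 0"
    "\<And>x i. x \<in> coord_space n \<Longrightarrow> i < n \<Longrightarrow> norm (meval (polymap n F x) a * x i) \<le> C * nrm n (polymap n F x) ^ M"
    using etale_growth[OF F et] by blast
  have im: "y \<in> polymap n F ` coord_space n" if "y \<in> coord_space n" "meval y a \<noteq> 0" for y
    by (rule image_contains_nonvanishing[OF F et inj a C that])
  let ?G = "inv_into (coord_space n) (polymap n F)"
  have "\<exists>p\<in>mpolys n. \<forall>y\<in>coord_space n. meval y a \<noteq> 0 \<longrightarrow> meval y a * ?G y i = meval y p" if i: "i < n" for i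
  proof (rule polynomial_if_polynomial_growth[OF a])
    fix y e :: "nat \<Rightarrow> complex" and s
    assume ye: "y \<in> coord_space n" "e \<in> coord_space n" "meval (\<lambda>i. y i + s * e i) a \<noteq> 0"
    show "(\<lambda>s. meval (\<lambda>i. y i + s * e i) a * ?G (\<lambda>i. y i + s * e i) i) field_differentiable at s"
      using DERIV_meval_line[OF a(1), of y e s] inverse_holomorphic_on_lines[OF F et inj a(1) im ye i]
      by (intro field_differentiable_mult) (auto simp: field_differentiable_def)
  next
    fix y assume y: "y \<in> coord_space n" "meval y a \<noteq> 0"
    have "?G y \<in> coord_space n" "polymap n F (?G y) = y"
      using inv_into_into[OF im[OF y]] f_inv_into_f[OF im[OF y]] by auto
    then show "norm (meval y a * ?G y i) \<le> C * nrm n y ^ M" using C(2)[of "?G y" i] i by simp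
  qed
  then obtain A where A: "\<And>i. i < n \<Longrightarrow> A i \<in> mpolys n"
    "\<And>i y. i < n \<Longrightarrow> y \<in> coord_space n \<Longrightarrow> meval y a \<noteq> 0 \<Longrightarrow> meval y a * ?G y i = meval y (A i)" by metis
  have "meval (polymap n F x) (A i) = meval (polymap n F x) a * x i" if x: "x \<in> coord_space n" and i: "i < n" for x i
  proof -
    have d: "mcomp F a \<in> mpolys n" "mcomp F (A i) \<in> mpolys n"
      using mcomp_mpolys[OF a(1), of F n] mcomp_mpolys[OF A(1)[OF i], of F n] F by auto
    have "mcomp F (A i) = mcomp F a * mvar i"
    proof (rule mpoly_eq_if_eq_off_zeros[OF d(1)])
      show "mcomp F a \<noteq> 0" using mcomp_eq_0[OF F et a(1)] a(2) by blast
      fix x :: "nat \<Rightarrow> complex" assume x: "x \<in> coord_space n" and nz: "meval x (mcomp F a) \<noteq> 0"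
      have "inv_into (coord_space n) (polymap n F) (polymap n F x) = x" by (rule inv_into_f_f[OF inj x])
      then show "meval x (mcomp F (A i)) = meval x (mcomp F a * mvar i)"
        using A(2)[OF i polymap_coord_space, of F x] nz
        by (simp add: meval_mult meval_mcomp[OF a(1)] meval_mcomp[OF A(1)[OF i]])
    qed (use d i in \<open>auto intro: mpolys_intros\<close>)
    then have "meval x (mcomp F (A i)) = meval x (mcomp F a * mvar i)" by simp
    then show ?thesis by (simp add: meval_simps meval_mcomp[OF a(1)] meval_mcomp[OF A(1)[OF i]])
  qed
  then show ?thesis using a A(1) im by blast
qed

section \<open>Univariate polynomials with polynomial coefficients\<close>

lemma coeff_mult_le:
  assumes "degree P \<le> d" "degree Q \<le> e"
  shows "coeff (P * Q) (d + e) = coeff P d * coeff Q e"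
proof (cases "degree P = d \<and> degree Q = e")
  case True
  then show ?thesis using coeff_mult_degree_sum[of P Q] by auto
next
  case False
  then have "degree P < d \<or> degree Q < e" using assms by auto
  then have "coeff P d * coeff Q e = 0" by (auto simp: coeff_eq_0)
  moreover have "degree (P * Q) < d + e"
    using degree_mult_le[of P Q] \<open>degree P < d \<or> degree Q < e\<close> assms by linarith
  ultimately show ?thesis by (simp add: coeff_eq_0)
qed

lemma pseudo_division:
  fixes f g :: "'a::idom mpoly poly"
  assumes "coeffs_in n f" "coeffs_in n g" "g \<noteq> 0"
  shows "\<exists>k h r. coeffs_in n h \<and> coeffs_in n r \<and> smult (lead_coeff g ^ k) f = g * h + r \<and> (r = 0 \<or> degree r < degree g)"
  using assms(1)
proof (induction "degree f" arbitrary: f rule: less_induct)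
  case less
  let ?c = "lead_coeff g"
  have c: "?c \<in> mpolys n" using assms(2) by (simp add: coeffs_in_def)
  show ?case
  proof (cases "degree f < degree g")
    case True
    then show ?thesis using less.prems by (intro exI[of _ 0] exI[of _ f]) auto
  next
    case False
    define j where "j = degree f - degree g"
    have fj: "degree f = degree g + j" using False by (simp add: j_def)
    define h0 where "h0 = monom (lead_coeff f) j"
    have h0: "coeffs_in n h0" using less.prems by (auto simp: h0_def coeffs_in_def coeff_monom)
    define f' where "f' = smult ?c f - g * h0"
    have f': "coeffs_in n f'" unfolding f'_def
      by (intro coeffs_in_minus coeffs_in_smult coeffs_in_mult c less.prems assms(2) h0)
    have dh: "degree h0 \<le> j" unfolding h0_def by (rule degree_monom_le)
    have "degree f' \<le> degree f"
      unfolding f'_def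
    proof (rule degree_diff_le)
      show "degree (g * h0) \<le> degree f" using degree_mult_le[of g h0] dh fj by linarith
    qed (rule degree_smult_le)
    moreover have "coeff f' (degree f) = 0"
      using coeff_mult_le[OF order_refl dh, of g] unfolding f'_def fj[symmetric]
      by (simp add: h0_def mult.commute)
    ultimately have "f' = 0 \<or> degree f' < degree f" by (rule eq_zero_or_degree_less)
    then show ?thesis
    proof
      assume "f' = 0"
      then have "smult (?c ^ 1) f = g * h0 + 0" by (simp add: f'_def)
      then show ?thesis using h0 coeffs_in_0 by blast
    next
      assume "degree f' < degree f"
      from less.hyps[OF this f'] obtain k h r where kh: "coeffs_in n h" "coeffs_in n r"
        "smult (?c ^ k) f' = g * h + r" "r = 0 \<or> degree r < degree g" by blast
      have "smult (?c ^ Suc k) f = smult (?c ^ k) f' + g * smult (?c ^ k) h0"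
        by (simp add: f'_def smult_diff_right mult.commute)
      also have "\<dots> = g * (h + smult (?c ^ k) h0) + r" by (simp add: kh(3) algebra_simps)
      finally show ?thesis
        using kh c h0 by (intro exI[of _ "Suc k"] exI[of _ "h + smult (?c ^ k) h0"] exI[of _ r])
          (auto intro!: coeffs_in_add coeffs_in_smult mpolys_power)
    qed
  qed
qed

lemma monic_factorization:
  fixes P :: "complex poly"
  assumes "lead_coeff P = 1"
  obtains as where "P = (\<Prod>a\<leftarrow>as. [:- a, 1:])" "length as = degree P" "\<And>a. a \<in> set as \<Longrightarrow> poly P a = 0"
proof -
  obtain as where as: "smult (lead_coeff P) (\<Prod>a\<leftarrow>as. [:- a, 1:]) = P" "length as = degree P"
    using fundamental_theorem_algebra_factorized[of P] by blast
  have P: "P = (\<Prod>a\<leftarrow>as. [:- a, 1:])" using as(1) assms by simp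
  show ?thesis
  proof (rule that[OF P as(2)])
    fix a assume "a \<in> set as"
    then show "poly P a = 0" unfolding P by (auto simp: poly_prod_list prod_list_zero_iff)
  qed
qed

lemma norm_coeff_le_roots:
  fixes P :: "complex poly"
  assumes P: "lead_coeff P = 1" and R: "\<And>z. poly P z = 0 \<Longrightarrow> norm z \<le> R" "R \<ge> 0"
  shows "norm (coeff P j) \<le> (1 + R) ^ degree P"
proof -
  obtain as where as: "P = (\<Prod>a\<leftarrow>as. [:- a, 1:])" "length as = degree P" "\<And>a. a \<in> set as \<Longrightarrow> poly P a = 0"
    using monic_factorization[OF P] by blast
  have "norm (coeff (\<Prod>a\<leftarrow>bs. [:- a, 1:]) j) \<le> (1 + R) ^ length bs" if "\<And>a. a \<in> set bs \<Longrightarrow> norm a \<le> R" for bs :: "complex list" and j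
    using that
  proof (induction bs arbitrary: j)
    case Nil
    then show ?case by (simp add: one_pCons coeff_pCons split: nat.splits)
  next
    case (Cons a bs)
    let ?Q = "\<Prod>a\<leftarrow>bs. [:- a, 1:]"
    have IH: "norm (coeff ?Q j) \<le> (1 + R) ^ length bs" for j using Cons by simp
    have IH': "norm (case j of 0 \<Rightarrow> 0 | Suc i \<Rightarrow> coeff ?Q i) \<le> (1 + R) ^ length bs"
      using IH R(2) by (auto split: nat.splits)
    have "coeff ([:- a, 1:] * ?Q) j = - a * coeff ?Q j + (case j of 0 \<Rightarrow> 0 | Suc i \<Rightarrow> coeff ?Q i)"
      by (simp add: coeff_pCons split: nat.splits)
    also have "norm \<dots> \<le> norm a * norm (coeff ?Q j) + norm (case j of 0 \<Rightarrow> 0 | Suc i \<Rightarrow> coeff ?Q i)"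
      using norm_triangle_ineq[of "- a * coeff ?Q j"] by (simp add: norm_mult)
    also have "\<dots> \<le> R * (1 + R) ^ length bs + (1 + R) ^ length bs"
      using Cons.prems R(2) IH IH' by (intro add_mono mult_mono) auto
    finally show ?case by (simp add: algebra_simps)
  qed
  then show ?thesis using as R by metis
qed

lemma root_near_small_value:
  fixes P :: "complex poly"
  assumes P: "lead_coeff P = 1" and small: "norm (poly P s) < \<delta> ^ degree P" and \<delta>: "\<delta> > 0"
  shows "\<exists>z. poly P z = 0 \<and> norm (z - s) < \<delta>"
proof (rule ccontr)
  assume far: "\<not> ?thesis"
  obtain as where as: "P = (\<Prod>a\<leftarrow>as. [:- a, 1:])" "length as = degree P" "\<And>a. a \<in> set as \<Longrightarrow> poly P a = 0"
    using monic_factorization[OF P] by blast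
  have "\<delta> ^ length bs \<le> norm (poly (\<Prod>a\<leftarrow>bs. [:- a, 1:]) s)" if "\<And>a. a \<in> set bs \<Longrightarrow> \<delta> \<le> norm (a - s)" for bs
    using that
  proof (induction bs)
    case (Cons a bs)
    have "\<delta> * \<delta> ^ length bs \<le> norm (a - s) * norm (poly (\<Prod>a\<leftarrow>bs. [:- a, 1:]) s)"
      using Cons \<delta> by (intro mult_mono) auto
    also have "\<dots> = norm (poly (\<Prod>a\<leftarrow>a # bs. [:- a, 1:]) s)"
    proof -
      have eq: "poly (\<Prod>a\<leftarrow>a # bs. [:- a, 1:]) s = (s - a) * poly (\<Prod>a\<leftarrow>bs. [:- a, 1:]) s"
        by (simp add: algebra_simps)
      show ?thesis unfolding eq norm_mult by (simp only: norm_minus_commute)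
    qed
    finally show ?case by simp
  qed simp
  moreover have "\<delta> \<le> norm (a - s)" if "a \<in> set as" for a using far as(3)[OF that] by force
  ultimately have "\<delta> ^ degree P \<le> norm (poly P s)" using as by metis
  then show False using small by simp
qed

lemma dominant_leading_term:
  fixes c :: "nat \<Rightarrow> 'a::real_normed_field"
  assumes s: "norm s \<ge> 1 + (\<Sum>j<d. norm (c j)) / norm (c d)" and c: "c d \<noteq> 0"
  shows "norm (c d) \<le> norm (\<Sum>j\<le>d. c j * s ^ j)"
proof (cases d)
  case 0
  then show ?thesis by simp
next
  case (Suc k)
  let ?S = "\<Sum>j<d. norm (c j)"
  have "?S / norm (c d) \<ge> 0" by (simp add: sum_nonneg)
  then have s1: "norm s \<ge> 1" using s by linarith
  have "norm (c d) * norm s \<ge> norm (c d) * (1 + ?S / norm (c d))" using s by (rule mult_left_mono) simp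
  then have key: "norm (c d) * norm s - ?S \<ge> norm (c d)" using c by (simp add: algebra_simps)
  have "norm (\<Sum>j<d. c j * s ^ j) \<le> (\<Sum>j<d. norm (c j) * norm s ^ k)"
  proof (rule sum_norm_le)
    fix j assume "j \<in> {..<d}"
    then have "norm s ^ j \<le> norm s ^ k" using s1 Suc by (intro power_increasing) auto
    then show "norm (c j * s ^ j) \<le> norm (c j) * norm s ^ k" by (simp add: norm_mult norm_power mult_left_mono)
  qed
  then have low: "norm (\<Sum>j<d. c j * s ^ j) \<le> ?S * norm s ^ k" by (simp add: sum_distrib_right)
  have "norm (c d) \<le> norm (c d) * norm s - ?S" by (rule key)
  also have "\<dots> \<le> (norm (c d) * norm s - ?S) * norm s ^ k"
    using key s1 order_trans[OF norm_ge_zero key] by (simp add: mult_le_cancel_left1 one_le_power)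
  also have "\<dots> = norm (c d * s ^ d) - ?S * norm s ^ k" by (simp add: Suc norm_mult norm_power algebra_simps)
  also have "\<dots> \<le> norm (c d * s ^ d) - norm (\<Sum>j<d. c j * s ^ j)" using low by simp
  also have "\<dots> \<le> norm (c d * s ^ d + (\<Sum>j<d. c j * s ^ j))"
    using norm_triangle_ineq4[of "c d * s ^ d + (\<Sum>j<d. c j * s ^ j)" "\<Sum>j<d. c j * s ^ j"] by simp
  also have "c d * s ^ d + (\<Sum>j<d. c j * s ^ j) = (\<Sum>j\<le>d. c j * s ^ j)"
    by (simp add: lessThan_Suc_atMost[symmetric] add.commute)
  finally show ?thesis .
qed

definition psubst :: "(nat \<Rightarrow> 'a mpoly poly) \<Rightarrow> 'a::comm_ring_1 mpoly \<Rightarrow> 'a mpoly poly" where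
  "psubst g p = msubst (\<lambda>c. [:mconst c:]) g p"

lemma comm_semiring_hom_const_mconst: "comm_semiring_hom (\<lambda>c :: 'a::comm_ring_1. [:mconst c:])"
  by unfold_locales (simp_all add: mconst_def single_add mult_single one_pCons mult.commute)

lemmas psubst_simps =
  comm_semiring_hom.msubst_add[OF comm_semiring_hom_const_mconst, folded psubst_def]
  comm_semiring_hom.msubst_mult[OF comm_semiring_hom_const_mconst, folded psubst_def]
  comm_semiring_hom.msubst_mconst[OF comm_semiring_hom_const_mconst, folded psubst_def]
  comm_semiring_hom.msubst_mvar[OF comm_semiring_hom_const_mconst, folded psubst_def]

lemma peval_psubst:
  assumes "p \<in> mpolys n" shows "peval y (psubst g p) s = meval (\<lambda>i. if i < n then peval y (g i) s else 0) p"
  using assms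
  by (induction p rule: mpolys_induct) (auto simp: psubst_simps peval_add peval_mult peval_const meval_simps)

lemma coeffs_in_psubst:
  assumes "p \<in> mpolys n" "\<And>i. i < n \<Longrightarrow> coeffs_in k (g i)" shows "coeffs_in k (psubst g p)"
  using assms
  by (induction p rule: mpolys_induct) (auto simp: psubst_simps intro: coeffs_in_add coeffs_in_mult coeffs_in_const)

lemma peval_linear: "peval y [:p, q:] s = meval y p + s * meval y q"
proof -
  have "map_poly (meval y) [:p, q:] = [:meval y p, meval y q:]"
    by (rule poly_eqI) (simp add: coeff_pCons split: nat.splits)
  then show ?thesis by (simp add: peval_def)
qed

lemma coeffs_in_linear: "p \<in> mpolys n \<Longrightarrow> q \<in> mpolys n \<Longrightarrow> coeffs_in n [:p, q:]"
  by (auto simp: coeffs_in_def coeff_pCons split: nat.splits)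

lemma peval_eq_0:
  fixes P :: "'a::real_normed_field mpoly poly"
  assumes P: "coeffs_in n P" and z: "\<And>y s. y \<in> coord_space n \<Longrightarrow> peval y P s = 0"
  shows "P = 0"
proof (rule poly_eqI)
  fix j
  have "coeff P j = 0"
  proof (rule mpoly_eq_0_if_vanishing)
    show "coeff P j \<in> mpolys n" using P by (simp add: coeffs_in_def)
    fix y :: "nat \<Rightarrow> 'a" assume "y \<in> coord_space n"
    then have "map_poly (meval y) P = 0" using z by (simp add: peval_def poly_all_0_iff_0[symmetric])
    then have "coeff (map_poly (meval y) P) j = 0" by simp
    then show "meval y (coeff P j) = 0" by simp
  qed
  then show "coeff P j = coeff 0 j" by simp
qed

text \<open>
  The polynomial \<open>p(y + se)\<close> in the variable \<open>s\<close>, over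
  \<open>\<complex>[y]\<close>. Keeping all coordinates of \<open>y\<close> although one of them is
  redundant avoids a linear change of coordinates.
\<close>

definition along :: "(nat \<Rightarrow> 'a) \<Rightarrow> 'a::comm_ring_1 mpoly \<Rightarrow> 'a mpoly poly" where
  "along e p = psubst (\<lambda>i. [:mvar i, mconst (e i):]) p"

lemma peval_along: "p \<in> mpolys n \<Longrightarrow> peval y (along e p) s = meval (\<lambda>i. y i + s * e i) p"
  unfolding along_def peval_psubst by (rule meval_cong) (auto simp: peval_linear)

lemma coeffs_in_along: "p \<in> mpolys n \<Longrightarrow> coeffs_in n (along e p)"
  unfolding along_def by (rule coeffs_in_psubst) (auto intro: coeffs_in_linear mpolys_mvar)

lemma top_coeff_power:
  fixes P :: "'a::idom mpoly poly"
  assumes "degree P \<le> d" "coeff P d = mconst c"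
  shows "degree (P ^ k) \<le> k * d \<and> coeff (P ^ k) (k * d) = mconst (c ^ k)"
proof (induction k)
  case (Suc k)
  then show ?case
    using coeff_mult_le[of P d "P ^ k" "k * d"] degree_mult_le[of P "P ^ k"] assms
    by (auto simp: mconst_def mult_single)
qed simp

lemma top_coeff_prod:
  fixes P :: "'b \<Rightarrow> 'a::idom mpoly poly"
  assumes "finite A" "\<And>i. i \<in> A \<Longrightarrow> degree (P i) \<le> d i \<and> coeff (P i) (d i) = mconst (c i)"
  shows "degree (prod P A) \<le> sum d A \<and> coeff (prod P A) (sum d A) = mconst (prod c A)"
  using assms
proof (induction A)
  case (insert i A)
  have i: "degree (P i) \<le> d i" "coeff (P i) (d i) = mconst (c i)" using insert.prems by auto
  have A: "degree (prod P A) \<le> sum d A" "coeff (prod P A) (sum d A) = mconst (prod c A)" using insert by auto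
  have "degree (P i * prod P A) \<le> d i + sum d A"
    using degree_mult_le[of "P i" "prod P A"] i(1) A(1) by linarith
  then show ?case
    using insert.hyps coeff_mult_le[OF i(1) A(1)] by (simp add: i(2) A(2) mconst_def mult_single)
qed simp

text \<open>
  The leading coefficient of \<open>a(y + se)\<close> in \<open>s\<close> is the value at
  \<open>e\<close> of the homogeneous part of highest degree, if this is not \<open>0\<close>.
\<close>

lemma exists_monic_direction:
  fixes a :: "'a::real_normed_field mpoly"
  assumes a: "a \<in> mpolys n" "a \<noteq> 0"
  shows "\<exists>e\<in>coord_space n. \<exists>c. c \<noteq> 0 \<and> lead_coeff (along e a) = mconst c"
proof -
  have ne: "keys a \<noteq> {}" using a(2) by (metis keys_zero poly_mapping_eqI in_keys_iff empty_iff lookup_zero)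
  define D where "D = Max (mdeg ` keys a)"
  have le: "mdeg m \<le> D" if "m \<in> keys a" for m unfolding D_def using that by (intro Max_ge) auto
  have "D \<in> mdeg ` keys a" unfolding D_def using ne by (intro Max_in) auto
  then obtain m0 where m0: "m0 \<in> keys a" "mdeg m0 = D" by auto
  define t where "t = (\<Sum>m\<in>{m\<in>keys a. mdeg m = D}. single m (lookup a m))"
  have "t \<in> mpolys n" unfolding t_def using a(1) by (intro mpolys_sum mpolys_single) (auto simp: mpolys_def)
  moreover have "lookup t m0 = (\<Sum>m\<in>{m\<in>keys a. mdeg m = D}. if m = m0 then lookup a m0 else 0)"
    unfolding t_def lookup_sum by (intro sum.cong) (auto simp: lookup_single when_def)
  then have "lookup t m0 \<noteq> 0" using m0 by (auto simp: in_keys_iff)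
  then have "t \<noteq> 0" by auto
  ultimately obtain e where e: "e \<in> coord_space n" "meval e t \<noteq> 0" using nonzero_point by blast
  define g where "g = (\<lambda>i. [:mvar i, mconst (e i):])"
  have mono: "degree (monomial_value g m) \<le> mdeg m \<and> coeff (monomial_value g m) (mdeg m) = mconst (monomial_value e m)" for m
    unfolding monomial_value_def mdeg_def
  proof (rule top_coeff_prod)
    fix i
    show "degree (g i ^ lookup m i) \<le> lookup m i \<and> coeff (g i ^ lookup m i) (lookup m i) = mconst (e i ^ lookup m i)"
      using top_coeff_power[of "g i" 1 "e i" "lookup m i"] by (simp add: g_def)
  qed simp
  have al: "along e a = (\<Sum>m\<in>keys a. smult (mconst (lookup a m)) (monomial_value g m))"
    by (simp add: along_def psubst_def msubst_def g_def)
  have deg: "degree (along e a) \<le> D"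
    unfolding al
  proof (rule degree_sum_le)
    fix m assume "m \<in> keys a"
    then show "degree (smult (mconst (lookup a m)) (monomial_value g m)) \<le> D"
      using mono[of m] le[of m] degree_smult_le[of "mconst (lookup a m)" "monomial_value g m"] by linarith
  qed simp
  have "coeff (along e a) D = (\<Sum>m\<in>keys a. if mdeg m = D then mconst (lookup a m * monomial_value e m) else 0)"
    unfolding al coeff_sum
  proof (intro sum.cong refl)
    fix m assume m: "m \<in> keys a"
    show "coeff (smult (mconst (lookup a m)) (monomial_value g m)) D = (if mdeg m = D then mconst (lookup a m * monomial_value e m) else 0)"
    proof (cases "mdeg m = D")
      case True
      then show ?thesis using mono[of m] by (auto simp: mconst_def mult_single)
    next
      case False
      then have "degree (monomial_value g m) < D" using mono[of m] le[OF m] by linarith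
      then show ?thesis using False by (simp add: coeff_eq_0)
    qed
  qed
  also have "\<dots> = (\<Sum>m\<in>{m\<in>keys a. mdeg m = D}. mconst (lookup a m * monomial_value e m))"
    by (simp add: sum.inter_filter)
  also have "\<dots> = mconst (meval e t)"
  proof -
    have "meval e t = (\<Sum>m\<in>{m\<in>keys a. mdeg m = D}. lookup a m * monomial_value e m)"
      by (simp add: t_def meval_sum meval_single)
    moreover have "mconst (sum f A) = (\<Sum>x\<in>A. mconst (f x))" for f :: "(nat \<Rightarrow>\<^sub>0 nat) \<Rightarrow> 'a" and A
      by (induction A rule: infinite_finite_induct) (simp_all add: mconst_def single_add)
    ultimately show ?thesis by simp
  qed
  finally have cD: "coeff (along e a) D = mconst (meval e t)" .
  have "mconst (meval e t) \<noteq> 0" using e(2) by (metis meval_0 meval_mconst)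
  then have "degree (along e a) = D" using deg cD le_degree[of "along e a" D] by simp
  then show ?thesis using e cD by blast
qed

text \<open>
  The fundamental theorem of algebra on the lines through the origin.
\<close>

lemma nonvanishing_constant:
  fixes P :: "complex mpoly poly"
  assumes P: "coeffs_in n P" and nz: "\<And>x s. x \<in> coord_space n \<Longrightarrow> peval x P s \<noteq> 0"
  shows "\<exists>c. \<forall>x\<in>coord_space n. \<forall>s. peval x P s = c"
proof -
  have "peval x P s = peval (\<lambda>_. 0) P 0" if x: "x \<in> coord_space n" for x s
  proof -
    have "\<forall>j. \<exists>q. \<forall>t. meval (\<lambda>i. 0 + t * x i) (coeff P j) = poly q t"
      using meval_line_poly[of _ n "\<lambda>_. 0" x] P by (auto simp: coeffs_in_def)
    then obtain q where q: "\<And>j t. meval (\<lambda>i. 0 + t * x i) (coeff P j) = poly (q j) t" by metis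
    define U where "U = (\<Sum>j\<le>degree P. q j * [:0, s:] ^ j)"
    have U: "poly U t = peval (\<lambda>i. t * x i) P (t * s)" for t
      using q by (simp add: U_def poly_sum peval_eq_sum[OF order_refl])
    have "(\<lambda>i. t * x i) \<in> coord_space n" for t using x by (simp add: coord_space_def)
    then have "poly U t \<noteq> 0" for t unfolding U using nz by blast
    then have "constant (poly U)" using fundamental_theorem_of_algebra[of U] by blast
    then have "poly U 1 = poly U 0" unfolding constant_def by blast
    then show ?thesis by (simp add: U)
  qed
  then show ?thesis by blast
qed

section \<open>Denominators of the inverse\<close>

text \<open>
  Functions of \<open>(y, s)\<close> are studied at the points with \<open>y + se = F(x)\<close>, that
  is \<open>y = F(x) - se\<close>.
\<close>

locale etale_direction =
  fixes n :: nat and F :: "nat \<Rightarrow> complex mpoly" and e :: "nat \<Rightarrow> complex"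
  assumes F: "\<And>i. i < n \<Longrightarrow> F i \<in> mpolys n" and et: "etale n F" and e: "e \<in> coord_space n"
begin

definition shifted :: "(nat \<Rightarrow> complex) \<Rightarrow> complex \<Rightarrow> nat \<Rightarrow> complex" where
  "shifted x s = (\<lambda>i. polymap n F x i - s * e i)"

lemma shifted_coord_space [simp]: "shifted x s \<in> coord_space n"
  using e polymap_coord_space[of n F x] by (simp add: shifted_def coord_space_def)

lemma shifted_eq: "polymap n F x = (\<lambda>i. y i + s * e i) \<Longrightarrow> shifted x s = y"
  by (auto simp: shifted_def)

definition pullback :: "complex mpoly poly \<Rightarrow> complex mpoly poly" where
  "pullback P = (\<Sum>j\<le>degree P. psubst (\<lambda>i. [:F i, - mconst (e i):]) (coeff P j) * monom 1 j)"

lemma peval_pullback: "coeffs_in n P \<Longrightarrow> peval x (pullback P) s = peval (shifted x s) P s"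
proof -
  assume P: "coeffs_in n P"
  have "peval x (psubst (\<lambda>i. [:F i, - mconst (e i):]) (coeff P j)) s = meval (shifted x s) (coeff P j)" for j
  proof -
    have c: "coeff P j \<in> mpolys n" using P by (simp add: coeffs_in_def)
    show ?thesis unfolding peval_psubst[OF c]
      by (rule meval_cong[OF c]) (auto simp: peval_linear shifted_def polymap_def meval_simps)
  qed
  then show ?thesis
    by (simp add: pullback_def peval_sum peval_mult peval_monom peval_eq_sum[where P = P, OF order_refl])
qed

lemma coeffs_in_pullback: "coeffs_in n P \<Longrightarrow> coeffs_in n (pullback P)"
  unfolding pullback_def
  by (intro coeffs_in_sum coeffs_in_mult coeffs_in_psubst[of _ n] coeffs_in_linear coeffs_in_monom mpolys_uminus mpolys_mconst)
    (auto simp: coeffs_in_def F)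

text \<open>
  For fixed \<open>s\<close> this is algebraic independence, applied to \<open>P(y - se, s)\<close>.
\<close>

lemma eq_0_if_pullback_vanishes:
  assumes P: "coeffs_in n P" and z: "\<And>x s. x \<in> coord_space n \<Longrightarrow> peval (shifted x s) P s = 0"
  shows "P = 0"
proof (rule peval_eq_0[OF P])
  fix y :: "nat \<Rightarrow> complex" and s assume y: "y \<in> coord_space n"
  define p where "p = (\<Sum>j\<le>degree P. mcomp (\<lambda>i. mvar i - mconst (s * e i)) (coeff P j) * mconst (s ^ j))"
  have c: "coeff P j \<in> mpolys n" for j using P by (simp add: coeffs_in_def)
  have p: "p \<in> mpolys n" unfolding p_def
    by (intro mpolys_sum mpolys_mult mpolys_mconst mcomp_mpolys[OF c] mpolys_minus mpolys_mvar)
  have ev: "meval w p = peval (\<lambda>i. w i - s * e i) P s" for w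
  proof -
    have "meval w (mcomp (\<lambda>i. mvar i - mconst (s * e i)) (coeff P j)) = meval (\<lambda>i. w i - s * e i) (coeff P j)" for j
      unfolding meval_mcomp[OF c] by (rule meval_cong[OF c]) (auto simp: polymap_def meval_simps)
    then show ?thesis by (simp add: p_def meval_simps peval_eq_sum[OF order_refl])
  qed
  have "p = 0"
    by (rule etale_algebraic_independence[OF F et p]) (use z in \<open>simp_all add: ev shifted_def\<close>)
  then have "meval (\<lambda>i. y i + s * e i) p = 0" by simp
  then show "peval y P s = 0" by (simp add: ev)
qed

lemma cancel_pullback:
  assumes G: "coeffs_in n G" "G \<noteq> 0" and B: "coeffs_in n B" and Q: "coeffs_in n Q" and i: "i < n"
    and eq: "\<And>x s. x \<in> coord_space n \<Longrightarrow> peval (shifted x s) G s * peval (shifted x s) B s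
        = peval (shifted x s) G s * (peval (shifted x s) Q s * x i)"
    and x: "x \<in> coord_space n"
  shows "peval (shifted x s) B s = peval (shifted x s) Q s * x i"
proof -
  let ?D = "pullback B - pullback Q * [:mvar i:]"
  have D: "coeffs_in n ?D"
    by (intro coeffs_in_minus coeffs_in_mult coeffs_in_pullback coeffs_in_const B Q mpolys_mvar i)
  have ev: "peval x ?D s = peval (shifted x s) B s - peval (shifted x s) Q s * x i" for x s
    by (simp add: peval_minus peval_mult peval_smult peval_pullback B Q peval_const mult.commute)
  have "pullback G * ?D = 0"
  proof (rule peval_eq_0)
    show "coeffs_in n (pullback G * ?D)" by (intro coeffs_in_mult coeffs_in_pullback G D)
    fix x :: "nat \<Rightarrow> complex" and s assume "x \<in> coord_space n"
    then show "peval x (pullback G * ?D) s = 0"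
      using eq[of x s] unfolding peval_mult[of _ "pullback G"] ev by (simp add: peval_pullback G)
  qed
  moreover have "pullback G \<noteq> 0"
  proof
    assume z: "pullback G = 0"
    have "peval (shifted x s) G s = 0" for x s using peval_pullback[OF G(1), of x s] z by simp
    then show False using eq_0_if_pullback_vanishes[OF G(1)] G(2) by blast
  qed
  ultimately have "?D = 0" by simp
  then show ?thesis using ev[of x s] by simp
qed

text \<open>
  In terms of the inverse \<open>G\<close>, the products of \<open>q(y, s)\<close> and
  \<open>G\<^sub>i(y + se)\<close> are polynomials. The condition is expressed on the source because
  \<open>G\<close> is not known to be defined everywhere.
\<close>

definition denominator :: "complex mpoly poly \<Rightarrow> bool" where
  "denominator q \<longleftrightarrow> coeffs_in n q \<and> (\<exists>B. \<forall>i<n. coeffs_in n (B i) \<and>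
     (\<forall>x\<in>coord_space n. \<forall>s. peval (shifted x s) (B i) s = peval (shifted x s) q s * x i))"

lemma denominator_comb:
  assumes "denominator q" "denominator r" and c: "c \<in> mpolys n" and h: "coeffs_in n h"
  shows "denominator (smult c q - r * h)"
proof -
  obtain B where B: "coeffs_in n q" "\<And>i. i < n \<Longrightarrow> coeffs_in n (B i)"
    "\<And>i x s. i < n \<Longrightarrow> x \<in> coord_space n \<Longrightarrow> peval (shifted x s) (B i) s = peval (shifted x s) q s * x i"
    using assms(1) unfolding denominator_def by blast
  obtain C where C: "coeffs_in n r" "\<And>i. i < n \<Longrightarrow> coeffs_in n (C i)"
    "\<And>i x s. i < n \<Longrightarrow> x \<in> coord_space n \<Longrightarrow> peval (shifted x s) (C i) s = peval (shifted x s) r s * x i"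
    using assms(2) unfolding denominator_def by blast
  show ?thesis
    unfolding denominator_def
  proof (intro conjI exI[of _ "\<lambda>i. smult c (B i) - C i * h"] allI impI ballI)
    show "coeffs_in n (smult c q - r * h)"
      by (intro coeffs_in_minus coeffs_in_smult coeffs_in_mult c h B C)
    fix i assume i: "i < n"
    show "coeffs_in n (smult c (B i) - C i * h)"
      by (intro coeffs_in_minus coeffs_in_smult coeffs_in_mult c h B C i)
    fix x :: "nat \<Rightarrow> complex" and s assume "x \<in> coord_space n"
    then show "peval (shifted x s) (smult c (B i) - C i * h) s = peval (shifted x s) (smult c q - r * h) s * x i"
      using B(3)[OF i] C(3)[OF i] by (simp add: peval_minus peval_smult peval_mult algebra_simps)
  qed
qed

text \<open>
  The polynomials \<open>g\<close> that vanish wherever the pullback of \<open>q\<close> does form an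
  ideal, which contains \<open>q\<close> and all numerators. An element of least degree in
  \<open>s\<close> divides them up to factors in \<open>\<complex>[y]\<close>, so it could be cancelled
  from the fractions. As \<open>q\<close> is minimal, this element does not involve \<open>s\<close>.
\<close>

lemma minimal_denominator_zeros:
  assumes q: "denominator q" "q \<noteq> 0" and min: "\<And>r. denominator r \<Longrightarrow> r \<noteq> 0 \<Longrightarrow> degree q \<le> degree r"
  shows "\<exists>r\<in>mpolys n. r \<noteq> 0 \<and> (\<forall>x\<in>coord_space n. \<forall>s. peval (shifted x s) q s = 0 \<longrightarrow> meval (shifted x s) r = 0)"
proof -
  obtain B where B: "coeffs_in n q" "\<And>i. i < n \<Longrightarrow> coeffs_in n (B i)"
    "\<And>i x s. i < n \<Longrightarrow> x \<in> coord_space n \<Longrightarrow> peval (shifted x s) (B i) s = peval (shifted x s) q s * x i"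
    using q(1) unfolding denominator_def by blast
  define I where "I g \<longleftrightarrow> coeffs_in n g \<and> (\<forall>x\<in>coord_space n. \<forall>s. peval (shifted x s) q s = 0 \<longrightarrow> peval (shifted x s) g s = 0)" for g
  have "I q" using B(1) by (simp add: I_def)
  then obtain g where g: "I g" "g \<noteq> 0" and gmin: "\<And>f. I f \<Longrightarrow> f \<noteq> 0 \<Longrightarrow> degree g \<le> degree f"
    using ex_has_least_nat[of "\<lambda>g. I g \<and> g \<noteq> 0" q degree] q(2) by blast
  have gc: "coeffs_in n g" using g(1) by (simp add: I_def)
  define c where "c = lead_coeff g"
  have c: "c \<in> mpolys n" using gc by (simp add: c_def coeffs_in_def)
  have c0: "c \<noteq> 0" using g(2) by (simp add: c_def)
  have div: "\<exists>k h. coeffs_in n h \<and> smult (c ^ k) f = g * h" if f: "I f" for f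
  proof -
    obtain k h r where kh: "coeffs_in n h" "coeffs_in n r" "smult (c ^ k) f = g * h + r" "r = 0 \<or> degree r < degree g"
      using pseudo_division[of n f g] f gc g(2) unfolding I_def c_def by blast
    have r: "r = smult (c ^ k) f - g * h" using kh(3) by simp
    have "I r"
      unfolding I_def
    proof (intro conjI ballI allI impI)
      fix x :: "nat \<Rightarrow> complex" and s assume "x \<in> coord_space n" "peval (shifted x s) q s = 0"
      then have "peval (shifted x s) f s = 0" "peval (shifted x s) g s = 0" using f g(1) by (auto simp: I_def)
      then show "peval (shifted x s) r s = 0" by (simp add: r peval_minus peval_smult peval_mult)
    qed (rule kh(2))
    then have "r = 0" using gmin kh(4) by (metis not_le)
    then show ?thesis using kh by auto
  qed
  obtain k h where kh: "coeffs_in n h" "smult (c ^ k) q = g * h" using div[OF \<open>I q\<close>] by blast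
  have "I (B i)" if "i < n" for i using B that by (auto simp: I_def)
  then have "\<forall>i. \<exists>l f. i < n \<longrightarrow> coeffs_in n f \<and> smult (c ^ l) (B i) = g * f" using div by blast
  then obtain l f where lf: "\<And>i. i < n \<Longrightarrow> coeffs_in n (f i)" "\<And>i. i < n \<Longrightarrow> smult (c ^ l i) (B i) = g * f i"
    by metis
  define L where "L = (\<Sum>i<n. l i)"
  define q1 where "q1 = smult (c ^ L) h"
  have q1: "smult (c ^ (L + k)) q = g * q1"
    by (simp add: q1_def kh(2)[symmetric] power_add mult_smult_right[symmetric])
  have q1c: "coeffs_in n q1" unfolding q1_def by (intro coeffs_in_smult mpolys_power c kh)
  have q1n: "q1 \<noteq> 0" using q1 q(2) c0 by auto
  have "denominator q1"
    unfolding denominator_def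
  proof (intro conjI q1c exI[of _ "\<lambda>i. smult (c ^ (L - l i + k)) (f i)"] allI impI ballI)
    fix i assume i: "i < n"
    have "l i \<le> L" unfolding L_def using i by (intro member_le_sum) auto
    then have e: "c ^ (L + k) = c ^ (L - l i + k) * c ^ l i" by (simp add: power_add[symmetric])
    have fi: "smult (c ^ (L + k)) (B i) = g * smult (c ^ (L - l i + k)) (f i)"
      unfolding e mult_smult_right lf(2)[OF i, symmetric] by simp
    show fc: "coeffs_in n (smult (c ^ (L - l i + k)) (f i))" by (intro coeffs_in_smult mpolys_power c lf i)
    fix x :: "nat \<Rightarrow> complex" and s assume x: "x \<in> coord_space n"
    show "peval (shifted x s) (smult (c ^ (L - l i + k)) (f i)) s = peval (shifted x s) q1 s * x i"
    proof (rule cancel_pullback[OF gc g(2) fc q1c i _ x])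
      fix x :: "nat \<Rightarrow> complex" and s assume x: "x \<in> coord_space n"
      let ?e = "\<lambda>P. peval (shifted x s) P s"
      have "?e g * ?e (smult (c ^ (L - l i + k)) (f i)) = ?e (smult (c ^ (L + k)) (B i))"
        unfolding fi peval_mult ..
      also have "\<dots> = ?e (smult (c ^ (L + k)) q) * x i"
        unfolding peval_smult B(3)[OF i x] by simp
      also have "\<dots> = ?e g * (?e q1 * x i)" unfolding q1 peval_mult by simp
      finally show "?e g * ?e (smult (c ^ (L - l i + k)) (f i)) = ?e g * (?e q1 * x i)" .
    qed
  qed
  then have "degree q \<le> degree q1" using min q1n by blast
  moreover have "degree q = degree g + degree q1"
  proof -
    have "degree (smult (c ^ (L + k)) q) = degree q" using c0 by simp
    then show ?thesis unfolding q1 using degree_mult_eq[OF g(2) q1n] by simp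
  qed
  ultimately have "degree g = 0" by simp
  then obtain r where r: "g = [:r:]" by (rule degree_eq_zeroE)
  have "r \<in> mpolys n" using gc[unfolded coeffs_in_def, rule_format, of 0] r by simp
  moreover have "r \<noteq> 0" using g(2) r by auto
  moreover have "meval (shifted x s) r = 0" if "x \<in> coord_space n" "peval (shifted x s) q s = 0" for x s
    using g(1) that unfolding I_def r peval_const by blast
  ultimately show ?thesis by blast
qed

end

text \<open>
  Cauchy's bound for the roots of \<open>P(y, \<cdot>)\<close>, if \<open>c\<close> is its leading
  coefficient.
\<close>

definition root_radius :: "complex mpoly poly \<Rightarrow> complex \<Rightarrow> (nat \<Rightarrow> complex) \<Rightarrow> real" where
  "root_radius P c y = 1 + (\<Sum>j<degree P. norm (meval y (coeff P j))) / norm c"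

lemma root_radius_ge_1: "root_radius P c y \<ge> 1"
  by (simp add: root_radius_def sum_nonneg)

lemma poly_bounded_root_radius: "coeffs_in n P \<Longrightarrow> poly_bounded n S (root_radius P c)"
proof -
  assume P: "coeffs_in n P"
  have "poly_bounded n S (\<lambda>y. 1 + (\<Sum>j<degree P. norm (meval y (coeff P j))) * (1 / norm c))"
    by (intro poly_bounded_add poly_bounded_mult poly_bounded_sum poly_bounded_const poly_bounded_meval)
      (use P in \<open>simp add: coeffs_in_def\<close>)
  then show ?thesis by (simp add: root_radius_def[abs_def])
qed

lemma norm_peval_ge:
  assumes "lead_coeff P = mconst c" "c \<noteq> 0" "norm s \<ge> root_radius P c y"
  shows "norm c \<le> norm (peval y P s)"
  using dominant_leading_term[where d = "degree P" and c = "\<lambda>j. meval y (coeff P j)" and s = s] assms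
  by (simp add: root_radius_def peval_eq_sum[OF order_refl])

context etale_direction
begin

text \<open>
  Up to a factor in \<open>\<complex>[y]\<close>, \<open>q\<close> divides \<open>al\<close>, whose
  leading coefficient is constant. So the roots of \<open>q(y, \<cdot>)\<close>, and with them the
  quotients of its coefficients by the leading one, have polynomial growth in \<open>y\<close>; hence
  the quotients are polynomials.
\<close>

lemma denominator_monic:
  assumes q: "denominator q" "q \<noteq> 0" and min: "\<And>r. denominator r \<Longrightarrow> r \<noteq> 0 \<Longrightarrow> degree q \<le> degree r"
    and al: "denominator al" "lead_coeff al = mconst \<kappa>" "\<kappa> \<noteq> 0"
  shows "\<exists>p. coeffs_in n p \<and> q = smult (lead_coeff q) p \<and> lead_coeff p = 1 \<and> degree p = degree q"
proof -
  define c where "c = lead_coeff q"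
  define m where "m = degree q"
  have qc: "coeffs_in n q" and alc: "coeffs_in n al" using q(1) al(1) by (simp_all add: denominator_def)
  have c: "c \<in> mpolys n" "c \<noteq> 0" using qc q(2) by (simp_all add: c_def coeffs_in_def)
  obtain k h r where kh: "coeffs_in n h" "coeffs_in n r" "smult (c ^ k) al = q * h + r" "r = 0 \<or> degree r < degree q"
    using pseudo_division[OF alc qc q(2)] unfolding c_def by blast
  have "denominator (smult (c ^ k) al - q * h)" by (intro denominator_comb al q mpolys_power c kh)
  then have "denominator r" using kh(3) by simp
  then have "r = 0" using min kh(4) by (metis not_le)
  then have div: "smult (c ^ k) al = q * h" using kh(3) by simp
  define R where "R = root_radius al \<kappa>"
  have coeff_bound: "norm (meval y (coeff q j) / meval y c) \<le> (1 + R y) ^ m" if y: "meval y c \<noteq> 0" for y j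
  proof -
    define P where "P = smult (1 / meval y c) (map_poly (meval y) q)"
    have dP: "degree P = m"
    proof (rule antisym)
      show "degree P \<le> m" unfolding P_def by (rule degree_le) (auto simp: m_def coeff_eq_0)
      show "m \<le> degree P" using y by (intro le_degree) (simp add: P_def m_def c_def)
    qed
    have lP: "lead_coeff P = 1" unfolding dP using y by (simp add: P_def m_def c_def)
    have "norm z \<le> R y" if "poly P z = 0" for z
    proof (rule ccontr)
      assume "\<not> norm z \<le> R y"
      then have "norm \<kappa> \<le> norm (peval y al z)" by (intro norm_peval_ge al) (simp add: R_def)
      then have "peval y al z \<noteq> 0" using al(3) by auto
      moreover have "peval y q z = 0" using that y by (simp add: P_def peval_def)
      then have "peval y (smult (c ^ k) al) z = 0" unfolding div peval_mult by simp
      ultimately show False using y by (simp add: peval_smult meval_power)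
    qed
    moreover have "R y \<ge> 0" using root_radius_ge_1[of al \<kappa> y] by (simp add: R_def)
    ultimately have "norm (coeff P j) \<le> (1 + R y) ^ degree P" by (intro norm_coeff_le_roots[OF lP])
    then show ?thesis unfolding dP by (simp add: P_def)
  qed
  have "poly_bounded n UNIV (\<lambda>y. (1 + R y) ^ m)"
    unfolding R_def by (intro poly_bounded_power poly_bounded_add poly_bounded_const poly_bounded_root_radius alc)
  then obtain C M where CM: "C \<ge> 0" "\<And>y. \<bar>(1 + R y) ^ m\<bar> \<le> C * nrm n y ^ M" by (auto simp: poly_bounded_def)
  have "\<exists>p\<in>mpolys n. coeff q j = c * p" for j
  proof -
    let ?u = "coeff q j"
    have u: "?u \<in> mpolys n" using qc by (simp add: coeffs_in_def)
    have "\<exists>p\<in>mpolys n. \<forall>y\<in>coord_space n. meval y c \<noteq> 0 \<longrightarrow> meval y ?u / meval y c = meval y p"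
    proof (rule polynomial_if_polynomial_growth[OF c])
      fix y v :: "nat \<Rightarrow> complex" and s assume "meval (\<lambda>i. y i + s * v i) c \<noteq> 0"
      then show "(\<lambda>s. meval (\<lambda>i. y i + s * v i) ?u / meval (\<lambda>i. y i + s * v i) c) field_differentiable at s"
        using DERIV_meval_line[OF u, of y v s] DERIV_meval_line[OF c(1), of y v s]
        by (intro field_differentiable_divide) (auto simp: field_differentiable_def)
    next
      fix y assume "meval y c \<noteq> 0"
      then show "norm (meval y ?u / meval y c) \<le> C * nrm n y ^ M"
        using coeff_bound[of y j] CM(2)[of y] by linarith
    qed
    then obtain p where p: "p \<in> mpolys n" "\<And>y. y \<in> coord_space n \<Longrightarrow> meval y c \<noteq> 0 \<Longrightarrow> meval y ?u / meval y c = meval y p"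
      by blast
    have "?u = c * p"
      by (rule mpoly_eq_if_eq_off_zeros[OF c u mpolys_mult[OF c(1) p(1)]])
        (use p(2) in \<open>simp add: meval_mult field_simps\<close>)
    then show ?thesis using p(1) by blast
  qed
  then obtain f where f: "\<And>j. f j \<in> mpolys n" "\<And>j. coeff q j = c * f j" by metis
  define p where "p = (\<Sum>j\<le>m. monom (f j) j)"
  have cp: "coeff p j = (if j \<le> m then f j else 0)" for j
    by (simp add: p_def coeff_sum coeff_monom)
  have qp: "q = smult c p"
    by (rule poly_eqI) (auto simp: cp f(2)[symmetric] m_def coeff_eq_0)
  have "c * f m = c * 1" using f(2)[of m] by (simp add: c_def m_def)
  then have fm: "f m = 1" using c(2) by (simp only: mult_cancel_left) simp
  have dp: "degree p = m" using qp c(2) by (simp add: m_def)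
  have "lead_coeff p = 1" unfolding dp by (simp add: cp fm)
  moreover have "coeffs_in n p" unfolding p_def by (intro coeffs_in_sum coeffs_in_monom f)
  ultimately show ?thesis using qp dp unfolding c_def m_def by blast
qed

text \<open>
  If \<open>q\<close> involved \<open>s\<close>, the pullback of its monic part \<open>p\<close> would
  not be constant and would have a zero. Being monic, \<open>p\<close> keeps a root nearby when
  \<open>y\<close> is moved slightly. As the image is open, this produces zeros of the pullback of
  \<open>q\<close> at which \<open>r\<close> is not \<open>0\<close>.
\<close>

lemma minimal_denominator_constant:
  assumes im: "openin (top_of_set (coord_space n)) (polymap n F ` coord_space n)"
    and q: "denominator q" "q \<noteq> 0" and min: "\<And>r. denominator r \<Longrightarrow> r \<noteq> 0 \<Longrightarrow> degree q \<le> degree r"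
    and al: "denominator al" "lead_coeff al = mconst \<kappa>" "\<kappa> \<noteq> 0"
  shows "degree q = 0"
proof (rule ccontr)
  assume m: "degree q \<noteq> 0"
  obtain p where p: "coeffs_in n p" "q = smult (lead_coeff q) p" "lead_coeff p = 1" "degree p = degree q"
    using denominator_monic[OF q min al] by blast
  obtain r where r: "r \<in> mpolys n" "r \<noteq> 0"
    "\<And>x s. x \<in> coord_space n \<Longrightarrow> peval (shifted x s) q s = 0 \<Longrightarrow> meval (shifted x s) r = 0"
    using minimal_denominator_zeros[OF q min] by blast
  have "\<exists>x0\<in>coord_space n. \<exists>s0. peval (shifted x0 s0) p s0 = 0"
  proof (rule ccontr)
    assume "\<not> ?thesis"
    then have "peval x (pullback p) s \<noteq> 0" if "x \<in> coord_space n" for x s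
      using that by (simp add: peval_pullback p)
    then obtain c where c: "\<And>x s. x \<in> coord_space n \<Longrightarrow> peval x (pullback p) s = c"
      using nonvanishing_constant[OF coeffs_in_pullback[OF p(1)]] by blast
    have "p - [:mconst c:] = 0"
      by (rule eq_0_if_pullback_vanishes)
        (use c in \<open>auto simp: peval_minus peval_const peval_pullback[symmetric] p intro!: coeffs_in_minus coeffs_in_const p\<close>)
    then have "p = [:mconst c:]" by simp
    then have "degree p = 0" by simp
    then show False using m p(4) by simp
  qed
  then obtain x0 s0 where x0: "x0 \<in> coord_space n" "peval (shifted x0 s0) p s0 = 0" by blast
  define y0 where "y0 = shifted x0 s0"
  obtain y1 where y1: "y1 \<in> coord_space n" "meval y1 r \<noteq> 0" using nonzero_point[OF r(1,2)] by blast
  define w where "w = (\<lambda>i. y1 i - y0 i)"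
  define Y where "Y = (\<lambda>t i. y0 i + t * w i)"
  have w: "w \<in> coord_space n" and Yc: "Y t \<in> coord_space n" for t
    using y1 shifted_coord_space[of x0 s0] by (auto simp: w_def Y_def y0_def coord_space_def)
  obtain O' where O': "open O'" "polymap n F ` coord_space n = coord_space n \<inter> O'"
    using im by (auto simp: openin_open)
  define \<Omega> where "\<Omega> = (\<lambda>z :: complex \<times> complex. \<lambda>i. Y (fst z) i + snd z * e i)"
  have "continuous_on UNIV \<Omega>" unfolding \<Omega>_def Y_def
    by (intro continuous_on_coordinatewise_then_product continuous_intros)
  then have "open (\<Omega> -` O')" using O'(1) by (simp add: continuous_on_open_vimage)
  moreover have "\<Omega> (0, s0) = polymap n F x0" by (simp add: \<Omega>_def Y_def y0_def shifted_def)
  then have "(0, s0) \<in> \<Omega> -` O'" using O'(2) x0(1) by auto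
  ultimately obtain A B where AB: "open A" "open B" "(0, s0) \<in> A \<times> B" "A \<times> B \<subseteq> \<Omega> -` O'"
    by (rule open_prod_elim)
  obtain \<delta> where \<delta>: "\<delta> > 0" "ball s0 \<delta> \<subseteq> B" using AB by (meson SigmaD2 open_contains_ball)
  have "eventually (\<lambda>t. t \<in> A) (at 0)"
    using AB by (intro eventually_at_in_open') auto
  moreover have "eventually (\<lambda>t. norm (peval (Y t) p s0) < \<delta> ^ degree p) (at 0)"
  proof -
    have cY: "continuous_on UNIV Y" unfolding Y_def
      by (intro continuous_on_coordinatewise_then_product continuous_intros)
    have "continuous_on UNIV (\<lambda>t. norm (peval (Y t) p s0))"
      unfolding peval_eq_sum[OF order_refl]
      by (intro continuous_on_norm continuous_on_sum continuous_on_mult continuous_on_const continuous_on_meval cY)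
    then have "((\<lambda>t. norm (peval (Y t) p s0)) \<longlongrightarrow> norm (peval (Y 0) p s0)) (at 0)"
      by (simp add: continuous_on_def)
    moreover have "Y 0 = y0" by (simp add: Y_def)
    ultimately show ?thesis using x0(2) \<delta>(1) by (intro order_tendstoD(2)[of _ 0]) (auto simp: y0_def)
  qed
  moreover have "eventually (\<lambda>t. meval (Y t) r \<noteq> 0) (at 0)"
  proof -
    have "finite {t. meval (Y t) r = 0}"
      unfolding Y_def by (rule finite_zeros_on_line[OF r(1), of _ 1]) (use y1 in \<open>simp add: w_def\<close>)
    then have "eventually (\<lambda>t. t \<in> - ({t. meval (Y t) r = 0} - {0})) (nhds 0)"
      by (intro eventually_nhds_in_open open_Compl finite_imp_closed finite_Diff) simp_all
    then show ?thesis unfolding eventually_at_filter by eventually_elim auto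
  qed
  ultimately have "eventually (\<lambda>t. t \<in> A \<and> norm (peval (Y t) p s0) < \<delta> ^ degree p \<and> meval (Y t) r \<noteq> 0) (at 0)"
    by eventually_elim auto
  then obtain t where t: "t \<in> A" "norm (peval (Y t) p s0) < \<delta> ^ degree p" "meval (Y t) r \<noteq> 0"
    using eventually_happens'[OF at_neq_bot] by blast
  define P where "P = map_poly (meval (Y t)) p"
  have dP: "degree P = degree p"
  proof (rule antisym)
    show "degree P \<le> degree p" unfolding P_def by (rule degree_le) (auto simp: coeff_eq_0)
    show "degree p \<le> degree P" by (intro le_degree) (simp add: P_def p(3))
  qed
  have "lead_coeff P = 1" unfolding dP by (simp add: P_def p(3))
  moreover have "norm (poly P s0) < \<delta> ^ degree P" using t(2) by (simp add: dP) (simp add: P_def peval_def)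
  ultimately obtain z where z: "poly P z = 0" "norm (z - s0) < \<delta>" using root_near_small_value \<delta>(1) by blast
  have "z \<in> B" using z(2) \<delta>(2) by (auto simp: dist_norm norm_minus_commute subset_iff)
  then have "\<Omega> (t, z) \<in> O'" using t(1) AB(4) by auto
  moreover have "\<Omega> (t, z) \<in> coord_space n" using coord_space_line[OF Yc e, of t z] by (simp add: \<Omega>_def)
  ultimately have "\<Omega> (t, z) \<in> polymap n F ` coord_space n" using O'(2) by blast
  then obtain x where x: "x \<in> coord_space n" "polymap n F x = (\<lambda>i. Y t i + z * e i)" by (auto simp: \<Omega>_def)
  have sx: "shifted x z = Y t" by (rule shifted_eq[OF x(2)])
  have "peval (shifted x z) q z = meval (Y t) (lead_coeff q) * peval (Y t) p z"
    unfolding sx by (subst p(2)) (simp add: peval_smult)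
  also have "peval (Y t) p z = 0" using z(1) by (simp add: P_def peval_def)
  finally have "meval (shifted x z) r = 0" using r(3)[OF x(1), of z] by simp
  then show False using t(3) by (simp add: sx)
qed

end

section \<open>Injective etale maps are isomorphisms\<close>

lemma max_modulus_at_0:
  fixes P :: "complex poly"
  assumes "\<rho> > 0" "\<And>s. norm s = \<rho> \<Longrightarrow> norm (poly P s) \<le> K"
  shows "norm (poly P 0) \<le> K"
proof -
  have "norm ((deriv ^^ 0) (poly P) 0) \<le> fact 0 * K / \<rho> ^ 0"
    by (rule Cauchy_inequality) (use assms in \<open>auto intro!: holomorphic_intros continuous_intros\<close>)
  then show ?thesis by simp
qed

text \<open>
  With a denominator \<open>u(y)\<close> free of \<open>s\<close>, the inverse is a polynomial in
  \<open>s\<close> on almost every line \<open>y + se\<close>. On a circle that is so large that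
  \<open>a(y + se)\<close> is bounded below, it has polynomial growth in \<open>y\<close>, and by the
  maximum principle also at \<open>s = 0\<close>.
\<close>

lemma etale_injective_polynomial_inverse:
  fixes F :: "nat \<Rightarrow> complex mpoly"
  assumes F: "\<And>i. i < n \<Longrightarrow> F i \<in> mpolys n" and et: "etale n F"
    and inj: "inj_on (polymap n F) (coord_space n)"
  shows "\<exists>a A. a \<in> mpolys n \<and> a \<noteq> 0 \<and> (\<forall>y\<in>coord_space n. meval y a \<noteq> 0 \<longrightarrow> y \<in> polymap n F ` coord_space n) \<and>
     (\<forall>i<n. A i \<in> mpolys n) \<and> (\<forall>x\<in>coord_space n. \<forall>i<n. meval (polymap n F x) (A i) = x i)"
proof -
  obtain a A where a: "a \<in> mpolys n" "a \<noteq> 0" and A: "\<And>i. i < n \<Longrightarrow> A i \<in> mpolys n"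
    and im: "\<And>y. y \<in> coord_space n \<Longrightarrow> meval y a \<noteq> 0 \<Longrightarrow> y \<in> polymap n F ` coord_space n"
    and Ax: "\<And>x i. x \<in> coord_space n \<Longrightarrow> i < n \<Longrightarrow> meval (polymap n F x) (A i) = meval (polymap n F x) a * x i"
    using rational_inverse[OF F et inj] by blast
  obtain e \<kappa> where e: "e \<in> coord_space n" and \<kappa>: "\<kappa> \<noteq> 0" "lead_coeff (along e a) = mconst \<kappa>"
    using exists_monic_direction[OF a] by blast
  interpret etale_direction n F e by unfold_locales (use F et e in auto)
  define al where "al = along e a"
  have sh: "(\<lambda>i. shifted x s i + s * e i) = polymap n F x" for x s by (auto simp: shifted_def)
  have alc: "coeffs_in n al" unfolding al_def by (rule coeffs_in_along[OF a(1)])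
  have ale: "peval y al s = meval (\<lambda>i. y i + s * e i) a" for y s unfolding al_def by (rule peval_along[OF a(1)])
  have al: "denominator al"
    unfolding denominator_def
    by (intro conjI alc exI[of _ "\<lambda>i. along e (A i)"] allI impI ballI)
      (auto simp: coeffs_in_along A ale peval_along[OF A] sh Ax)
  have al0: "al \<noteq> 0"
  proof
    assume "al = 0"
    then have "mconst \<kappa> = (0 :: complex mpoly)" using \<kappa>(2) by (simp add: al_def)
    then show False using \<kappa>(1) by (metis meval_0 meval_mconst)
  qed
  obtain q where q: "denominator q" "q \<noteq> 0" and min: "\<And>r. denominator r \<Longrightarrow> r \<noteq> 0 \<Longrightarrow> degree q \<le> degree r"
    using ex_has_least_nat[of "\<lambda>q. denominator q \<and> q \<noteq> 0" al degree] al al0 by blast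
  have "openin (top_of_set (coord_space n)) (polymap n F ` coord_space n)"
    by (rule inj_polymap_open[OF inj]) simp
  then have "degree q = 0"
    using minimal_denominator_constant[OF _ q min al] \<kappa> by (simp add: al_def)
  then obtain u where u: "q = [:u:]" by (rule degree_eq_zeroE)
  obtain B where B: "\<And>i. i < n \<Longrightarrow> coeffs_in n (B i)"
    "\<And>i x s. i < n \<Longrightarrow> x \<in> coord_space n \<Longrightarrow> peval (shifted x s) (B i) s = meval (shifted x s) u * x i"
    and uc: "coeffs_in n [:u:]"
    using q(1) unfolding denominator_def u peval_const by blast
  have un: "u \<in> mpolys n" "u \<noteq> 0" using uc[unfolded coeffs_in_def, rule_format, of 0] q(2) u by auto
  have ident: "meval y u * meval (\<lambda>k. y k + s * e k) (A i) = meval (\<lambda>k. y k + s * e k) a * peval y (B i) s" if i: "i < n" for i y s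
  proof -
    have "smult u (along e (A i)) - al * B i = 0"
    proof (rule eq_0_if_pullback_vanishes)
      show "coeffs_in n (smult u (along e (A i)) - al * B i)"
        by (intro coeffs_in_minus coeffs_in_smult coeffs_in_mult coeffs_in_along alc B un A i)
      show "peval (shifted x s) (smult u (along e (A i)) - al * B i) s = 0" if "x \<in> coord_space n" for x s
        using that i by (simp add: peval_minus peval_smult peval_mult ale peval_along[OF A] sh Ax B(2))
    qed
    then have "peval y (smult u (along e (A i)) - al * B i) s = 0" by simp
    then show ?thesis by (simp add: peval_minus peval_smult peval_mult ale peval_along[OF A[OF i]])
  qed
  have ua: "u * a \<in> mpolys n" "u * a \<noteq> 0" using un a by (auto intro: mpolys_mult)
  have "\<exists>g\<in>mpolys n. \<forall>y\<in>coord_space n. meval y (u * a) \<noteq> 0 \<longrightarrow> meval y (A i) / meval y a = meval y g" if i: "i < n" for i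
  proof -
    define R where "R = root_radius al \<kappa>"
    have Rpos: "R y \<ge> 1" for y unfolding R_def by (rule root_radius_ge_1)
    obtain C M where C: "C \<ge> 0" "\<And>y. norm (meval y (A i)) \<le> C * nrm n y ^ M"
      using poly_bounded_meval[OF A[OF i], of UNIV] by (auto simp: poly_bounded_def)
    define bnd where "bnd = (\<lambda>y. C / norm \<kappa> * (nrm n y + R y * nrm n e) ^ M)"
    have "poly_bounded n UNIV bnd"
      unfolding bnd_def R_def
      by (intro poly_bounded_mult poly_bounded_power poly_bounded_add poly_bounded_const poly_bounded_nrm poly_bounded_root_radius alc)
    then obtain D N where DN: "D \<ge> 0" "\<And>y. \<bar>bnd y\<bar> \<le> D * nrm n y ^ N" by (auto simp: poly_bounded_def)
    have fb: "norm (meval y (A i) / meval y a) \<le> bnd y" if y: "meval y (u * a) \<noteq> 0" for y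
    proof -
      have nz: "meval y u \<noteq> 0" "meval y a \<noteq> 0" using y by (auto simp: meval_mult)
      define P where "P = smult (1 / meval y u) (map_poly (meval y) (B i))"
      have Ps: "poly P s = peval y (B i) s / meval y u" for s by (simp add: P_def peval_def)
      have P0: "poly P 0 = meval y (A i) / meval y a"
        using ident[OF i, of y 0] nz by (simp add: Ps field_simps)
      have "norm (poly P s) \<le> bnd y" if s: "norm s = R y" for s
      proof -
        let ?z = "\<lambda>k. y k + s * e k"
        have "norm \<kappa> \<le> norm (meval ?z a)"
          using norm_peval_ge[of al \<kappa> y s] \<kappa> s by (simp add: al_def R_def ale[unfolded al_def])
        then have az: "meval ?z a \<noteq> 0" "norm \<kappa> \<le> norm (meval ?z a)" using \<kappa>(1) by auto
        have "poly P s = meval ?z (A i) / meval ?z a" using ident[OF i, of y s] nz az by (simp add: Ps field_simps)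
        then have "norm (poly P s) = norm (meval ?z (A i)) / norm (meval ?z a)" by (simp add: norm_divide)
        also have "\<dots> \<le> (C * nrm n ?z ^ M) / norm \<kappa>"
          using C az \<kappa>(1) by (intro frac_le) auto
        also have "nrm n ?z \<le> nrm n y + R y * nrm n e"
        proof -
          have "(\<Sum>k<n. norm (y k + s * e k)) \<le> (\<Sum>k<n. norm (y k) + R y * norm (e k))"
            by (intro sum_mono order_trans[OF norm_triangle_ineq]) (simp add: norm_mult s)
          then have "nrm n ?z \<le> nrm n y + R y * (\<Sum>k<n. norm (e k))"
            by (simp add: nrm_def sum.distrib sum_distrib_left)
          also have "R y * (\<Sum>k<n. norm (e k)) \<le> R y * nrm n e"
            using Rpos[of y] by (intro mult_left_mono) (auto simp: nrm_def)
          finally show ?thesis by simp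
        qed
        then have "(C * nrm n ?z ^ M) / norm \<kappa> \<le> (C * (nrm n y + R y * nrm n e) ^ M) / norm \<kappa>"
          using C(1) by (intro divide_right_mono mult_left_mono power_mono) auto
        finally show ?thesis by (simp add: bnd_def)
      qed
      moreover have "R y > 0" using Rpos[of y] by linarith
      ultimately have "norm (poly P 0) \<le> bnd y" by (intro max_modulus_at_0)
      then show ?thesis by (simp add: P0)
    qed
    show ?thesis
    proof (rule polynomial_if_polynomial_growth[OF ua])
      fix y v :: "nat \<Rightarrow> complex" and s assume "meval (\<lambda>k. y k + s * v k) (u * a) \<noteq> 0"
      then have "meval (\<lambda>k. y k + s * v k) a \<noteq> 0" by (simp add: meval_mult)
      then show "(\<lambda>s. meval (\<lambda>k. y k + s * v k) (A i) / meval (\<lambda>k. y k + s * v k) a) field_differentiable at s"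
        using DERIV_meval_line[OF A[OF i], of y v s] DERIV_meval_line[OF a(1), of y v s]
        by (intro field_differentiable_divide) (auto simp: field_differentiable_def)
    next
      fix y assume "meval y (u * a) \<noteq> 0"
      then show "norm (meval y (A i) / meval y a) \<le> D * nrm n y ^ N"
        using fb[of y] DN(2)[of y] by linarith
    qed
  qed
  then obtain g where g: "\<And>i. i < n \<Longrightarrow> g i \<in> mpolys n"
    "\<And>i y. i < n \<Longrightarrow> y \<in> coord_space n \<Longrightarrow> meval y (u * a) \<noteq> 0 \<Longrightarrow> meval y (A i) / meval y a = meval y (g i)" by metis
  have "meval (polymap n F x) (g i) = x i" if x: "x \<in> coord_space n" and i: "i < n" for x i
  proof -
    have m: "mcomp F (u * a) \<in> mpolys n" "mcomp F (g i) \<in> mpolys n"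
      using mcomp_mpolys[OF ua(1), of F n] mcomp_mpolys[OF g(1)[OF i], of F n] F by auto
    have "mcomp F (g i) = mvar i"
    proof (rule mpoly_eq_if_eq_off_zeros[OF m(1) _ m(2) mpolys_mvar[OF i]])
      show "mcomp F (u * a) \<noteq> 0" using mcomp_eq_0[OF F et ua(1)] ua(2) by blast
      fix x :: "nat \<Rightarrow> complex" assume x: "x \<in> coord_space n" and "meval x (mcomp F (u * a)) \<noteq> 0"
      then have nz: "meval (polymap n F x) (u * a) \<noteq> 0" by (simp add: meval_mcomp[OF ua(1)])
      then have "meval (polymap n F x) a \<noteq> 0" by (simp add: meval_mult)
      then show "meval x (mcomp F (g i)) = meval x (mvar i)"
        using g(2)[OF i polymap_coord_space nz] Ax[OF x i] by (simp add: meval_mcomp[OF g(1)[OF i]])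
    qed
    then show ?thesis using meval_mcomp[OF g(1)[OF i], of x F] by simp
  qed
  with a im g(1) show ?thesis by blast
qed

text \<open>
  Surjectivity comes for free: \<open>F \<circ> g\<close> is the identity where \<open>a \<noteq>
  0\<close>, hence everywhere.
\<close>

lemma etale_injective_isomorphism:
  fixes F :: "nat \<Rightarrow> complex mpoly"
  assumes F: "\<And>i. i < n \<Longrightarrow> F i \<in> mpolys n" and et: "etale n F"
    and inj: "inj_on (polymap n F) (coord_space n)"
  shows "polynomial_isomorphism n F"
proof -
  obtain a g where a: "a \<in> mpolys n" "a \<noteq> 0" and g: "\<And>i. i < n \<Longrightarrow> g i \<in> mpolys n"
    and im: "\<And>y. y \<in> coord_space n \<Longrightarrow> meval y a \<noteq> 0 \<Longrightarrow> y \<in> polymap n F ` coord_space n"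
    and gx: "\<And>x i. x \<in> coord_space n \<Longrightarrow> i < n \<Longrightarrow> meval (polymap n F x) (g i) = x i"
    using etale_injective_polynomial_inverse[OF F et inj] by blast
  have gF: "polymap n g (polymap n F x) = x" if "x \<in> coord_space n" for x
    by (rule coord_space_eqI[OF polymap_coord_space that]) (use gx that in \<open>simp add: polymap_def[of n g]\<close>)
  have Fg: "polymap n F (polymap n g y) = y" if y: "y \<in> coord_space n" for y
  proof (rule coord_space_eqI[OF polymap_coord_space y])
    fix i assume i: "i < n"
    have "mcomp g (F i) = mvar i"
    proof (rule mpoly_eq_if_eq_off_zeros[OF a])
      show "mcomp g (F i) \<in> mpolys n" by (rule mcomp_mpolys[OF F[OF i] g])
      fix y :: "nat \<Rightarrow> complex" assume y: "y \<in> coord_space n" "meval y a \<noteq> 0"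
      then obtain x where x: "x \<in> coord_space n" "y = polymap n F x" using im[OF y] by blast
      then have "polymap n g y = x" using gF by simp
      then show "meval y (mcomp g (F i)) = meval y (mvar i)"
        using x(2) i by (simp add: polymap_def[of n F] meval_mcomp[OF F[OF i]])
    qed (rule mpolys_mvar[OF i])
    then show "polymap n F (polymap n g y) i = y i"
      using i meval_mcomp[OF F[OF i], of y g] by (simp add: polymap_def[of n F])
  qed
  have "polymap n F ` coord_space n = coord_space n"
  proof
    show "coord_space n \<subseteq> polymap n F ` coord_space n"
    proof
      fix y :: "nat \<Rightarrow> complex" assume "y \<in> coord_space n"
      then have "y = polymap n F (polymap n g y)" using Fg by simp
      then show "y \<in> polymap n F ` coord_space n" using polymap_coord_space by blast
    qed
  qed auto
  then have "bij_betw (polymap n F) (coord_space n) (coord_space n)" using inj by (simp add: bij_betw_def)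
  moreover have "polymap n g y = inv_into (coord_space n) (polymap n F) y" if "y \<in> coord_space n" for y
    by (rule sym, rule inv_into_f_eq[OF inj]) (simp_all add: Fg that)
  ultimately show ?thesis unfolding polynomial_isomorphism_def using g by blast
qed

lemma etale_if_jacobian_nonvanishing:
  fixes F :: "nat \<Rightarrow> 'a::idom mpoly"
  assumes "\<And>x. x \<in> coord_space n \<Longrightarrow> meval x (det (jacobian_mat n F)) \<noteq> 0"
  shows "etale n F"
  unfolding etale_def
proof (intro ballI)
  fix x v :: "nat \<Rightarrow> 'a" assume x: "x \<in> coord_space n" and v: "v \<in> coord_space n"
  interpret ev: comm_ring_hom "meval x" by (rule comm_ring_hom_meval)
  have "map_mat (meval x) (jacobian_mat n F) = mat n n (\<lambda>(i, j). meval x (mpderiv j (F i)))"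
    by (rule eq_matI) (auto simp: jacobian_mat_def)
  then have "det (mat n n (\<lambda>(i, j). meval x (mpderiv j (F i)))) \<noteq> 0"
    using assms[OF x] ev.hom_det[of "jacobian_mat n F"] by simp
  then show "(\<forall>i<n. (\<Sum>j<n. meval x (mpderiv j (F i)) * v j) = 0) \<longrightarrow> v = (\<lambda>_. 0)"
    using v unfolding det_nonzero_iff_injective by blast
qed

theorem theorem1p2:
  assumes "\<And>(n::nat) (H :: nat \<Rightarrow> real mpoly) (F :: nat \<Rightarrow> real mpoly) (S :: (nat \<Rightarrow> real) set).
      n \<ge> 2 \<Longrightarrow>
      (\<And>i. i < n \<Longrightarrow> H i \<in> mpolys n) \<Longrightarrow>
      (\<And>i. i < n \<Longrightarrow> H i = 0 \<or> homogeneous 3 (H i)) \<Longrightarrow>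
      nilpotent_mat (jacobian_mat n H) \<Longrightarrow>
      (\<And>i. i < n \<Longrightarrow> F i = - mvar i + H i) \<Longrightarrow>
      S = nonproper_set (Euclidean_space n) (Euclidean_space n) (polymap n F) \<Longrightarrow>
      S = {} \<or> real_codim n S \<ge> 2 \<Longrightarrow>
      inj_on (polymap n F) (coord_space n)"
  shows "\<forall>(n::nat) (Y :: nat \<Rightarrow> complex mpoly).
      (\<forall>i<n. Y i \<in> mpolys n) \<longrightarrow>
      (\<forall>x\<in>coord_space n. meval x (det (jacobian_mat n Y)) \<noteq> 0) \<longrightarrow>
      polynomial_isomorphism n Y"
proof (intro allI impI)
  fix n and Y :: "nat \<Rightarrow> complex mpoly"
  assume "\<forall>i<n. Y i \<in> mpolys n" and J: "\<forall>x\<in>coord_space n. meval x (det (jacobian_mat n Y)) \<noteq> 0"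
  then have Y: "Y i \<in> mpolys n" if "i < n" for i using that by blast
  have et: "etale n Y" by (rule etale_if_jacobian_nonvanishing) (use J in blast)
  have real_cubic_injectivity
    unfolding real_cubic_injectivity_def by (intro allI impI assms) auto
  then have inj: "inj_on (polymap n Y) (coord_space n)" by (rule inj_etale[OF _ Y et])
  show "polynomial_isomorphism n Y" by (rule etale_injective_isomorphism[OF Y et inj])
qed

end
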